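(* Let $(R,\mathfrak{m},k)$ be a commutative Noetherian local ring and let $\{x,y\}$ be a pair of exact zerodivisors of $R$ such that the local ring $R/(x)$ is G-regular. Then for any integer $n$ with $0<n<\operatorname{s}(x,y)$ there exists a family $\{0 \to (R/(x))^n \to M_r \to R/(y) \to 0\}_{r\in R}$ of exact sequences of $R$-modules such that each $M_r$ is indecomposable and such that, whenever $p,q\in R$ satisfy $M_p\cong M_q$, one has $\overline p=\overline q$ in $k=R/\mathfrak{m}$.
   Context: A pair of exact zerodivisors of $R$ is a pair of elements $x,y\in\mathfrak{m}$ with $(0:x)=(y)$ and $(0:y)=(x)$. A finitely generated module $M$ over a local ring $A$ is totally reflexive if $M\to M^{**}$ is an isomorphism and $\operatorname{Ext}^i_A(M,A)=0=\operatorname{Ext}^i_A(M^*,A)$ for all $i>0$, where $(-)^*=\operatorname{Hom}_A(-,A)$; $A$ is G-regular if every totally reflexive $A$-module is free. For $x,y\in\mathfrak{m}$, $\operatorname{s}(x,y)\in\{0,1,2,\dots\}\cup\{\infty\}$ is the supremum of the nonnegative integers $n$ such that there exists an ideal $I$ of $R$ whose image $I(R/(x,y))$ has minimal number of generators (as an $R/(x,y)$-module) equal to $n$. *)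

theory Defs
  imports "HOL-Algebra.Module" "HOL-Algebra.QuotRing" "HOL-Library.Extended_Nat"
begin

definition noetherian_ring :: "('a, 'b) ring_scheme \<Rightarrow> bool" where
  "noetherian_ring A \<longleftrightarrow> cring A \<and>
     (\<forall>I. ideal I A \<longrightarrow> (\<exists>S. finite S \<and> S \<subseteq> carrier A \<and> I = Idl\<^bsub>A\<^esub> S))"

definition local_ring :: "('a, 'b) ring_scheme \<Rightarrow> bool" where
  "local_ring A \<longleftrightarrow> cring A \<and> (\<exists>!m. maximalideal m A)"

definition max_ideal :: "('a, 'b) ring_scheme \<Rightarrow> 'a set" where
  "max_ideal A = (THE m. maximalideal m A)"

definition ann :: "('a, 'b) ring_scheme \<Rightarrow> 'a \<Rightarrow> 'a set" where
  "ann A a = {b \<in> carrier A. b \<otimes>\<^bsub>A\<^esub> a = \<zero>\<^bsub>A\<^esub>}"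

definition exact_zerodivisors :: "('a, 'b) ring_scheme \<Rightarrow> 'a \<Rightarrow> 'a \<Rightarrow> bool" where
  "exact_zerodivisors A x y \<longleftrightarrow> x \<in> max_ideal A \<and> y \<in> max_ideal A \<and>
     ann A x = PIdl\<^bsub>A\<^esub> y \<and> ann A y = PIdl\<^bsub>A\<^esub> x"

definition ring_mod :: "('r, 'e) ring_scheme \<Rightarrow> ('r, 'r) module" where
  "ring_mod A = \<lparr>carrier = carrier A, mult = mult A, one = one A, zero = zero A,
                 add = add A, smult = mult A\<rparr>"

definition ideal_mod :: "('r, 'e) ring_scheme \<Rightarrow> 'r set \<Rightarrow> ('r, 'r) module" where
  "ideal_mod A J = (ring_mod A)\<lparr>carrier := J\<rparr>"

definition quot_mod :: "('r, 'e) ring_scheme \<Rightarrow> 'r set \<Rightarrow> ('r, 'r set) module" where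
  "quot_mod A I = \<lparr>carrier = a_rcosets\<^bsub>A\<^esub> I, mult = rcoset_mult A I,
     one = I +>\<^bsub>A\<^esub> \<one>\<^bsub>A\<^esub>, zero = I, add = set_add A,
     smult = (\<lambda>a X. rcoset_mult A I (I +>\<^bsub>A\<^esub> a) X)\<rparr>"

definition pow_mod :: "('r, 'c, 'm) module_scheme \<Rightarrow> nat \<Rightarrow> ('r, nat \<Rightarrow> 'c) module" where
  "pow_mod M n = \<lparr>carrier = {..<n} \<rightarrow>\<^sub>E carrier M,
     mult = (\<lambda>u v. restrict (\<lambda>i. u i \<otimes>\<^bsub>M\<^esub> v i) {..<n}),
     one = restrict (\<lambda>i. \<one>\<^bsub>M\<^esub>) {..<n},
     zero = restrict (\<lambda>i. \<zero>\<^bsub>M\<^esub>) {..<n},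
     add = (\<lambda>u v. restrict (\<lambda>i. u i \<oplus>\<^bsub>M\<^esub> v i) {..<n}),
     smult = (\<lambda>a v. restrict (\<lambda>i. a \<odot>\<^bsub>M\<^esub> v i) {..<n})\<rparr>"

definition free_mod :: "('r, 'e) ring_scheme \<Rightarrow> nat \<Rightarrow> ('r, nat \<Rightarrow> 'r) module" where
  "free_mod A n = pow_mod (ring_mod A) n"

definition mod_hom :: "('r, 'e) ring_scheme \<Rightarrow> ('r, 'c, 'm) module_scheme \<Rightarrow>
    ('r, 'd, 'n) module_scheme \<Rightarrow> ('c \<Rightarrow> 'd) set" where
  "mod_hom A M N = {f. f \<in> carrier M \<rightarrow> carrier N \<and>
     (\<forall>u\<in>carrier M. \<forall>v\<in>carrier M. f (u \<oplus>\<^bsub>M\<^esub> v) = f u \<oplus>\<^bsub>N\<^esub> f v) \<and>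
     (\<forall>a\<in>carrier A. \<forall>u\<in>carrier M. f (a \<odot>\<^bsub>M\<^esub> u) = a \<odot>\<^bsub>N\<^esub> f u)}"

definition mod_iso :: "('r, 'e) ring_scheme \<Rightarrow> ('r, 'c, 'm) module_scheme \<Rightarrow>
    ('r, 'd, 'n) module_scheme \<Rightarrow> bool" where
  "mod_iso A M N \<longleftrightarrow> (\<exists>f \<in> mod_hom A M N. bij_betw f (carrier M) (carrier N))"

definition generates :: "('r, 'e) ring_scheme \<Rightarrow> ('r, 'c, 'm) module_scheme \<Rightarrow>
    nat \<Rightarrow> (nat \<Rightarrow> 'c) \<Rightarrow> bool" where
  "generates A M n v \<longleftrightarrow> v \<in> {..<n} \<rightarrow> carrier M \<and>
     (\<forall>m\<in>carrier M. \<exists>c\<in>{..<n} \<rightarrow> carrier A. m = (\<Oplus>\<^bsub>M\<^esub>i\<in>{..<n}. c i \<odot>\<^bsub>M\<^esub> v i))"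

definition fin_gen :: "('r, 'e) ring_scheme \<Rightarrow> ('r, 'c, 'm) module_scheme \<Rightarrow> bool" where
  "fin_gen A M \<longleftrightarrow> (\<exists>n v. generates A M n v)"

definition mu :: "('r, 'e) ring_scheme \<Rightarrow> ('r, 'c, 'm) module_scheme \<Rightarrow> nat" where
  "mu A M = (LEAST n. \<exists>v. generates A M n v)"

text \<open>M is free (with a finite basis; the modules considered are finitely generated).\<close>
definition free :: "('r, 'e) ring_scheme \<Rightarrow> ('r, 'c, 'm) module_scheme \<Rightarrow> bool" where
  "free A M \<longleftrightarrow> (\<exists>(n::nat) v. v \<in> {..<n} \<rightarrow> carrier M \<and>
     (\<forall>m\<in>carrier M. \<exists>!c. c \<in> {..<n} \<rightarrow>\<^sub>E carrier A \<and>
        m = (\<Oplus>\<^bsub>M\<^esub>i\<in>{..<n}. c i \<odot>\<^bsub>M\<^esub> v i)))"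

definition indecomposable :: "('r, 'e) ring_scheme \<Rightarrow> ('r, 'c, 'm) module_scheme \<Rightarrow> bool" where
  "indecomposable A M \<longleftrightarrow> carrier M \<noteq> {\<zero>\<^bsub>M\<^esub>} \<and>
     (\<forall>P Q. submodule P A M \<and> submodule Q A M \<and> P \<inter> Q = {\<zero>\<^bsub>M\<^esub>} \<and>
        P <+>\<^bsub>M\<^esub> Q = carrier M \<longrightarrow> P = {\<zero>\<^bsub>M\<^esub>} \<or> Q = {\<zero>\<^bsub>M\<^esub>})"

definition short_exact :: "('r, 'e) ring_scheme \<Rightarrow> ('r, 'b, 'l) module_scheme \<Rightarrow>
    ('r, 'c, 'm) module_scheme \<Rightarrow> ('r, 'd, 'n) module_scheme \<Rightarrow> ('b \<Rightarrow> 'c) \<Rightarrow> ('c \<Rightarrow> 'd) \<Rightarrow> bool" where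
  "short_exact A L M N f g \<longleftrightarrow> f \<in> mod_hom A L M \<and> g \<in> mod_hom A M N \<and>
     inj_on f (carrier L) \<and> f ` carrier L = {m \<in> carrier M. g m = \<zero>\<^bsub>N\<^esub>} \<and>
     g ` carrier M = carrier N"

definition dual_mod :: "('r, 'e) ring_scheme \<Rightarrow> ('r, 'c, 'm) module_scheme \<Rightarrow> ('r, 'c \<Rightarrow> 'r) module" where
  "dual_mod A M = \<lparr>carrier = mod_hom A M (ring_mod A) \<inter> extensional (carrier M),
     mult = (\<lambda>f g. restrict (\<lambda>u. f u \<otimes>\<^bsub>A\<^esub> g u) (carrier M)),
     one = restrict (\<lambda>u. \<one>\<^bsub>A\<^esub>) (carrier M),
     zero = restrict (\<lambda>u. \<zero>\<^bsub>A\<^esub>) (carrier M),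
     add = (\<lambda>f g. restrict (\<lambda>u. f u \<oplus>\<^bsub>A\<^esub> g u) (carrier M)),
     smult = (\<lambda>a f. restrict (\<lambda>u. a \<otimes>\<^bsub>A\<^esub> f u) (carrier M))\<rparr>"

definition bidual_map :: "('r, 'e) ring_scheme \<Rightarrow> ('r, 'c, 'm) module_scheme \<Rightarrow> 'c \<Rightarrow> (('c \<Rightarrow> 'r) \<Rightarrow> 'r)" where
  "bidual_map A M = (\<lambda>u. restrict (\<lambda>f. f u) (carrier (dual_mod A M)))"

definition free_resolution :: "('r, 'e) ring_scheme \<Rightarrow> ('r, 'c, 'm) module_scheme \<Rightarrow>
    (nat \<Rightarrow> nat) \<Rightarrow> (nat \<Rightarrow> (nat \<Rightarrow> 'r) \<Rightarrow> (nat \<Rightarrow> 'r)) \<Rightarrow> ((nat \<Rightarrow> 'r) \<Rightarrow> 'c) \<Rightarrow> bool" where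
  "free_resolution A M b d \<epsilon> \<longleftrightarrow>
     \<epsilon> \<in> mod_hom A (free_mod A (b 0)) M \<and> \<epsilon> ` carrier (free_mod A (b 0)) = carrier M \<and>
     (\<forall>i. d i \<in> mod_hom A (free_mod A (b (Suc i))) (free_mod A (b i))) \<and>
     d 0 ` carrier (free_mod A (b 1)) = {u \<in> carrier (free_mod A (b 0)). \<epsilon> u = \<zero>\<^bsub>M\<^esub>} \<and>
     (\<forall>i. d (Suc i) ` carrier (free_mod A (b (Suc (Suc i)))) =
          {u \<in> carrier (free_mod A (b (Suc i))). d i u = \<zero>\<^bsub>free_mod A (b i)\<^esub>})"

text \<open>Ext^{j+1}_A(M, A) = 0: the cohomology of Hom_A(F, A) at F_{j+1}* vanishes,
  i.e. every phi in F_{j+1}* with phi o d_{j+1} = 0 is of the form psi o d_j with psi in F_j*.\<close>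
definition Ext_succ_zero :: "('r, 'e) ring_scheme \<Rightarrow> ('r, 'c, 'm) module_scheme \<Rightarrow> nat \<Rightarrow> bool" where
  "Ext_succ_zero A M j \<longleftrightarrow> (\<exists>b d \<epsilon>. free_resolution A M b d \<epsilon> \<and>
     (\<forall>\<phi> \<in> carrier (dual_mod A (free_mod A (b (Suc j)))).
        (\<forall>u \<in> carrier (free_mod A (b (Suc (Suc j)))). \<phi> (d (Suc j) u) = \<zero>\<^bsub>A\<^esub>) \<longrightarrow>
        (\<exists>\<psi> \<in> carrier (dual_mod A (free_mod A (b j))).
           \<forall>u \<in> carrier (free_mod A (b (Suc j))). \<phi> u = \<psi> (d j u))))"

definition totally_reflexive :: "('r, 'e) ring_scheme \<Rightarrow> ('r, 'c, 'm) module_scheme \<Rightarrow> bool" where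
  "totally_reflexive A M \<longleftrightarrow> Module.module A M \<and> fin_gen A M \<and>
     bidual_map A M \<in> mod_hom A M (dual_mod A (dual_mod A M)) \<and>
     bij_betw (bidual_map A M) (carrier M) (carrier (dual_mod A (dual_mod A M))) \<and>
     (\<forall>j. Ext_succ_zero A M j) \<and> (\<forall>j. Ext_succ_zero A (dual_mod A M) j)"

text \<open>G-regular: every totally reflexive A-module is free. Modules are taken with carriers
  of type (nat => 'r) set, which is large enough to contain an isomorphic copy
  (a quotient A^n/N, elements = cosets) of every finitely generated A-module.\<close>
definition G_regular :: "('r, 'e) ring_scheme \<Rightarrow> bool" where
  "G_regular A \<longleftrightarrow> (\<forall>M :: ('r, (nat \<Rightarrow> 'r) set) module. totally_reflexive A M \<longrightarrow> free A M)"

definition s_inv :: "('a, 'b) ring_scheme \<Rightarrow> 'a \<Rightarrow> 'a \<Rightarrow> enat" where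
  "s_inv R x y = (let J = Idl\<^bsub>R\<^esub> {x, y}; Q = R Quot J in
     Sup {enat (mu Q (ideal_mod Q ((\<lambda>a. J +>\<^bsub>R\<^esub> a) ` I))) | I. ideal I R})"

end

theory Submission
  imports Defs
begin

text \<open>
  \<open>M_r\<close> is presented by generators \<open>e_0, \<dots>, e_{n-1}, f\<close> and relations \<open>x e_i = 0\<close> and
  \<open>y f = \<Sigma> z_i e_i\<close>, where \<open>z_0 = a_0 + r a_n\<close> and \<open>z_i = a_i\<close> for \<open>0 < i < n\<close>; here \<open>a_0, \<dots>, a_n\<close>
  are independent modulo \<open>\<mm>\<close> as generators of an ideal of \<open>R/(x,y)\<close>. The presentation matrix \<open>T\<close> and
  the matrix \<open>S\<close> obtained from it by exchanging \<open>x\<close> and \<open>y\<close> satisfy \<open>ker T = im S\<close> and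
  \<open>ker S = im T\<close>, and so do their transposes, so \<open>M_r\<close> is totally reflexive over \<open>R\<close>.

  If \<open>M_r = P \<oplus> Q\<close>, then one summand, say \<open>P\<close>, maps onto \<open>R/(y)\<close>, and \<open>Q\<close> is generated by the images
  of the \<open>e_i\<close>, hence killed by \<open>x\<close>. As \<open>R/(x) \<cong> y R\<close>, functionals on \<open>Q\<close> with values in \<open>R/(x)\<close> and
  in \<open>R\<close> agree, and dimension shifting shows that \<open>Q\<close> is totally reflexive over \<open>R/(x)\<close>; so it is
  free. If \<open>Q \<noteq> 0\<close>, a coordinate functional of \<open>Q\<close> turns the relation \<open>y f = \<Sigma> z_i e_i\<close> into a
  relation \<open>\<Sigma> c_i z_i \<in> (x,y)\<close> in which some \<open>c_i\<close> is a unit, which contradicts independence.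

  An isomorphism \<open>M_p \<cong> M_q\<close> forces the ideals \<open>(x, y, z_0, \<dots>, z_{n-1})\<close> of entries of the two
  presentation matrices to agree modulo \<open>\<mm>\<close> times the larger ideal \<open>(x, y, a_0, \<dots>, a_n)\<close>, and
  comparing the coefficients of \<open>a_0\<close> and \<open>a_n\<close> gives \<open>p \<equiv> q\<close> modulo \<open>\<mm>\<close>.
\<close>

subsection \<open>Homomorphisms and free modules\<close>

text \<open>The obstacle is the change of rings. Vanishing of Ext is known over R, from a 2-periodic
  complete resolution, while G-regularity asks for it over R/(x), whose free modules are no longer
  free over R. In place of long exact sequences, Ext is encoded as the obstruction to extending
  functionals from a syzygy inside a finite free module, so that every comparison is made by maps
  between finite free modules.

  The strict inequality n < s(x,y) supplies n + 1 independent elements, one more than the entries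
  z_i call for; the spare a_n is the direction in which r moves the module. Since n > 0 there are at
  least two of them, and the trivial relation a_i a_j = a_j a_i then forces every a_i into the
  maximal ideal. Hence all relations of M_r have entries in the maximal ideal, which the comparison
  of M_p with M_q uses.\<close>

lemma mod_homI:
  assumes "\<And>u. u \<in> carrier M \<Longrightarrow> f u \<in> carrier N"
    and "\<And>u v. u \<in> carrier M \<Longrightarrow> v \<in> carrier M \<Longrightarrow> f (u \<oplus>\<^bsub>M\<^esub> v) = f u \<oplus>\<^bsub>N\<^esub> f v"
    and "\<And>a u. a \<in> carrier A \<Longrightarrow> u \<in> carrier M \<Longrightarrow> f (a \<odot>\<^bsub>M\<^esub> u) = a \<odot>\<^bsub>N\<^esub> f u"
  shows "f \<in> mod_hom A M N"
  using assms by (auto simp: mod_hom_def)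

lemma mod_homD:
  assumes "f \<in> mod_hom A M N"
  shows mod_hom_closed: "u \<in> carrier M \<Longrightarrow> f u \<in> carrier N"
    and mod_hom_add: "u \<in> carrier M \<Longrightarrow> v \<in> carrier M \<Longrightarrow> f (u \<oplus>\<^bsub>M\<^esub> v) = f u \<oplus>\<^bsub>N\<^esub> f v"
    and mod_hom_smult: "a \<in> carrier A \<Longrightarrow> u \<in> carrier M \<Longrightarrow> f (a \<odot>\<^bsub>M\<^esub> u) = a \<odot>\<^bsub>N\<^esub> f u"
  using assms by (auto simp: mod_hom_def)

lemma mod_hom_zero:
  assumes "Module.module A M" "Module.module A N" "f \<in> mod_hom A M N"
  shows "f \<zero>\<^bsub>M\<^esub> = \<zero>\<^bsub>N\<^esub>"
proof -
  interpret M: Module.module A M by fact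
  interpret N: Module.module A N by fact
  have "f (\<zero>\<^bsub>A\<^esub> \<odot>\<^bsub>M\<^esub> \<zero>\<^bsub>M\<^esub>) = \<zero>\<^bsub>A\<^esub> \<odot>\<^bsub>N\<^esub> f \<zero>\<^bsub>M\<^esub>"
    by (rule mod_hom_smult[OF assms(3)]) auto
  moreover have "f \<zero>\<^bsub>M\<^esub> \<in> carrier N" by (rule mod_hom_closed[OF assms(3)]) auto
  ultimately show ?thesis by simp
qed

lemma mod_hom_neg:
  assumes "Module.module A M" "Module.module A N" "f \<in> mod_hom A M N" "u \<in> carrier M"
  shows "f (\<ominus>\<^bsub>M\<^esub> u) = \<ominus>\<^bsub>N\<^esub> f u"
proof -
  interpret M: Module.module A M by fact
  interpret N: Module.module A N by fact
  have "f (\<ominus>\<^bsub>M\<^esub> u) \<oplus>\<^bsub>N\<^esub> f u = \<zero>\<^bsub>N\<^esub>"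
    using mod_hom_add[OF assms(3), of "\<ominus>\<^bsub>M\<^esub> u" u] assms(4) mod_hom_zero[OF assms(1-3)]
    by (simp add: M.l_neg)
  thus ?thesis
    by (metis M.a_inv_closed N.minus_equality assms(3,4) mod_hom_closed)
qed

lemma mod_hom_minus:
  assumes "Module.module A M" "Module.module A N" "f \<in> mod_hom A M N" "u \<in> carrier M" "v \<in> carrier M"
  shows "f (u \<ominus>\<^bsub>M\<^esub> v) = f u \<ominus>\<^bsub>N\<^esub> f v"
proof -
  interpret M: Module.module A M by fact
  show ?thesis
    using assms by (simp add: a_minus_def mod_hom_add[OF assms(3)] mod_hom_neg[OF assms(1-3)])
qed

lemma mod_hom_finsum:
  assumes "Module.module A M" "Module.module A N" "f \<in> mod_hom A M N" "h \<in> I \<rightarrow> carrier M"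
  shows "f (finsum M h I) = finsum N (\<lambda>i. f (h i)) I"
proof (cases "finite I")
  case True
  interpret M: Module.module A M by fact
  interpret N: Module.module A N by fact
  show ?thesis using True assms(4)
  proof (induction I)
    case empty
    show ?case using mod_hom_zero[OF assms(1-3)] by simp
  next
    case (insert i I)
    have c: "f (h j) \<in> carrier N" if "j \<in> insert i I" for j
      using insert.prems that mod_hom_closed[OF assms(3)] by auto
    have "f (finsum M h (insert i I)) = f (h i \<oplus>\<^bsub>M\<^esub> finsum M h I)"
      using insert by (subst M.finsum_insert) auto
    also have "\<dots> = f (h i) \<oplus>\<^bsub>N\<^esub> f (finsum M h I)"
      using insert.prems by (intro mod_hom_add[OF assms(3)] M.finsum_closed) auto
    also have "\<dots> = finsum N (\<lambda>i. f (h i)) (insert i I)"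
      using insert c by (subst N.finsum_insert) (auto simp: Pi_def)
    finally show ?case .
  qed
next
  case False
  interpret M: Module.module A M by fact
  interpret N: Module.module A N by fact
  show ?thesis using False mod_hom_zero[OF assms(1-3)] by simp
qed

lemma mod_hom_comp:
  assumes "f \<in> mod_hom A L M" "g \<in> mod_hom A M N"
  shows "(\<lambda>u. g (f u)) \<in> mod_hom A L N"
  using assms by (auto simp: mod_hom_def Pi_def)

lemma mod_hom_id: "(\<lambda>u. u) \<in> mod_hom A M M"
  by (auto simp: mod_hom_def)

lemma mod_hom_plus:
  assumes "Module.module A N" "f \<in> mod_hom A M N" "g \<in> mod_hom A M N"
  shows "(\<lambda>u. f u \<oplus>\<^bsub>N\<^esub> g u) \<in> mod_hom A M N"
proof -
  interpret N: Module.module A N by fact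
  show ?thesis using assms(2,3)
    by (auto simp: mod_hom_def Pi_def N.smult_r_distr N.a_ac)
qed

lemma mod_hom_uminus:
  assumes "Module.module A N" "f \<in> mod_hom A M N"
  shows "(\<lambda>u. \<ominus>\<^bsub>N\<^esub> f u) \<in> mod_hom A M N"
proof -
  interpret N: Module.module A N by fact
  show ?thesis using assms(2)
    by (auto simp: mod_hom_def Pi_def N.minus_add N.smult_r_minus)
qed

lemma mod_hom_diff:
  assumes "Module.module A N" "f \<in> mod_hom A M N" "g \<in> mod_hom A M N"
  shows "(\<lambda>u. f u \<ominus>\<^bsub>N\<^esub> g u) \<in> mod_hom A M N"
  unfolding a_minus_def by (intro mod_hom_plus mod_hom_uminus assms)

lemma mod_hom_scale:
  assumes "Module.module A N" "a \<in> carrier A" "f \<in> mod_hom A M N"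
  shows "(\<lambda>u. a \<odot>\<^bsub>N\<^esub> f u) \<in> mod_hom A M N"
proof -
  interpret N: Module.module A N by fact
  show ?thesis using assms(2,3)
    by (auto simp: mod_hom_def Pi_def N.smult_r_distr N.smult_assoc1[symmetric] N.R.m_comm)
qed

lemma mod_hom_restrict_iff: "restrict f (carrier M) \<in> mod_hom A M N \<longleftrightarrow> f \<in> mod_hom A M N"
  if "Module.module A M"
proof -
  interpret M: Module.module A M by fact
  show ?thesis by (auto simp: mod_hom_def Pi_def)
qed

lemma mod_hom_sub: "f \<in> mod_hom A M N \<Longrightarrow> K \<subseteq> carrier M \<Longrightarrow> f \<in> mod_hom A (M\<lparr>carrier := K\<rparr>) N"
  by (auto simp: mod_hom_def subset_iff Pi_def)

lemma mod_hom_into_sub: "f \<in> mod_hom A L (M\<lparr>carrier := K\<rparr>) \<longleftrightarrow> f \<in> mod_hom A L M \<and> f \<in> carrier L \<rightarrow> K"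
  if "K \<subseteq> carrier M"
  using that by (auto simp: mod_hom_def)

lemma submodule_kernel:
  assumes "Module.module A M" "Module.module A N" "f \<in> mod_hom A M N"
  shows "submodule {u \<in> carrier M. f u = \<zero>\<^bsub>N\<^esub>} A M"
proof -
  interpret M: Module.module A M by fact
  interpret N: Module.module A N by fact
  show ?thesis
    by (rule M.submoduleI)
       (auto simp: mod_hom_zero[OF assms] mod_hom_neg[OF assms] mod_homD[OF assms(3)])
qed

lemma submodule_image:
  assumes "Module.module A M" "Module.module A N" "f \<in> mod_hom A M N" "submodule K A M"
  shows "submodule (f ` K) A N"
proof -
  interpret M: Module.module A M by fact
  interpret N: Module.module A N by fact
  note K = M.submoduleE[OF assms(4)]
  have KM: "\<And>k. k \<in> K \<Longrightarrow> k \<in> carrier M" using K by auto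
  have z: "\<zero>\<^bsub>M\<^esub> \<in> K"
    using K(2) K(4)[OF M.R.zero_closed] KM by fastforce
  show ?thesis
  proof (rule N.submoduleI)
    show "f ` K \<subseteq> carrier N" using KM mod_hom_closed[OF assms(3)] by auto
    show "\<zero>\<^bsub>N\<^esub> \<in> f ` K" using z mod_hom_zero[OF assms(1-3)] by (metis imageI)
    show "\<ominus>\<^bsub>N\<^esub> a \<in> f ` K" if "a \<in> f ` K" for a
      using that KM K(3) by (auto simp: mod_hom_neg[OF assms(1-3), symmetric])
    show "a \<oplus>\<^bsub>N\<^esub> b \<in> f ` K" if "a \<in> f ` K" "b \<in> f ` K" for a b
      using that KM K(5) by (auto simp: mod_hom_add[OF assms(3), symmetric])
    show "a \<odot>\<^bsub>N\<^esub> b \<in> f ` K" if "a \<in> carrier A" "b \<in> f ` K" for a b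
      using that KM K(4) by (auto simp: mod_hom_smult[OF assms(3), symmetric])
  qed
qed

lemma submodule_range:
  assumes "Module.module A M" "Module.module A N" "f \<in> mod_hom A M N"
  shows "submodule (f ` carrier M) A N"
  by (rule submodule_image[OF assms module.carrier_is_submodule[OF assms(1)]])

lemma submodule_zero_closed:
  assumes "Module.module A M" "submodule K A M" shows "\<zero>\<^bsub>M\<^esub> \<in> K"
  using submodule_image[OF assms(1,1) mod_hom_id assms(2)]
  by (metis assms(2) submodule.axioms(1) subgroup.one_closed monoid.select_convs(2))

lemma submodule_finsum:
  assumes "Module.module A M" "submodule K A M" "h \<in> I \<rightarrow> K"
  shows "finsum M h I \<in> K"
proof -
  interpret M: Module.module A M by fact
  note K = M.submoduleE[OF assms(2)]
  note z = submodule_zero_closed[OF assms(1,2)]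
  show ?thesis
  proof (cases "finite I")
    case True
    thus ?thesis using assms(3)
    proof (induction I)
      case (insert i I)
      have "h \<in> insert i I \<rightarrow> carrier M" using insert.prems K(1) by auto
      thus ?case using insert K(5) by (subst M.finsum_insert) auto
    qed (simp add: z)
  qed (simp add: z)
qed

lemma module_ring_mod: "cring A \<Longrightarrow> Module.module A (ring_mod A)"
proof -
  assume "cring A"
  then interpret A: cring A .
  show ?thesis
    by (rule moduleI, unfold_locales)
       (auto simp: ring_mod_def A.a_ac A.m_ac A.l_distr A.r_distr Units_def
             intro: A.l_neg A.r_neg A.a_inv_closed)
qed
lemma ring_mod_simps [simp]:
  "carrier (ring_mod A) = carrier A" "zero (ring_mod A) = zero A" "add (ring_mod A) = add A"
  "smult (ring_mod A) = mult A" "one (ring_mod A) = one A" "mult (ring_mod A) = mult A"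
  by (simp_all add: ring_mod_def)

lemma finsum_ring_mod: "finsum (ring_mod A) = finsum A"
  by (simp add: finsum_def fun_eq_iff finprod_def)

lemma a_inv_ring_mod: "a_inv (ring_mod A) = a_inv A"
  by (simp add: a_inv_def fun_eq_iff m_inv_def)

lemma module_pow_mod:
  assumes "Module.module A M" shows "Module.module A (pow_mod M n)"
proof -
  interpret M: Module.module A M by fact
  have inv: "\<exists>y\<in>carrier (pow_mod M n). y \<oplus>\<^bsub>pow_mod M n\<^esub> x = \<zero>\<^bsub>pow_mod M n\<^esub>"
    if "x \<in> carrier (pow_mod M n)" for x
    by (rule bexI[of _ "restrict (\<lambda>i. \<ominus>\<^bsub>M\<^esub> x i) {..<n}"])
       (use that in \<open>auto simp: pow_mod_def PiE_def Pi_def M.l_neg intro!: restrict_ext\<close>)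
  show ?thesis
  proof (rule moduleI[OF M.R.is_cring abelian_groupI])
    fix x y z
    assume "x \<in> carrier (pow_mod M n)" "y \<in> carrier (pow_mod M n)" "z \<in> carrier (pow_mod M n)"
    thus "x \<oplus>\<^bsub>pow_mod M n\<^esub> y \<oplus>\<^bsub>pow_mod M n\<^esub> z = x \<oplus>\<^bsub>pow_mod M n\<^esub> (y \<oplus>\<^bsub>pow_mod M n\<^esub> z)"
      by (auto simp: pow_mod_def PiE_def Pi_def fun_eq_iff M.a_assoc)
  next
    fix x y
    assume "x \<in> carrier (pow_mod M n)" "y \<in> carrier (pow_mod M n)"
    thus "x \<oplus>\<^bsub>pow_mod M n\<^esub> y = y \<oplus>\<^bsub>pow_mod M n\<^esub> x"
      by (auto simp: pow_mod_def PiE_def Pi_def fun_eq_iff M.a_comm)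
  qed (use inv in \<open>auto simp: pow_mod_def PiE_def Pi_def fun_eq_iff extensional_def
         M.smult_l_distr M.smult_r_distr M.smult_assoc1\<close>)
qed

lemma module_free_mod: "cring A \<Longrightarrow> Module.module A (free_mod A n)"
  unfolding free_mod_def by (intro module_pow_mod module_ring_mod)

lemma free_mod_simps:
  "carrier (free_mod A n) = {..<n} \<rightarrow>\<^sub>E carrier A"
  "zero (free_mod A n) = restrict (\<lambda>i. \<zero>\<^bsub>A\<^esub>) {..<n}"
  "add (free_mod A n) = (\<lambda>u v. restrict (\<lambda>i. u i \<oplus>\<^bsub>A\<^esub> v i) {..<n})"
  "smult (free_mod A n) = (\<lambda>a v. restrict (\<lambda>i. a \<otimes>\<^bsub>A\<^esub> v i) {..<n})"
  by (simp_all add: free_mod_def pow_mod_def)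

lemma free_mod_nth:
  assumes "i < n"
  shows "u \<in> carrier (free_mod A n) \<Longrightarrow> u i \<in> carrier A"
    and "\<zero>\<^bsub>free_mod A n\<^esub> i = \<zero>\<^bsub>A\<^esub>"
    and "(u \<oplus>\<^bsub>free_mod A n\<^esub> v) i = u i \<oplus>\<^bsub>A\<^esub> v i"
    and "(a \<odot>\<^bsub>free_mod A n\<^esub> v) i = a \<otimes>\<^bsub>A\<^esub> v i"
  using assms by (auto simp: free_mod_simps)

lemma free_mod_eqI:
  assumes "u \<in> carrier (free_mod A n)" "v \<in> carrier (free_mod A n)" "\<And>i. i < n \<Longrightarrow> u i = v i"
  shows "u = v"
  using assms by (auto simp: free_mod_simps intro: PiE_ext)

lemma free_mod_memI: "(\<And>i. i < n \<Longrightarrow> f i \<in> carrier A) \<Longrightarrow> restrict f {..<n} \<in> carrier (free_mod A n)"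
  by (auto simp: free_mod_simps)

lemma free_mod_coord: "i < n \<Longrightarrow> (\<lambda>u. u i) \<in> mod_hom A (free_mod A n) (ring_mod A)"
  by (auto simp: mod_hom_def free_mod_nth)

lemma free_mod_neg_nth:
  assumes "cring A" "i < n" "u \<in> carrier (free_mod A n)"
  shows "(\<ominus>\<^bsub>free_mod A n\<^esub> u) i = \<ominus>\<^bsub>A\<^esub> u i"
  using mod_hom_neg[OF module_free_mod module_ring_mod free_mod_coord, OF assms(1,1) assms(2,3)]
  by (simp add: a_inv_ring_mod)

lemma free_mod_minus_nth:
  assumes "cring A" "i < n" "u \<in> carrier (free_mod A n)" "v \<in> carrier (free_mod A n)"
  shows "(u \<ominus>\<^bsub>free_mod A n\<^esub> v) i = u i \<ominus>\<^bsub>A\<^esub> v i"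
  using assms by (simp add: a_minus_def free_mod_nth free_mod_neg_nth)

definition unitvec :: "('r, 'e) ring_scheme \<Rightarrow> nat \<Rightarrow> nat \<Rightarrow> (nat \<Rightarrow> 'r)" where
  "unitvec A n j = restrict (\<lambda>i. if i = j then \<one>\<^bsub>A\<^esub> else \<zero>\<^bsub>A\<^esub>) {..<n}"

definition lincomb :: "('r, 'c, 'm) module_scheme \<Rightarrow> nat \<Rightarrow> (nat \<Rightarrow> 'c) \<Rightarrow> (nat \<Rightarrow> 'r) \<Rightarrow> 'c" where
  "lincomb M n v u = (\<Oplus>\<^bsub>M\<^esub>i\<in>{..<n}. u i \<odot>\<^bsub>M\<^esub> v i)"

lemma unitvec_closed: "cring A \<Longrightarrow> unitvec A n j \<in> carrier (free_mod A n)"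
proof -
  assume "cring A" then interpret cring A .
  show ?thesis by (auto simp: unitvec_def free_mod_simps)
qed

lemma lincomb_hom:
  assumes "Module.module A M" "v \<in> {..<n} \<rightarrow> carrier M"
  shows "lincomb M n v \<in> mod_hom A (free_mod A n) M"
proof -
  interpret M: Module.module A M by fact
  have c: "\<And>i. i < n \<Longrightarrow> v i \<in> carrier M" using assms by auto
  show ?thesis unfolding lincomb_def
  proof (rule mod_homI)
    fix u assume u: "u \<in> carrier (free_mod A n)"
    note u' = free_mod_nth(1)[OF _ u]
    show "(\<Oplus>\<^bsub>M\<^esub>i\<in>{..<n}. u i \<odot>\<^bsub>M\<^esub> v i) \<in> carrier M"
      using u' c by (auto intro!: M.finsum_closed)
    { fix w assume w: "w \<in> carrier (free_mod A n)"
      note w' = free_mod_nth(1)[OF _ w]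
      have "(\<Oplus>\<^bsub>M\<^esub>i\<in>{..<n}. (u \<oplus>\<^bsub>free_mod A n\<^esub> w) i \<odot>\<^bsub>M\<^esub> v i) =
            (\<Oplus>\<^bsub>M\<^esub>i\<in>{..<n}. u i \<odot>\<^bsub>M\<^esub> v i \<oplus>\<^bsub>M\<^esub> w i \<odot>\<^bsub>M\<^esub> v i)"
        using u' w' c by (intro M.finsum_cong') (auto simp: free_mod_nth M.smult_l_distr)
      also have "\<dots> = (\<Oplus>\<^bsub>M\<^esub>i\<in>{..<n}. u i \<odot>\<^bsub>M\<^esub> v i) \<oplus>\<^bsub>M\<^esub> (\<Oplus>\<^bsub>M\<^esub>i\<in>{..<n}. w i \<odot>\<^bsub>M\<^esub> v i)"
        using u' w' c by (intro M.finsum_addf) auto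
      finally show "(\<Oplus>\<^bsub>M\<^esub>i\<in>{..<n}. (u \<oplus>\<^bsub>free_mod A n\<^esub> w) i \<odot>\<^bsub>M\<^esub> v i) =
          (\<Oplus>\<^bsub>M\<^esub>i\<in>{..<n}. u i \<odot>\<^bsub>M\<^esub> v i) \<oplus>\<^bsub>M\<^esub> (\<Oplus>\<^bsub>M\<^esub>i\<in>{..<n}. w i \<odot>\<^bsub>M\<^esub> v i)" . }
    fix a assume a: "a \<in> carrier A"
    have "(\<Oplus>\<^bsub>M\<^esub>i\<in>{..<n}. (a \<odot>\<^bsub>free_mod A n\<^esub> u) i \<odot>\<^bsub>M\<^esub> v i) = (\<Oplus>\<^bsub>M\<^esub>i\<in>{..<n}. a \<odot>\<^bsub>M\<^esub> (u i \<odot>\<^bsub>M\<^esub> v i))"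
      using u' a c by (intro M.finsum_cong') (auto simp: free_mod_nth M.smult_assoc1)
    also have "\<dots> = a \<odot>\<^bsub>M\<^esub> (\<Oplus>\<^bsub>M\<^esub>i\<in>{..<n}. u i \<odot>\<^bsub>M\<^esub> v i)"
      using u' a c by (intro M.finsum_smult_ldistr[symmetric]) auto
    finally show "(\<Oplus>\<^bsub>M\<^esub>i\<in>{..<n}. (a \<odot>\<^bsub>free_mod A n\<^esub> u) i \<odot>\<^bsub>M\<^esub> v i) = a \<odot>\<^bsub>M\<^esub> (\<Oplus>\<^bsub>M\<^esub>i\<in>{..<n}. u i \<odot>\<^bsub>M\<^esub> v i)" .
  qed
qed

lemma lincomb_unitvec:
  assumes "Module.module A M" "v \<in> {..<n} \<rightarrow> carrier M" "j < n"
  shows "lincomb M n v (unitvec A n j) = v j"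
proof -
  interpret M: Module.module A M by fact
  have c: "\<And>i. i < n \<Longrightarrow> v i \<in> carrier M" using assms by auto
  have "lincomb M n v (unitvec A n j) = (\<Oplus>\<^bsub>M\<^esub>i\<in>{..<n}. if j = i then v i else \<zero>\<^bsub>M\<^esub>)"
    unfolding lincomb_def unitvec_def using c assms(3)
    by (intro M.finsum_cong') auto
  also have "\<dots> = v j" using assms(3) c by (intro M.finsum_singleton) auto
  finally show ?thesis .
qed

lemma free_mod_expand:
  assumes "cring A" "u \<in> carrier (free_mod A n)"
  shows "u = lincomb (free_mod A n) n (unitvec A n) u"
proof (rule free_mod_eqI[OF assms(2)])
  interpret A: cring A by fact
  interpret F: Module.module A "free_mod A n" by (rule module_free_mod[OF assms(1)])
  note un = free_mod_nth(1)[OF _ assms(2)]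
  show "lincomb (free_mod A n) n (unitvec A n) u \<in> carrier (free_mod A n)"
    unfolding lincomb_def by (intro F.finsum_closed) (auto simp: un unitvec_closed assms)
  fix i assume i: "i < n"
  have "(lincomb (free_mod A n) n (unitvec A n) u) i =
     (\<Oplus>\<^bsub>ring_mod A\<^esub>j\<in>{..<n}. (u j \<odot>\<^bsub>free_mod A n\<^esub> unitvec A n j) i)"
    unfolding lincomb_def
    by (rule mod_hom_finsum[OF module_free_mod module_ring_mod free_mod_coord])
       (auto simp: i un unitvec_closed assms)
  also have "\<dots> = (\<Oplus>\<^bsub>A\<^esub>j\<in>{..<n}. if i = j then u j else \<zero>\<^bsub>A\<^esub>)"
    unfolding finsum_ring_mod
    by (intro A.finsum_cong') (use i un in \<open>auto simp: free_mod_nth unitvec_def\<close>)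
  also have "\<dots> = u i" using i un by (intro A.finsum_singleton) auto
  finally show "u i = (lincomb (free_mod A n) n (unitvec A n) u) i" by simp
qed

lemma mod_hom_eq_lincomb:
  assumes "Module.module A M" "h \<in> mod_hom A (free_mod A n) M" "u \<in> carrier (free_mod A n)"
  shows "h u = lincomb M n (\<lambda>j. h (unitvec A n j)) u"
proof -
  interpret M: Module.module A M by fact
  interpret F: Module.module A "free_mod A n" by (rule module_free_mod[OF M.R.is_cring])
  note un = free_mod_nth(1)[OF _ assms(3)]
  note e = unitvec_closed[OF M.R.is_cring]
  have "h u = h (\<Oplus>\<^bsub>free_mod A n\<^esub>i\<in>{..<n}. u i \<odot>\<^bsub>free_mod A n\<^esub> unitvec A n i)"
    using free_mod_expand[OF M.R.is_cring assms(3)] by (simp add: lincomb_def)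
  also have "\<dots> = (\<Oplus>\<^bsub>M\<^esub>i\<in>{..<n}. h (u i \<odot>\<^bsub>free_mod A n\<^esub> unitvec A n i))"
    by (rule mod_hom_finsum[OF F.module_axioms assms(1,2)]) (auto simp: un e)
  also have "\<dots> = (\<Oplus>\<^bsub>M\<^esub>i\<in>{..<n}. u i \<odot>\<^bsub>M\<^esub> h (unitvec A n i))"
    using un e mod_hom_closed[OF assms(2)]
    by (intro M.finsum_cong') (auto simp: mod_hom_smult[OF assms(2)])
  finally show ?thesis by (simp add: lincomb_def)
qed

lemma hom_image_submodule:
  assumes "Module.module A M" "h \<in> mod_hom A (free_mod A n) M" "submodule K A M"
    and "\<And>j. j < n \<Longrightarrow> h (unitvec A n j) \<in> K" "u \<in> carrier (free_mod A n)"
  shows "h u \<in> K"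
proof -
  interpret M: Module.module A M by fact
  show ?thesis
    unfolding mod_hom_eq_lincomb[OF assms(1,2,5)] lincomb_def
    using assms(4,5) M.submoduleE(4)[OF assms(3)]
    by (intro submodule_finsum[OF assms(1,3)]) (auto simp: free_mod_nth)
qed

text \<open>Projectivity of finite free modules. Surjectivity of \<open>g\<close> is relaxed to the
  image of \<open>h\<close> lying in the image of \<open>g\<close>, so that maps can be lifted
  through a map onto a mere submodule of \<open>Y\<close>.\<close>

lemma free_mod_lift:
  assumes "Module.module A X" "Module.module A Y" "g \<in> mod_hom A X Y" "h \<in> mod_hom A (free_mod A n) Y"
    and "h ` carrier (free_mod A n) \<subseteq> g ` carrier X"
  obtains l where "l \<in> mod_hom A (free_mod A n) X"
    "\<And>u. u \<in> carrier (free_mod A n) \<Longrightarrow> g (l u) = h u"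
proof -
  interpret X: Module.module A X by fact
  interpret Y: Module.module A Y by fact
  note e = unitvec_closed[OF X.R.is_cring]
  have "\<forall>j. \<exists>w\<in>carrier X. g w = h (unitvec A n j)"
    using assms(5) e by (metis (no_types, opaque_lifting) imageE image_subset_iff)
  then obtain w where w: "\<And>j. w j \<in> carrier X" "\<And>j. g (w j) = h (unitvec A n j)" by metis
  have l: "lincomb X n w \<in> mod_hom A (free_mod A n) X"
    by (rule lincomb_hom) (use w assms in auto)
  moreover have "g (lincomb X n w u) = h u" if u: "u \<in> carrier (free_mod A n)" for u
  proof -
    have gl: "(\<lambda>u. g (lincomb X n w u)) \<in> mod_hom A (free_mod A n) Y"
      by (rule mod_hom_comp[OF l assms(3)])
    have "g (lincomb X n w u) = lincomb Y n (\<lambda>j. g (lincomb X n w (unitvec A n j))) u"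
      by (rule mod_hom_eq_lincomb[OF assms(2) gl u])
    also have "\<dots> = lincomb Y n (\<lambda>j. h (unitvec A n j)) u"
      unfolding lincomb_def using w u mod_hom_closed[OF assms(4)] e
      by (intro Y.finsum_cong')
         (auto simp: free_mod_nth lincomb_unitvec[OF assms(1), unfolded lincomb_def])
    also have "\<dots> = h u" by (rule mod_hom_eq_lincomb[OF assms(2,4) u, symmetric])
    finally show ?thesis .
  qed
  ultimately show ?thesis by (rule that)
qed

lemma mod_hom_const_zero:
  assumes "Module.module A N" shows "(\<lambda>u. \<zero>\<^bsub>N\<^esub>) \<in> mod_hom A M N"
proof -
  interpret N: Module.module A N by fact
  show ?thesis by (auto simp: mod_hom_def)
qed

lemma submodule_ring_mod_ideal:
  assumes "cring A" "submodule K A (ring_mod A)"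
  shows "ideal K A"
proof -
  interpret A: cring A by fact
  interpret RM: Module.module A "ring_mod A" by (rule module_ring_mod[OF assms(1)])
  note K = RM.submoduleE[OF assms(2)]
  show ?thesis
  proof (rule idealI)
    show "ring A" ..
    show "subgroup K (add_monoid A)"
      using K(1,2,3,5) RM.submoduleE(2)[OF assms(2)] submodule_zero_closed[OF RM.module_axioms assms(2)]
      by (intro subgroup.intro) (auto simp: a_inv_ring_mod simp flip: a_inv_def)
    show "b \<otimes>\<^bsub>A\<^esub> a \<in> K" if "a \<in> K" "b \<in> carrier A" for a b using K that by simp
    show "a \<otimes>\<^bsub>A\<^esub> b \<in> K" if "a \<in> K" "b \<in> carrier A" for a b
      using K that by (subst A.m_comm) auto
  qed
qed

section \<open>Direct sums of finite free modules in block coordinates\<close>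

definition inl :: "('r, 'e) ring_scheme \<Rightarrow> nat \<Rightarrow> nat \<Rightarrow> (nat \<Rightarrow> 'r) \<Rightarrow> nat \<Rightarrow> 'r" where
  "inl A c m u = restrict (\<lambda>i. if i < c then u i else \<zero>\<^bsub>A\<^esub>) {..<c + m}"
definition inr :: "('r, 'e) ring_scheme \<Rightarrow> nat \<Rightarrow> nat \<Rightarrow> (nat \<Rightarrow> 'r) \<Rightarrow> nat \<Rightarrow> 'r" where
  "inr A c m u = restrict (\<lambda>i. if i < c then \<zero>\<^bsub>A\<^esub> else u (i - c)) {..<c + m}"
definition prl :: "nat \<Rightarrow> (nat \<Rightarrow> 'r) \<Rightarrow> nat \<Rightarrow> 'r" where
  "prl c u = restrict u {..<c}"
definition prr :: "nat \<Rightarrow> nat \<Rightarrow> (nat \<Rightarrow> 'r) \<Rightarrow> nat \<Rightarrow> 'r" where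
  "prr c m u = restrict (\<lambda>i. u (c + i)) {..<m}"

lemma mod_hom_into_free:
  assumes "\<And>i. i < n \<Longrightarrow> h i \<in> mod_hom A M (ring_mod A)"
  shows "(\<lambda>u. restrict (\<lambda>i. h i u) {..<n}) \<in> mod_hom A M (free_mod A n)"
  using mod_homD[OF assms] by (intro mod_homI) (auto simp: free_mod_simps fun_eq_iff)

lemma inl_hom: assumes "cring A" shows "inl A c m \<in> mod_hom A (free_mod A c) (free_mod A (c + m))"
proof -
  have "(\<lambda>u. if i < c then u i else \<zero>\<^bsub>A\<^esub>) \<in> mod_hom A (free_mod A c) (ring_mod A)" for i
    using free_mod_coord[of i c A] mod_hom_const_zero[OF module_ring_mod[OF assms]] by (cases "i < c") auto
  thus ?thesis unfolding inl_def by (intro mod_hom_into_free)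
qed

lemma inr_hom: assumes "cring A" shows "inr A c m \<in> mod_hom A (free_mod A m) (free_mod A (c + m))"
proof -
  have "(\<lambda>u. if i < c then \<zero>\<^bsub>A\<^esub> else u (i - c)) \<in> mod_hom A (free_mod A m) (ring_mod A)" if "i < c + m" for i
    using free_mod_coord[of "i - c" m A] mod_hom_const_zero[OF module_ring_mod[OF assms], of "free_mod A m"] that
    by (cases "i < c") auto
  thus ?thesis unfolding inr_def by (intro mod_hom_into_free)
qed

lemma prl_hom: "prl c \<in> mod_hom A (free_mod A (c + m)) (free_mod A c)"
  unfolding prl_def by (intro mod_hom_into_free free_mod_coord) simp

lemma prr_hom: "prr c m \<in> mod_hom A (free_mod A (c + m)) (free_mod A m)"
  unfolding prr_def by (intro mod_hom_into_free free_mod_coord) simp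

lemma prl_inl: "u \<in> carrier (free_mod A c) \<Longrightarrow> prl c (inl A c m u) = u"
  by (auto simp: free_mod_simps prl_def inl_def PiE_def extensional_def fun_eq_iff)
lemma prr_inr: "u \<in> carrier (free_mod A m) \<Longrightarrow> prr c m (inr A c m u) = u"
  by (auto simp: free_mod_simps prr_def inr_def PiE_def extensional_def fun_eq_iff)
lemma prl_inr: "prl c (inr A c m u) = \<zero>\<^bsub>free_mod A c\<^esub>"
  by (auto simp: free_mod_simps prl_def inr_def fun_eq_iff)
lemma prr_inl: "prr c m (inl A c m u) = \<zero>\<^bsub>free_mod A m\<^esub>"
  by (auto simp: free_mod_simps prr_def inl_def fun_eq_iff)
lemma inl_prl_inr_prr:
  assumes "cring A" "w \<in> carrier (free_mod A (c + m))"
  shows "inl A c m (prl c w) \<oplus>\<^bsub>free_mod A (c + m)\<^esub> inr A c m (prr c m w) = w"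
proof -
  interpret cring A by fact
  have "w i \<in> carrier A" if "i < c + m" for i using free_mod_nth(1)[OF that assms(2)] .
  moreover have "w i = undefined" if "\<not> i < c + m" for i
    using that assms(2) by (auto simp: free_mod_simps)
  ultimately show ?thesis
    by (auto simp: free_mod_simps prl_def prr_def inl_def inr_def fun_eq_iff)
qed

subsection \<open>Vanishing of Ext\<close>

text \<open>
  \<open>ext_vanish A i b K\<close> says \<open>Ext^{i+1}(A^b/K, A) = 0\<close>: \<open>Ext^1\<close> is the obstruction to extending
  functionals from \<open>K\<close> to \<open>A^b\<close>, and higher \<open>Ext\<close> is reduced to it by passing to syzygies. Quantifying
  over all presentations of \<open>K\<close> is harmless by \<open>ext_vanish_retract\<close> below.
\<close>
primrec ext_vanish :: "('r, 'e) ring_scheme \<Rightarrow> nat \<Rightarrow> nat \<Rightarrow> (nat \<Rightarrow> 'r) set \<Rightarrow> bool" where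
  "ext_vanish A 0 b K = (\<forall>\<phi> \<in> mod_hom A ((free_mod A b)\<lparr>carrier := K\<rparr>) (ring_mod A).
      \<exists>\<psi> \<in> mod_hom A (free_mod A b) (ring_mod A). \<forall>k\<in>K. \<psi> k = \<phi> k)"
| "ext_vanish A (Suc i) b K = (\<forall>c. \<forall>g \<in> mod_hom A (free_mod A c) (free_mod A b).
      g ` carrier (free_mod A c) = K \<longrightarrow>
      ext_vanish A i c {u \<in> carrier (free_mod A c). g u = \<zero>\<^bsub>free_mod A b\<^esub>})"

section \<open>Finite generation over a Noetherian ring\<close>

locale noetherian_base =
  fixes R :: "('a, 'e) ring_scheme" (structure)
  assumes noeth: "noetherian_ring R"
begin

lemma crR: "cring R" using noeth by (simp add: noetherian_ring_def)
sublocale cring R by (rule crR)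

abbreviation "F \<equiv> free_mod R"
abbreviation "RR \<equiv> ring_mod R"

lemma modF: "Module.module R (F b)" by (rule module_free_mod[OF crR])
lemma modR: "Module.module R RR" by (rule module_ring_mod[OF crR])

text \<open>Generation is expressed by minimality among ideals instead of by linear combinations.
  Later uses take for \<open>J\<close> the image of a linear map and conclude that this image
  contains \<open>I\<close>.\<close>

lemma ideal_fin_gen:
  assumes "ideal I R"
  obtains k s where "s \<in> {..<k::nat} \<rightarrow> I" "\<And>J. ideal J R \<Longrightarrow> s ` {..<k} \<subseteq> J \<Longrightarrow> I \<subseteq> J"
proof -
  obtain S where S: "finite S" "S \<subseteq> carrier R" "I = Idl S"
    using noeth assms by (auto simp: noetherian_ring_def)
  obtain s where s: "bij_betw s {..<card S} S"
    using ex_bij_betw_nat_finite[OF S(1)] by (auto simp: atLeast0LessThan)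
  show ?thesis
  proof (rule that)
    show "s \<in> {..<card S} \<rightarrow> I"
      using s genideal_self[OF S(2)] S(3) by (auto simp: bij_betw_def)
    show "I \<subseteq> J" if "ideal J R" "s ` {..<card S} \<subseteq> J" for J
      using that s genideal_minimal S(3) by (auto simp: bij_betw_def)
  qed
qed

text \<open>\<open>K\<close> is filtered by the vanishing of the coordinates from \<open>k\<close>
  on. Coordinate \<open>k\<close> maps the layer \<open>L (Suc k)\<close> onto an ideal with kernel
  \<open>L k\<close>, so lifts of finitely many generators of that ideal, together with generators
  of \<open>L k\<close>, generate \<open>L (Suc k)\<close>.\<close>

lemma submodule_fin_gen:
  assumes K: "submodule K R (F b)"
  obtains c g where "g \<in> mod_hom R (F c) (F b)" "g ` carrier (F c) = K"
proof -
  interpret FM: Module.module R "F b" by (rule modF)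
  note KE = FM.submoduleE[OF K]
  have KF: "\<And>v. v \<in> K \<Longrightarrow> v \<in> carrier (F b)" using KE by auto
  define L where "L k = {v \<in> K. \<forall>i. k \<le> i \<and> i < b \<longrightarrow> v i = \<zero>}" for k
  have L: "submodule (L k) R (F b)" for k
  proof (rule FM.submoduleI)
    show "\<zero>\<^bsub>F b\<^esub> \<in> L k" using submodule_zero_closed[OF modF K] by (auto simp: L_def free_mod_nth)
    show "\<ominus>\<^bsub>F b\<^esub> a \<in> L k" if "a \<in> L k" for a
      using that KE KF free_mod_neg_nth[OF crR] by (auto simp: L_def)
    show "a \<oplus>\<^bsub>F b\<^esub> v \<in> L k" if "a \<in> L k" "v \<in> L k" for a v
      using that KE by (auto simp: L_def free_mod_nth)
    show "a \<odot>\<^bsub>F b\<^esub> v \<in> L k" if "a \<in> carrier R" "v \<in> L k" for a v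
      using that KE by (auto simp: L_def free_mod_nth)
  qed (use KE in \<open>auto simp: L_def\<close>)
  have "\<exists>c g. g \<in> mod_hom R (F c) (F b) \<and> g ` carrier (F c) = L k" if "k \<le> b" for k
    using that
  proof (induction k)
    case 0
    have "L 0 = {\<zero>\<^bsub>F b\<^esub>}"
    proof (intro equalityI subsetI)
      fix v assume v: "v \<in> L 0"
      have "v = \<zero>\<^bsub>F b\<^esub>"
        by (rule free_mod_eqI) (use v KF in \<open>auto simp: L_def free_mod_nth\<close>)
      thus "v \<in> {\<zero>\<^bsub>F b\<^esub>}" by simp
    qed (use submodule_zero_closed[OF modF L] in auto)
    moreover have "(\<lambda>u. \<zero>\<^bsub>F b\<^esub>) ` carrier (F 0) = {\<zero>\<^bsub>F b\<^esub>}"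
      using FM.zero_closed by (auto simp: free_mod_simps)
    ultimately show ?case using mod_hom_const_zero[OF modF] by metis
  next
    case (Suc k)
    then obtain c1 g1 where g1: "g1 \<in> mod_hom R (F c1) (F b)" "g1 ` carrier (F c1) = L k"
      by auto
    have kb: "k < b" using Suc.prems by simp
    define I where "I = (\<lambda>v. v k) ` L (Suc k)"
    have "ideal I R" unfolding I_def
      by (rule submodule_ring_mod_ideal[OF crR submodule_image[OF modF modR free_mod_coord[OF kb] L]])
    then obtain c2 s where s: "s \<in> {..<c2::nat} \<rightarrow> I" "\<And>J. ideal J R \<Longrightarrow> s ` {..<c2} \<subseteq> J \<Longrightarrow> I \<subseteq> J"
      by (blast intro: ideal_fin_gen)
    have "\<forall>j<c2. \<exists>w\<in>L (Suc k). w k = s j"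
    proof (intro allI impI)
      fix j assume "j < c2"
      hence "s j \<in> I" using s(1) by blast
      then obtain w where "s j = w k" "w \<in> L (Suc k)" unfolding I_def by (rule imageE)
      thus "\<exists>w\<in>L (Suc k). w k = s j" by (intro bexI[of _ w]) auto
    qed
    note ex = this[rule_format, unfolded Bex_def]
    define w where "w j = (SOME v. v \<in> L (Suc k) \<and> v k = s j)" for j
    have w: "w j \<in> L (Suc k)" "w j k = s j" if "j < c2" for j
      using someI_ex[OF ex[OF that]] unfolding w_def by simp_all
    have wF: "w \<in> {..<c2} \<rightarrow> carrier (F b)" using w(1) KF by (auto simp: L_def)
    define g2 where "g2 = lincomb (F b) c2 w"
    have g2: "g2 \<in> mod_hom R (F c2) (F b)" unfolding g2_def by (rule lincomb_hom[OF modF wF])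
    have g2e: "g2 (unitvec R c2 j) = w j" if "j < c2" for j
      unfolding g2_def by (rule lincomb_unitvec[OF modF wF that])
    have g2L: "g2 u \<in> L (Suc k)" if "u \<in> carrier (F c2)" for u
      by (rule hom_image_submodule[OF modF g2 L _ that]) (use g2e w in auto)
    have "ideal ((\<lambda>u. g2 u k) ` carrier (F c2)) R"
      by (rule submodule_ring_mod_ideal[OF crR
          submodule_range[OF modF modR mod_hom_comp[OF g2 free_mod_coord[OF kb]]]])
    hence sub: "I \<subseteq> (\<lambda>u. g2 u k) ` carrier (F c2)"
    proof (rule s(2))
      have "s j \<in> (\<lambda>u. g2 u k) ` carrier (F c2)" if "j < c2" for j
        by (rule image_eqI[of _ _ "unitvec R c2 j"]) (use that g2e w unitvec_closed[OF crR] in auto)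
      thus "s ` {..<c2} \<subseteq> (\<lambda>u. g2 u k) ` carrier (F c2)" by auto
    qed
    define g where "g = (\<lambda>u. g1 (prl c1 u) \<oplus>\<^bsub>F b\<^esub> g2 (prr c1 c2 u))"
    have g: "g \<in> mod_hom R (F (c1 + c2)) (F b)" unfolding g_def
      by (intro mod_hom_plus[OF modF] mod_hom_comp[OF prl_hom] mod_hom_comp[OF prr_hom] g1 g2)
    moreover have "g ` carrier (F (c1 + c2)) = L (Suc k)"
    proof (intro equalityI subsetI)
      fix v assume "v \<in> g ` carrier (F (c1 + c2))"
      then obtain u where u: "u \<in> carrier (F (c1 + c2))" "v = g u" by auto
      have "g1 (prl c1 u) \<in> L (Suc k)"
        using imageI[OF mod_hom_closed[OF prl_hom u(1)], of g1] unfolding g1(2) by (auto simp: L_def)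
      thus "v \<in> L (Suc k)" unfolding u(2) g_def
        by (intro FM.submoduleE(5)[OF L] g2L mod_hom_closed[OF prr_hom u(1)])
    next
      fix v assume v: "v \<in> L (Suc k)"
      hence vF: "v \<in> carrier (F b)" using KF by (auto simp: L_def)
      from v sub obtain u2 where u2: "u2 \<in> carrier (F c2)" "v k = g2 u2 k" unfolding I_def by (blast elim: imageE)
      have "g2 u2 \<in> carrier (F b)" by (rule mod_hom_closed[OF g2 u2(1)])
      \<comment> \<open>The combination \<open>g2 u2\<close> has the same coordinate
        \<open>k\<close> as \<open>v\<close>; the difference lies one layer lower, where
        \<open>g1\<close> reaches it.\<close>
      define w where "w = v \<ominus>\<^bsub>F b\<^esub> g2 u2"
      have wn: "w i = v i \<ominus> g2 u2 i" if "i < b" for i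
        unfolding w_def by (rule free_mod_minus_nth[OF crR that vF]) fact
      have w1: "w \<in> L (Suc k)" unfolding w_def a_minus_def
        by (intro FM.submoduleE(5)[OF L] FM.submoduleE(3)[OF L] v g2L u2)
      moreover have "w k = \<zero>"
        using wn[OF kb] free_mod_nth(1)[OF kb vF] u2(2) by (simp add: minus_eq r_neg)
      ultimately have "w \<in> L k" unfolding L_def by (auto simp: Suc_le_eq) (metis le_neq_implies_less)
      then obtain u1 where u1: "u1 \<in> carrier (F c1)" "w = g1 u1" using g1(2) by auto
      define u where "u = inl R c1 c2 u1 \<oplus>\<^bsub>F (c1 + c2)\<^esub> inr R c1 c2 u2"
      have i: "inl R c1 c2 u1 \<in> carrier (F (c1 + c2))" "inr R c1 c2 u2 \<in> carrier (F (c1 + c2))"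
        by (rule mod_hom_closed[OF inl_hom[OF crR] u1(1)], rule mod_hom_closed[OF inr_hom[OF crR] u2(1)])
      have "prl c1 u = u1 \<oplus>\<^bsub>F c1\<^esub> \<zero>\<^bsub>F c1\<^esub>" "prr c1 c2 u = \<zero>\<^bsub>F c2\<^esub> \<oplus>\<^bsub>F c2\<^esub> u2"
        unfolding u_def using i u1(1) u2(1)
        by (simp_all add: mod_hom_add[OF prl_hom] mod_hom_add[OF prr_hom] prl_inl prl_inr prr_inl prr_inr)
      moreover have "u1 \<oplus>\<^bsub>F c1\<^esub> \<zero>\<^bsub>F c1\<^esub> = u1" "\<zero>\<^bsub>F c2\<^esub> \<oplus>\<^bsub>F c2\<^esub> u2 = u2"
        using u1(1) u2(1) modF by (simp_all add: Module.module_def abelian_group_def abelian_monoid.r_zero abelian_monoid.l_zero)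
      ultimately have "g u = w \<oplus>\<^bsub>F b\<^esub> g2 u2" by (simp add: g_def u1(2))
      also have "\<dots> = v" unfolding w_def using vF \<open>g2 u2 \<in> carrier (F b)\<close>
        by (simp add: FM.minus_eq FM.a_assoc FM.l_neg)
      finally have "v = g u" by simp
      moreover have "u \<in> carrier (F (c1 + c2))" unfolding u_def
        using i modF by (intro abelian_monoid.a_closed) (auto simp: Module.module_def abelian_group_def)
      ultimately show "v \<in> g ` carrier (F (c1 + c2))" by blast
    qed
    ultimately show ?case by blast
  qed
  moreover have "L b = K" by (auto simp: L_def)
  ultimately show ?thesis using that by (metis order_refl)
qed

end

lemma (in abelian_group) neg_zero: "\<ominus> \<zero> = \<zero>"
  by (simp add: minus_equality)

context noetherian_base
begin

text \<open>
  \<open>F b'/K'\<close> is a retract of \<open>F b/K \<oplus> F m\<close> via \<open>(\<alpha>, \<delta>)\<close> and \<open>(\<beta>, \<gamma>)\<close>. The free summand has to be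
  allowed because the hypothesis passes to syzygies only in this stable form.
\<close>
lemma ext_vanish_retract:
  assumes "submodule K R (F b)" "submodule K' R (F b')"
    and "\<alpha> \<in> mod_hom R (F b') (F b)" "\<beta> \<in> mod_hom R (F b) (F b')"
    and "\<gamma> \<in> mod_hom R (F m) (F b')" "\<delta> \<in> mod_hom R (F b') (F m)"
    and "\<And>k. k \<in> K' \<Longrightarrow> \<alpha> k \<in> K" "\<And>k. k \<in> K \<Longrightarrow> \<beta> k \<in> K'" "\<And>k. k \<in> K' \<Longrightarrow> \<delta> k = \<zero>\<^bsub>F m\<^esub>"
    and "\<And>v. v \<in> carrier (F b') \<Longrightarrow> v \<ominus>\<^bsub>F b'\<^esub> \<beta> (\<alpha> v) \<ominus>\<^bsub>F b'\<^esub> \<gamma> (\<delta> v) \<in> K'"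
    and "ext_vanish R i b K"
  shows "ext_vanish R i b' K'"
  using assms
proof (induction i arbitrary: b b' K K' \<alpha> \<beta> \<gamma> \<delta> m)
  case (0 b b' K K' \<alpha> \<beta> \<gamma> \<delta> m)
  note K = "0.prems"(1) and K' = "0.prems"(2) and \<alpha> = "0.prems"(3) and \<beta> = "0.prems"(4)
    and \<gamma> = "0.prems"(5) and \<delta> = "0.prems"(6) and \<alpha>K = "0.prems"(7) and \<beta>K = "0.prems"(8)
    and \<delta>K = "0.prems"(9) and h = "0.prems"(10) and V = "0.prems"(11)
  interpret M: Module.module R "F b" by (rule modF)
  interpret M': Module.module R "F b'" by (rule modF)
  have KF: "K \<subseteq> carrier (F b)" and KF': "K' \<subseteq> carrier (F b')"
    using M.submoduleE(1)[OF K] M'.submoduleE(1)[OF K'] by auto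
  \<comment> \<open>The defect of \<open>\<beta> \<alpha> + \<gamma> \<delta>\<close> from the
    identity has values in \<open>K'\<close>, so composing \<open>\<phi>\<close> with it gives a
    functional on all of \<open>F b'\<close>.\<close>
  define hh where "hh = (\<lambda>v. v \<ominus>\<^bsub>F b'\<^esub> \<beta> (\<alpha> v) \<ominus>\<^bsub>F b'\<^esub> \<gamma> (\<delta> v))"
  have hh: "hh \<in> mod_hom R (F b') ((F b')\<lparr>carrier := K'\<rparr>)"
    unfolding mod_hom_into_sub[OF KF'] using h
    by (auto simp: hh_def intro!: mod_hom_diff modF mod_hom_id mod_hom_comp[OF \<alpha> \<beta>] mod_hom_comp[OF \<delta> \<gamma>])
  show ?case unfolding ext_vanish.simps
  proof
    fix \<phi> assume \<phi>: "\<phi> \<in> mod_hom R ((F b')\<lparr>carrier := K'\<rparr>) RR"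
    have "\<beta> \<in> mod_hom R ((F b)\<lparr>carrier := K\<rparr>) ((F b')\<lparr>carrier := K'\<rparr>)"
      unfolding mod_hom_into_sub[OF KF'] using \<beta>K by (auto intro: mod_hom_sub[OF \<beta> KF])
    hence "(\<lambda>u. \<phi> (\<beta> u)) \<in> mod_hom R ((F b)\<lparr>carrier := K\<rparr>) RR" by (rule mod_hom_comp[OF _ \<phi>])
    then obtain \<psi> where \<psi>: "\<psi> \<in> mod_hom R (F b) RR" "\<And>k. k \<in> K \<Longrightarrow> \<psi> k = \<phi> (\<beta> k)"
      using V by auto
    \<comment> \<open>On \<open>K'\<close> the term with \<open>\<delta>\<close> vanishes, hence
      \<open>\<beta> \<alpha> + hh\<close> is the identity there and \<open>\<psi>'\<close>
      restricts to \<open>\<phi>\<close>.\<close>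
    define \<psi>' where "\<psi>' = (\<lambda>v. \<psi> (\<alpha> v) \<oplus>\<^bsub>RR\<^esub> \<phi> (hh v))"
    have "\<psi>' \<in> mod_hom R (F b') RR" unfolding \<psi>'_def
      by (intro mod_hom_plus[OF modR] mod_hom_comp[OF \<alpha> \<psi>(1)] mod_hom_comp[OF hh \<phi>])
    moreover have "\<psi>' k = \<phi> k" if k: "k \<in> K'" for k
    proof -
      have kF: "k \<in> carrier (F b')" using k KF' by auto
      have b: "\<beta> (\<alpha> k) \<in> K'" using \<alpha>K \<beta>K k by auto
      hence bF: "\<beta> (\<alpha> k) \<in> carrier (F b')" using KF' by auto
      have z: "\<gamma> (\<delta> k) = \<zero>\<^bsub>F b'\<^esub>" using \<delta>K[OF k] mod_hom_zero[OF modF modF \<gamma>] by simp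
      have hk: "hh k \<in> K'" unfolding hh_def by (rule h[OF kF])
      have "\<psi>' k = \<phi> (\<beta> (\<alpha> k)) \<oplus>\<^bsub>RR\<^esub> \<phi> (hh k)" using \<psi>(2)[OF \<alpha>K[OF k]] by (simp add: \<psi>'_def)
      also have "\<dots> = \<phi> (\<beta> (\<alpha> k) \<oplus>\<^bsub>F b'\<^esub> hh k)" using mod_hom_add[OF \<phi>, of "\<beta> (\<alpha> k)" "hh k"] b hk by simp
      also have "\<beta> (\<alpha> k) \<oplus>\<^bsub>F b'\<^esub> hh k = k"
        using kF bF by (simp add: hh_def z M'.minus_eq M'.a_lcomm M'.r_neg M'.neg_zero)
      finally show ?thesis .
    qed
    ultimately show "\<exists>\<psi>\<in>mod_hom R (F b') RR. \<forall>k\<in>K'. \<psi> k = \<phi> k" by blast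
  qed
next
  case (Suc i b b' K K' \<alpha> \<beta> \<gamma> \<delta> m)
  note K = Suc.prems(1) and K' = Suc.prems(2) and \<alpha> = Suc.prems(3) and \<beta> = Suc.prems(4)
    and \<gamma> = Suc.prems(5) and \<delta> = Suc.prems(6) and \<alpha>K = Suc.prems(7) and \<beta>K = Suc.prems(8)
    and \<delta>K = Suc.prems(9) and h = Suc.prems(10) and V = Suc.prems(11)
  interpret M': Module.module R "F b'" by (rule modF)
  define hh where "hh = (\<lambda>v. v \<ominus>\<^bsub>F b'\<^esub> \<beta> (\<alpha> v) \<ominus>\<^bsub>F b'\<^esub> \<gamma> (\<delta> v))"
  have hh: "hh \<in> mod_hom R (F b') (F b')"
    by (auto simp: hh_def intro!: mod_hom_diff modF mod_hom_id mod_hom_comp[OF \<alpha> \<beta>] mod_hom_comp[OF \<delta> \<gamma>])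
  obtain c g where g: "g \<in> mod_hom R (F c) (F b)" "g ` carrier (F c) = K"
    by (rule submodule_fin_gen[OF K])
  have gc: "g u \<in> K" if "u \<in> carrier (F c)" for u using g(2) that by auto
  show ?case unfolding ext_vanish.simps
  proof (intro allI ballI impI)
    fix c' g' assume g': "g' \<in> mod_hom R (F c') (F b')" "g' ` carrier (F c') = K'"
    have gc': "g' u \<in> K'" if "u \<in> carrier (F c')" for u using g'(2) that by auto
    obtain \<alpha>1 where \<alpha>1: "\<alpha>1 \<in> mod_hom R (F c') (F c)" "\<And>u. u \<in> carrier (F c') \<Longrightarrow> g (\<alpha>1 u) = \<alpha> (g' u)"
      by (rule free_mod_lift[OF modF modF g(1) mod_hom_comp[OF g'(1) \<alpha>]]) (use g gc' \<alpha>K in auto)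
    obtain \<beta>1 where \<beta>1: "\<beta>1 \<in> mod_hom R (F c) (F c')" "\<And>u. u \<in> carrier (F c) \<Longrightarrow> g' (\<beta>1 u) = \<beta> (g u)"
      by (rule free_mod_lift[OF modF modF g'(1) mod_hom_comp[OF g(1) \<beta>]]) (use g' gc \<beta>K in auto)
    \<comment> \<open>The defect \<open>hh\<close> need not vanish on \<open>F b'\<close>, so its
      lift is kept as the new \<open>\<gamma>\<close>. The free summand of the next stage is
      \<open>F b'\<close>, and \<open>g'\<close> takes the place of \<open>\<delta>\<close>: it
      vanishes on the new kernel by definition.\<close>
    obtain \<gamma>1 where \<gamma>1: "\<gamma>1 \<in> mod_hom R (F b') (F c')" "\<And>u. u \<in> carrier (F b') \<Longrightarrow> g' (\<gamma>1 u) = hh u"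
      by (rule free_mod_lift[OF modF modF g'(1) hh]) (use g' h in \<open>auto simp: hh_def\<close>)
    let ?K = "{u \<in> carrier (F c). g u = \<zero>\<^bsub>F b\<^esub>}"
    let ?K' = "{u \<in> carrier (F c'). g' u = \<zero>\<^bsub>F b'\<^esub>}"
    show "ext_vanish R i c' ?K'"
    proof (rule Suc.IH[of ?K c ?K' c' \<alpha>1 \<beta>1 \<gamma>1 b' g'])
      show "submodule ?K R (F c)" by (rule submodule_kernel[OF modF modF g(1)])
      show "submodule ?K' R (F c')" by (rule submodule_kernel[OF modF modF g'(1)])
      show "\<alpha>1 k \<in> ?K" if "k \<in> ?K'" for k
        using that \<alpha>1(2) mod_hom_closed[OF \<alpha>1(1)] mod_hom_zero[OF modF modF \<alpha>] by auto
      show "\<beta>1 k \<in> ?K'" if "k \<in> ?K" for k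
        using that \<beta>1(2) mod_hom_closed[OF \<beta>1(1)] mod_hom_zero[OF modF modF \<beta>] by auto
      show "ext_vanish R i c ?K" using V g by auto
      fix v assume v: "v \<in> carrier (F c')"
      have vc: "\<beta>1 (\<alpha>1 v) \<in> carrier (F c')" "\<gamma>1 (g' v) \<in> carrier (F c')" "g' v \<in> carrier (F b')"
        "\<alpha>1 v \<in> carrier (F c)" "\<beta> (\<alpha> (g' v)) \<in> carrier (F b')"
        using v mod_hom_closed[OF \<alpha>1(1)] mod_hom_closed[OF \<beta>1(1)] mod_hom_closed[OF \<gamma>1(1)]
          mod_hom_closed[OF g'(1)] mod_hom_closed[OF \<alpha>] mod_hom_closed[OF \<beta>] by auto
      interpret C': Module.module R "F c'" by (rule modF)
      have "g' (v \<ominus>\<^bsub>F c'\<^esub> \<beta>1 (\<alpha>1 v) \<ominus>\<^bsub>F c'\<^esub> \<gamma>1 (g' v)) = g' v \<ominus>\<^bsub>F b'\<^esub> \<beta> (\<alpha> (g' v)) \<ominus>\<^bsub>F b'\<^esub> hh (g' v)"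
        using v vc by (simp add: mod_hom_minus[OF modF modF g'(1)] \<beta>1(2) \<alpha>1(2) \<gamma>1(2))
      also have "hh (g' v) = g' v \<ominus>\<^bsub>F b'\<^esub> \<beta> (\<alpha> (g' v))"
        using vc \<delta>K[OF gc'[OF v]] mod_hom_zero[OF modF modF \<gamma>] by (simp add: hh_def M'.minus_eq)
      also have "g' v \<ominus>\<^bsub>F b'\<^esub> \<beta> (\<alpha> (g' v)) \<ominus>\<^bsub>F b'\<^esub> (g' v \<ominus>\<^bsub>F b'\<^esub> \<beta> (\<alpha> (g' v))) = \<zero>\<^bsub>F b'\<^esub>"
        using vc by (metis M'.minus_eq M'.minus_closed M'.r_neg)
      finally show "v \<ominus>\<^bsub>F c'\<^esub> \<beta>1 (\<alpha>1 v) \<ominus>\<^bsub>F c'\<^esub> \<gamma>1 (g' v) \<in> ?K'" using v vc by auto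
    qed (use \<alpha>1 \<beta>1 \<gamma>1 g' in auto)
  qed
qed

text \<open>The case of zero \<open>\<gamma>\<close> and \<open>\<delta>\<close>. Only
  \<open>\<beta> \<alpha>\<close> has to be the identity modulo \<open>K'\<close>, so retracts are
  covered as well as isomorphisms.\<close>

lemma ext_vanish_iso:
  assumes "submodule K R (F b)" "submodule K' R (F b')"
    and \<alpha>: "\<alpha> \<in> mod_hom R (F b') (F b)" and \<beta>: "\<beta> \<in> mod_hom R (F b) (F b')"
    and "\<And>k. k \<in> K' \<Longrightarrow> \<alpha> k \<in> K" "\<And>k. k \<in> K \<Longrightarrow> \<beta> k \<in> K'"
    and id: "\<And>v. v \<in> carrier (F b') \<Longrightarrow> v \<ominus>\<^bsub>F b'\<^esub> \<beta> (\<alpha> v) \<in> K'"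
    and "ext_vanish R i b K"
  shows "ext_vanish R i b' K'"
proof (rule ext_vanish_retract[OF assms(1-4) mod_hom_const_zero[OF modF] mod_hom_const_zero[OF modF]])
  interpret M': Module.module R "F b'" by (rule modF)
  fix v assume v: "v \<in> carrier (F b')"
  hence "\<beta> (\<alpha> v) \<in> carrier (F b')" using mod_hom_closed[OF \<alpha>] mod_hom_closed[OF \<beta>] by auto
  thus "v \<ominus>\<^bsub>F b'\<^esub> \<beta> (\<alpha> v) \<ominus>\<^bsub>F b'\<^esub> \<zero>\<^bsub>F b'\<^esub> \<in> K'" using id[OF v] v by (simp add: M'.minus_eq M'.neg_zero)
qed (use assms in auto)

text \<open>The alternating sequence of \<open>T\<close> and \<open>S\<close> is exact and stays
  exact after dualizing. The first syzygy of the cokernel of \<open>T\<close> is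
  \<open>im T\<close>, which is the cokernel of \<open>S\<close> because
  \<open>ker T = im S\<close>; raising \<open>i\<close> by one therefore exchanges \<open>T\<close>
  and \<open>S\<close>.\<close>

lemma ext_vanish_periodic:
  assumes "T \<in> mod_hom R (F N) (F N)" "S \<in> mod_hom R (F N) (F N)"
    and "T ` carrier (F N) = {v \<in> carrier (F N). S v = \<zero>\<^bsub>F N\<^esub>}"
    and "S ` carrier (F N) = {v \<in> carrier (F N). T v = \<zero>\<^bsub>F N\<^esub>}"
    and "\<And>\<phi>. \<phi> \<in> mod_hom R (F N) RR \<Longrightarrow> (\<And>v. v \<in> carrier (F N) \<Longrightarrow> \<phi> (S v) = \<zero>) \<Longrightarrow>
          \<exists>\<psi>\<in>mod_hom R (F N) RR. \<forall>v\<in>carrier (F N). \<phi> v = \<psi> (T v)"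
    and "\<And>\<phi>. \<phi> \<in> mod_hom R (F N) RR \<Longrightarrow> (\<And>v. v \<in> carrier (F N) \<Longrightarrow> \<phi> (T v) = \<zero>) \<Longrightarrow>
          \<exists>\<psi>\<in>mod_hom R (F N) RR. \<forall>v\<in>carrier (F N). \<phi> v = \<psi> (S v)"
  shows "ext_vanish R i N (T ` carrier (F N))"
  using assms
proof (induction i arbitrary: T S)
  case (0 T S)
  show ?case unfolding ext_vanish.simps
  proof
    fix \<phi> assume \<phi>: "\<phi> \<in> mod_hom R ((F N)\<lparr>carrier := T ` carrier (F N)\<rparr>) RR"
    have "T ` carrier (F N) \<subseteq> carrier (F N)" using "0.prems"(3) by auto
    hence T': "T \<in> mod_hom R (F N) ((F N)\<lparr>carrier := T ` carrier (F N)\<rparr>)"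
      by (subst mod_hom_into_sub) (use "0.prems"(1) in auto)
    have z: "\<phi> (T (S v)) = \<zero>" if "v \<in> carrier (F N)" for v
    proof -
      have "T (S v) = \<zero>\<^bsub>F N\<^esub>" using "0.prems"(4) that by blast
      moreover have "\<phi> (T \<zero>\<^bsub>F N\<^esub>) = \<zero>"
        using mod_hom_zero[OF modF modR mod_hom_comp[OF T' \<phi>]] by simp
      moreover have "T \<zero>\<^bsub>F N\<^esub> = \<zero>\<^bsub>F N\<^esub>" by (rule mod_hom_zero[OF modF modF "0.prems"(1)])
      ultimately show ?thesis by simp
    qed
    \<comment> \<open>Dual exactness writes \<open>\<phi> T\<close> as \<open>\<psi> T\<close> with
      \<open>\<psi>\<close> defined on the whole free module; this \<open>\<psi>\<close> extends
      \<open>\<phi>\<close> from the image of \<open>T\<close>.\<close>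
    obtain \<psi> where "\<psi> \<in> mod_hom R (F N) RR" "\<forall>v\<in>carrier (F N). \<phi> (T v) = \<psi> (T v)"
      using "0.prems"(5)[OF mod_hom_comp[OF T' \<phi>] z] by auto
    thus "\<exists>\<psi>\<in>mod_hom R (F N) RR. \<forall>k\<in>T ` carrier (F N). \<psi> k = \<phi> k" by (intro bexI[of _ \<psi>]) auto
  qed
next
  case (Suc i T S)
  note T = Suc.prems(1) and S = Suc.prems(2)
  have V: "ext_vanish R i N (S ` carrier (F N))"
    by (rule Suc.IH[OF S T Suc.prems(4,3,6,5)])
  show ?case unfolding ext_vanish.simps
  proof (intro allI ballI impI)
    fix c g assume g: "g \<in> mod_hom R (F c) (F N)" "g ` carrier (F c) = T ` carrier (F N)"
    let ?K' = "{u \<in> carrier (F c). g u = \<zero>\<^bsub>F N\<^esub>}"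
    \<comment> \<open>\<open>F c / ker g\<close> and \<open>F N / ker T\<close> are both isomorphic
      to the image of \<open>T\<close>. Lifting each cover through the other carries the vanishing
      for \<open>ker T = im S\<close> over to \<open>ker g\<close>.\<close>
    obtain \<alpha> where \<alpha>: "\<alpha> \<in> mod_hom R (F c) (F N)" "\<And>u. u \<in> carrier (F c) \<Longrightarrow> T (\<alpha> u) = g u"
      by (rule free_mod_lift[OF modF modF T g(1)]) (use g in auto)
    obtain \<beta> where \<beta>: "\<beta> \<in> mod_hom R (F N) (F c)" "\<And>u. u \<in> carrier (F N) \<Longrightarrow> g (\<beta> u) = T u"
      by (rule free_mod_lift[OF modF modF g(1) T]) (use g in auto)
    show "ext_vanish R i c ?K'"
    proof (rule ext_vanish_iso[OF submodule_range[OF modF modF S] submodule_kernel[OF modF modF g(1)] \<alpha>(1) \<beta>(1) _ _ _ V])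
      show "\<alpha> k \<in> S ` carrier (F N)" if "k \<in> ?K'" for k
        using that \<alpha>(2) mod_hom_closed[OF \<alpha>(1)] by (auto simp: Suc.prems(4))
      show "\<beta> k \<in> ?K'" if "k \<in> S ` carrier (F N)" for k
        using that \<beta>(2) mod_hom_closed[OF \<beta>(1)] unfolding Suc.prems(4) by auto
      fix v assume v: "v \<in> carrier (F c)"
      interpret C: Module.module R "F c" by (rule modF)
      interpret N: Module.module R "F N" by (rule modF)
      have b: "\<beta> (\<alpha> v) \<in> carrier (F c)" "\<alpha> v \<in> carrier (F N)" using v mod_hom_closed[OF \<alpha>(1)] mod_hom_closed[OF \<beta>(1)] by auto
      have "g (v \<ominus>\<^bsub>F c\<^esub> \<beta> (\<alpha> v)) = g v \<ominus>\<^bsub>F N\<^esub> g v"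
        using v b by (simp add: mod_hom_minus[OF modF modF g(1)] \<alpha>(2) \<beta>(2))
      also have "\<dots> = \<zero>\<^bsub>F N\<^esub>" using mod_hom_closed[OF g(1) v] by (simp add: N.minus_eq N.r_neg)
      finally show "v \<ominus>\<^bsub>F c\<^esub> \<beta> (\<alpha> v) \<in> ?K'" using v b by auto
    qed
  qed
qed

text \<open>The annihilator conditions \<open>(0 : x) = (y)\<close> and \<open>(0 : y) = (x)\<close>
  in elementwise form, symmetric under exchanging \<open>x\<close> and \<open>y\<close> and free of
  any reference to a maximal ideal.\<close>

definition exact_pair :: "'a \<Rightarrow> 'a \<Rightarrow> bool" where
  "exact_pair x y \<longleftrightarrow> x \<in> carrier R \<and> y \<in> carrier R \<and>
     (\<forall>a\<in>carrier R. x \<otimes> a = \<zero> \<longleftrightarrow> (\<exists>b\<in>carrier R. a = y \<otimes> b)) \<and>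
     (\<forall>a\<in>carrier R. y \<otimes> a = \<zero> \<longleftrightarrow> (\<exists>b\<in>carrier R. a = x \<otimes> b))"

lemma exact_pair_sym: "exact_pair x y \<Longrightarrow> exact_pair y x"
  by (auto simp: exact_pair_def)

lemma exact_pair_free_mod:
  assumes "exact_pair x y" "v \<in> carrier (F m)"
  shows "x \<odot>\<^bsub>F m\<^esub> v = \<zero>\<^bsub>F m\<^esub> \<longleftrightarrow> (\<exists>w\<in>carrier (F m). v = y \<odot>\<^bsub>F m\<^esub> w)"
proof
  interpret M: Module.module R "F m" by (rule modF)
  note vn = free_mod_nth(1)[OF _ assms(2)]
  {
    assume z: "x \<odot>\<^bsub>F m\<^esub> v = \<zero>\<^bsub>F m\<^esub>"
    have "\<exists>b\<in>carrier R. v i = y \<otimes> b" if "i < m" for i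
    proof -
      have "x \<otimes> v i = \<zero>" using arg_cong[OF z, of "\<lambda>v. v i"] that by (simp add: free_mod_nth)
      thus ?thesis using assms(1) vn[OF that] by (auto simp: exact_pair_def)
    qed
    then obtain b where b: "\<And>i. i < m \<Longrightarrow> b i \<in> carrier R" "\<And>i. i < m \<Longrightarrow> v i = y \<otimes> b i" by metis
    have "v = y \<odot>\<^bsub>F m\<^esub> restrict b {..<m}"
      by (rule free_mod_eqI[OF assms(2) M.smult_closed])
         (use assms b in \<open>auto simp: exact_pair_def free_mod_nth free_mod_memI\<close>)
    thus "\<exists>w\<in>carrier (F m). v = y \<odot>\<^bsub>F m\<^esub> w" using b free_mod_memI by metis
  next
    assume "\<exists>w\<in>carrier (F m). v = y \<odot>\<^bsub>F m\<^esub> w"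
    then obtain w where w: "w \<in> carrier (F m)" "v = y \<odot>\<^bsub>F m\<^esub> w" by auto
    have xy: "x \<in> carrier R" "y \<in> carrier R" "x \<otimes> y = \<zero>"
      using assms(1) by (auto simp: exact_pair_def intro: r_one[symmetric])
    show "x \<odot>\<^bsub>F m\<^esub> v = \<zero>\<^bsub>F m\<^esub>" using xy w by (simp add: M.smult_assoc1[symmetric])
  }
qed

text \<open>
  The second block of coordinates contributes a copy of \<open>y F m\<close>, through which functionals extend; the
  syzygies of \<open>K\<close> and of its projection are again related in this way, with \<open>x\<close> and \<open>y\<close> exchanged.
\<close>
lemma ext_vanish_project:
  assumes "exact_pair x y" "submodule K R (F (c + m))" "g \<in> mod_hom R (F c) (F m)"
    and "\<And>w. w \<in> K \<Longrightarrow> x \<odot>\<^bsub>F m\<^esub> prr c m w = g (prl c w)"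
    and "\<And>v. v \<in> carrier (F m) \<Longrightarrow> inr R c m v \<in> K \<longleftrightarrow> (\<exists>v'\<in>carrier (F m). v = y \<odot>\<^bsub>F m\<^esub> v')"
    and "ext_vanish R i (c + m) K"
  shows "ext_vanish R i c (prl c ` K)"
  using assms
proof (induction i arbitrary: x y c K g)
  case (0 x y c K g)
  note xy = "0.prems"(1) and K = "0.prems"(2) and g = "0.prems"(3) and xg = "0.prems"(4)
    and yK = "0.prems"(5) and V = "0.prems"(6)
  interpret E: Module.module R "F (c + m)" by (rule modF)
  have KF: "K \<subseteq> carrier (F (c + m))" by (rule E.submoduleE(1)[OF K])
  have cl: "x \<in> carrier R" "y \<in> carrier R" using xy by (auto simp: exact_pair_def)
  let ?K1 = "prl c ` K"
  have K1: "?K1 \<subseteq> carrier (F c)" using KF mod_hom_closed[OF prl_hom] by blast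
  have pK: "prl c \<in> mod_hom R ((F (c + m))\<lparr>carrier := K\<rparr>) ((F c)\<lparr>carrier := ?K1\<rparr>)"
    unfolding mod_hom_into_sub[OF K1] by (auto intro: mod_hom_sub[OF prl_hom KF])
  note ir = inr_hom[OF crR, of c m] and il = inl_hom[OF crR, of c m]
  show ?case unfolding ext_vanish.simps
  proof
    fix \<phi> assume \<phi>: "\<phi> \<in> mod_hom R ((F c)\<lparr>carrier := ?K1\<rparr>) RR"
    note \<phi>p = mod_hom_comp[OF pK \<phi>]
    obtain \<psi> where \<psi>: "\<psi> \<in> mod_hom R (F (c + m)) RR" "\<And>k. k \<in> K \<Longrightarrow> \<psi> k = \<phi> (prl c k)"
      using V \<phi>p by auto
    have K0: "\<zero>\<^bsub>F (c + m)\<^esub> \<in> K" by (rule submodule_zero_closed[OF modF K])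
    have \<phi>0: "\<phi> \<zero>\<^bsub>F c\<^esub> = \<zero>"
      using \<psi>(2)[OF K0] mod_hom_zero[OF modF modR \<psi>(1)] mod_hom_zero[OF modF modF prl_hom, of c m] by simp
    \<comment> \<open>On the second block \<open>\<psi>\<close> kills \<open>y F m\<close>, since
      these vectors lie in \<open>K\<close> and project to zero. Its values are therefore
      annihilated by \<open>y\<close>, that is, divisible by \<open>x\<close>; \<open>l\<close>
      below is the quotient.\<close>
    define h where "h = (\<lambda>v. \<psi> (inr R c m v))"
    have h: "h \<in> mod_hom R (F m) RR" unfolding h_def by (rule mod_hom_comp[OF ir \<psi>(1)])
    have hx: "\<exists>b\<in>carrier R. h v = x \<otimes> b" if v: "v \<in> carrier (F m)" for v
    proof -
      interpret M: Module.module R "F m" by (rule modF)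
      have yv: "y \<odot>\<^bsub>F m\<^esub> v \<in> carrier (F m)" using cl v by simp
      have "inr R c m (y \<odot>\<^bsub>F m\<^esub> v) \<in> K" using yK[OF yv] v by blast
      hence "h (y \<odot>\<^bsub>F m\<^esub> v) = \<phi> (prl c (inr R c m (y \<odot>\<^bsub>F m\<^esub> v)))" unfolding h_def by (rule \<psi>(2))
      hence "h (y \<odot>\<^bsub>F m\<^esub> v) = \<zero>" by (simp add: prl_inr \<phi>0)
      hence "y \<otimes> h v = \<zero>" using mod_hom_smult[OF h cl(2) v] by simp
      thus ?thesis using xy mod_hom_closed[OF h v] by (auto simp: exact_pair_def)
    qed
    have mx: "(\<lambda>a. x \<odot>\<^bsub>RR\<^esub> a) \<in> mod_hom R RR RR" by (rule mod_hom_scale[OF modR cl(1) mod_hom_id])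
    obtain l where l: "l \<in> mod_hom R (F m) RR" "\<And>v. v \<in> carrier (F m) \<Longrightarrow> x \<odot>\<^bsub>RR\<^esub> l v = h v"
      by (rule free_mod_lift[OF modR modR mx h]) (use hx in auto)
    \<comment> \<open>The contribution \<open>h = x l\<close> of the second block is shifted to the
      first: on \<open>K\<close>, \<open>x\<close> times the second block equals \<open>g\<close> of
      the first.\<close>
    define \<psi>' where "\<psi>' = (\<lambda>u. \<psi> (inl R c m u) \<oplus>\<^bsub>RR\<^esub> l (g u))"
    have "\<psi>' \<in> mod_hom R (F c) RR" unfolding \<psi>'_def
      by (intro mod_hom_plus[OF modR] mod_hom_comp[OF il \<psi>(1)] mod_hom_comp[OF g l(1)])
    moreover have "\<psi>' (prl c w) = \<phi> (prl c w)" if w: "w \<in> K" for w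
    proof -
      have wF: "w \<in> carrier (F (c + m))" using w KF by auto
      have p: "prl c w \<in> carrier (F c)" "prr c m w \<in> carrier (F m)"
        using mod_hom_closed[OF prl_hom wF] mod_hom_closed[OF prr_hom wF] by auto
      have "\<phi> (prl c w) = \<psi> w" using \<psi>(2) w by simp
      also have "\<dots> = \<psi> (inl R c m (prl c w) \<oplus>\<^bsub>F (c + m)\<^esub> inr R c m (prr c m w))"
        using inl_prl_inr_prr[OF crR wF] by simp
      also have "\<dots> = \<psi> (inl R c m (prl c w)) \<oplus> h (prr c m w)"
        using mod_hom_add[OF \<psi>(1) mod_hom_closed[OF il p(1)] mod_hom_closed[OF ir p(2)]] by (simp add: h_def)
      also have "h (prr c m w) = l (x \<odot>\<^bsub>F m\<^esub> prr c m w)"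
        using l(2)[OF p(2)] mod_hom_smult[OF l(1) cl(1) p(2)] by simp
      also have "x \<odot>\<^bsub>F m\<^esub> prr c m w = g (prl c w)" by (rule xg[OF w])
      finally show ?thesis by (simp add: \<psi>'_def)
    qed
    ultimately show "\<exists>\<psi>\<in>mod_hom R (F c) RR. \<forall>k\<in>?K1. \<psi> k = \<phi> k" by blast
  qed
next
  case (Suc i x y c K g)
  note xy = Suc.prems(1) and K = Suc.prems(2) and g = Suc.prems(3) and xg = Suc.prems(4)
    and yK = Suc.prems(5) and V = Suc.prems(6)
  interpret E: Module.module R "F (c + m)" by (rule modF)
  interpret M: Module.module R "F m" by (rule modF)
  have KF: "K \<subseteq> carrier (F (c + m))" by (rule E.submoduleE(1)[OF K])
  have cl: "x \<in> carrier R" "y \<in> carrier R" using xy by (auto simp: exact_pair_def)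
  let ?K1 = "prl c ` K"
  note ir = inr_hom[OF crR] and il = inl_hom[OF crR]
  show ?case unfolding ext_vanish.simps
  proof (intro allI ballI impI)
    fix d g1 assume g1: "g1 \<in> mod_hom R (F d) (F c)" "g1 ` carrier (F d) = ?K1"
    interpret D: Module.module R "F d" by (rule modF)
    interpret DM: Module.module R "F (d + m)" by (rule modF)
    have mK: "Module.module R ((F (c + m))\<lparr>carrier := K\<rparr>)"
      by (rule submodule.submodule_is_module[OF K modF])
    obtain h where h': "h \<in> mod_hom R (F d) ((F (c + m))\<lparr>carrier := K\<rparr>)"
      "\<And>u. u \<in> carrier (F d) \<Longrightarrow> prl c (h u) = g1 u"
      by (rule free_mod_lift[OF mK modF mod_hom_sub[OF prl_hom KF] g1(1)]) (use g1 in auto)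
    have h: "h \<in> mod_hom R (F d) (F (c + m))" and hK: "\<And>u. u \<in> carrier (F d) \<Longrightarrow> h u \<in> K"
      using h'(1) unfolding mod_hom_into_sub[OF KF] by auto
    \<comment> \<open>A cover of \<open>K\<close> made from a cover of its projection. The added
      summand maps onto \<open>y F m\<close>, which consists of the elements of \<open>K\<close>
      with zero projection.\<close>
    define G where "G = (\<lambda>w. h (prl d w) \<oplus>\<^bsub>F (c + m)\<^esub> inr R c m (y \<odot>\<^bsub>F m\<^esub> prr d m w))"
    have G: "G \<in> mod_hom R (F (d + m)) (F (c + m))" unfolding G_def
      by (intro mod_hom_plus[OF modF] mod_hom_comp[OF prl_hom h]
            mod_hom_comp[OF mod_hom_scale[OF modF cl(2) prr_hom] ir])
    have iyK: "inr R c m (y \<odot>\<^bsub>F m\<^esub> v) \<in> K" if "v \<in> carrier (F m)" for v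
      using yK that cl by auto
    have Gn: "G (inl R d m u \<oplus>\<^bsub>F (d + m)\<^esub> inr R d m v) = h u \<oplus>\<^bsub>F (c + m)\<^esub> inr R c m (y \<odot>\<^bsub>F m\<^esub> v)"
      if "u \<in> carrier (F d)" "v \<in> carrier (F m)" for u v
    proof -
      note i = mod_hom_closed[OF il that(1), of m] mod_hom_closed[OF ir that(2), of d]
      show ?thesis unfolding G_def
        using i that by (simp add: mod_hom_add[OF prl_hom] mod_hom_add[OF prr_hom] prl_inl prl_inr prr_inl prr_inr)
    qed
    have Gon: "\<exists>u\<in>carrier (F d). \<exists>v\<in>carrier (F m). u = u0 \<and> k = h u \<oplus>\<^bsub>F (c + m)\<^esub> inr R c m (y \<odot>\<^bsub>F m\<^esub> v)"
      if k: "k \<in> K" and u: "u0 \<in> carrier (F d)" "prl c k = g1 u0" for k u0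
    proof -
      define w where "w = k \<ominus>\<^bsub>F (c + m)\<^esub> h u0"
      have kF: "k \<in> carrier (F (c + m))" "h u0 \<in> carrier (F (c + m))" using k KF hK[OF u(1)] by auto
      have wK: "w \<in> K" unfolding w_def a_minus_def
        by (intro E.submoduleE(5)[OF K] E.submoduleE(3)[OF K] k hK u)
      have wF: "w \<in> carrier (F (c + m))" using wK KF by auto
      interpret C: Module.module R "F c" by (rule modF)
      have "prl c w = g1 u0 \<ominus>\<^bsub>F c\<^esub> g1 u0" unfolding w_def
        using mod_hom_minus[OF modF modF prl_hom kF] h'(2) u by simp
      hence "prl c w = \<zero>\<^bsub>F c\<^esub>" using mod_hom_closed[OF g1(1) u(1)] by (simp add: C.minus_eq C.r_neg)
      hence w0: "inr R c m (prr c m w) = w"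
        using inl_prl_inr_prr[OF crR wF] mod_hom_zero[OF modF modF il, of c m]
          mod_hom_closed[OF ir mod_hom_closed[OF prr_hom wF], of c] by simp
      obtain v where v: "v \<in> carrier (F m)" "prr c m w = y \<odot>\<^bsub>F m\<^esub> v"
        using yK[OF mod_hom_closed[OF prr_hom wF]] w0 wK by auto
      have "h u0 \<oplus>\<^bsub>F (c + m)\<^esub> w = k" unfolding w_def
        using kF by (simp add: E.minus_eq E.a_lcomm E.r_neg)
      thus ?thesis using u(1) v w0 by metis
    qed
    have Gim: "G ` carrier (F (d + m)) = K"
    proof (intro equalityI subsetI)
      fix k assume "k \<in> G ` carrier (F (d + m))"
      thus "k \<in> K" unfolding G_def
        using mod_hom_closed[OF prl_hom] mod_hom_closed[OF prr_hom]
        by (auto intro!: E.submoduleE(5)[OF K] hK iyK)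
    next
      fix k assume k: "k \<in> K"
      then obtain u0 where u0: "u0 \<in> carrier (F d)" "prl c k = g1 u0" using g1(2) by (metis image_iff)
      then obtain v where v: "v \<in> carrier (F m)" "k = h u0 \<oplus>\<^bsub>F (c + m)\<^esub> inr R c m (y \<odot>\<^bsub>F m\<^esub> v)"
        using Gon[OF k] by auto
      show "k \<in> G ` carrier (F (d + m))"
        using Gn[OF u0(1) v(1)] v(2) mod_hom_closed[OF il u0(1)] mod_hom_closed[OF ir v(1)]
        by (intro image_eqI[of _ _ "inl R d m u0 \<oplus>\<^bsub>F (d + m)\<^esub> inr R d m v"]) auto
    qed
    let ?K2 = "{w \<in> carrier (F (d + m)). G w = \<zero>\<^bsub>F (c + m)\<^esub>}"
    have "prl d ` ?K2 = {u \<in> carrier (F d). g1 u = \<zero>\<^bsub>F c\<^esub>}"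
    proof (intro equalityI subsetI)
      fix u assume "u \<in> prl d ` ?K2"
      then obtain w where w: "w \<in> carrier (F (d + m))" "G w = \<zero>\<^bsub>F (c + m)\<^esub>" "u = prl d w" by auto
      note p = mod_hom_closed[OF prl_hom w(1)] mod_hom_closed[OF prr_hom w(1)]
      interpret C: Module.module R "F c" by (rule modF)
      have "prl c (G w) = \<zero>\<^bsub>F c\<^esub>" using w(2) mod_hom_zero[OF modF modF prl_hom, of c m] by simp
      moreover have "prl c (G w) = g1 u \<oplus>\<^bsub>F c\<^esub> \<zero>\<^bsub>F c\<^esub>"
        unfolding G_def w(3) using p cl mod_hom_closed[OF h] mod_hom_closed[OF ir]
        by (simp add: mod_hom_add[OF prl_hom] h'(2) prl_inr)
      ultimately show "u \<in> {u \<in> carrier (F d). g1 u = \<zero>\<^bsub>F c\<^esub>}"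
        using p w(3) mod_hom_closed[OF g1(1)] by simp
    next
      fix u assume u: "u \<in> {u \<in> carrier (F d). g1 u = \<zero>\<^bsub>F c\<^esub>}"
      have z: "\<zero>\<^bsub>F (c + m)\<^esub> \<in> K" by (rule submodule_zero_closed[OF modF K])
      obtain v where v: "v \<in> carrier (F m)" "\<zero>\<^bsub>F (c + m)\<^esub> = h u \<oplus>\<^bsub>F (c + m)\<^esub> inr R c m (y \<odot>\<^bsub>F m\<^esub> v)"
        using Gon[OF z, of u] u mod_hom_zero[OF modF modF prl_hom, of c m] by auto
      let ?w = "inl R d m u \<oplus>\<^bsub>F (d + m)\<^esub> inr R d m v"
      have uF: "u \<in> carrier (F d)" using u by simp
      note i = mod_hom_closed[OF il uF, of m] mod_hom_closed[OF ir v(1), of d]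
      have "prl d ?w = u" using i uF by (simp add: mod_hom_add[OF prl_hom] prl_inl prl_inr)
      moreover have "?w \<in> ?K2" using Gn[OF uF v(1)] v(2)[symmetric] i by simp
      ultimately show "u \<in> prl d ` ?K2" by (intro image_eqI[OF sym])
    qed
    \<comment> \<open>On \<open>ker G\<close> the second block satisfies a relation of the same
      shape as before with \<open>y\<close> in place of \<open>x\<close>, and vectors supported in
      the second block lie in \<open>ker G\<close> exactly when \<open>y\<close> kills them, that
      is, when they lie in \<open>x F m\<close>. This is the induction hypothesis for the exchanged
      pair.\<close>
    moreover have "ext_vanish R i d (prl d ` ?K2)"
    proof (rule Suc.IH[OF exact_pair_sym[OF xy] submodule_kernel[OF modF modF G]])
      show "(\<lambda>u. \<ominus>\<^bsub>F m\<^esub> prr c m (h u)) \<in> mod_hom R (F d) (F m)"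
        by (intro mod_hom_uminus[OF modF] mod_hom_comp[OF h prr_hom])
      show "y \<odot>\<^bsub>F m\<^esub> prr d m w = \<ominus>\<^bsub>F m\<^esub> prr c m (h (prl d w))" if w: "w \<in> ?K2" for w
      proof -
        have wF: "w \<in> carrier (F (d + m))" using w by simp
        note p = mod_hom_closed[OF prl_hom wF] mod_hom_closed[OF prr_hom wF]
        have "prr c m (G w) = \<zero>\<^bsub>F m\<^esub>" using w mod_hom_zero[OF modF modF prr_hom, of c m] by simp
        moreover have "prr c m (G w) = prr c m (h (prl d w)) \<oplus>\<^bsub>F m\<^esub> y \<odot>\<^bsub>F m\<^esub> prr d m w"
          unfolding G_def using p cl mod_hom_closed[OF h] mod_hom_closed[OF ir]
          by (simp add: mod_hom_add[OF prr_hom] prr_inr)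
        moreover have "prr c m (h (prl d w)) \<in> carrier (F m)"
          by (intro mod_hom_closed[OF prr_hom] mod_hom_closed[OF h] p)
        ultimately show ?thesis using p cl
          by (metis M.minus_equality M.minus_minus M.smult_closed)
      qed
      show "inr R d m v \<in> ?K2 \<longleftrightarrow> (\<exists>v'\<in>carrier (F m). v = x \<odot>\<^bsub>F m\<^esub> v')" if v: "v \<in> carrier (F m)" for v
      proof -
        have i: "inr R d m v \<in> carrier (F (d + m))" by (rule mod_hom_closed[OF ir v])
        have yv: "y \<odot>\<^bsub>F m\<^esub> v \<in> carrier (F m)" using cl v by simp
        have "G (inr R d m v) = inr R c m (y \<odot>\<^bsub>F m\<^esub> v)"
          unfolding G_def prl_inr prr_inr[OF v] mod_hom_zero[OF modF modF h]
          using mod_hom_closed[OF ir yv, of c] by simp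
        moreover have "inr R c m (y \<odot>\<^bsub>F m\<^esub> v) = \<zero>\<^bsub>F (c + m)\<^esub> \<longleftrightarrow> y \<odot>\<^bsub>F m\<^esub> v = \<zero>\<^bsub>F m\<^esub>"
          using prr_inr[OF yv, of c] mod_hom_zero[OF modF modF prr_hom, of c m] mod_hom_zero[OF modF modF ir, of c m]
          by metis
        ultimately show ?thesis using i exact_pair_free_mod[OF exact_pair_sym[OF xy] v] by simp
      qed
      show "ext_vanish R i (d + m) ?K2" using V G Gim by auto
    qed
    ultimately show "ext_vanish R i d {u \<in> carrier (F d). g1 u = \<zero>\<^bsub>F c\<^esub>}" by simp
  qed
qed

end

context noetherian_base
begin

text \<open>For finitely generated \<open>X\<close> this says that all \<open>Ext^i(X, R)\<close>
  with \<open>i > 0\<close> vanish. Quantifying over every finite free cover means that no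
  resolution has to be chosen.\<close>

definition acyclic_mod :: "('a, 'c, 'm) module_scheme \<Rightarrow> bool" where
  "acyclic_mod X \<longleftrightarrow> (\<forall>b. \<forall>\<epsilon> \<in> mod_hom R (F b) X. \<epsilon> ` carrier (F b) = carrier X \<longrightarrow>
     (\<forall>i. ext_vanish R i b {u \<in> carrier (F b). \<epsilon> u = \<zero>\<^bsub>X\<^esub>}))"

text \<open>Vanishing tested on a single cover of \<open>Y\<close> suffices and is inherited by
  retracts: the maps \<open>s\<close> and \<open>r\<close> lift to maps between the two covers whose
  composite is the identity modulo the kernel of \<open>\<epsilon>\<close>.\<close>

lemma acyclic_mod_retract:
  assumes X: "Module.module R X" and Y: "Module.module R Y"
    and \<pi>: "\<pi> \<in> mod_hom R (F N) Y" "\<pi> ` carrier (F N) = carrier Y"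
    and V: "\<And>i. ext_vanish R i N {u \<in> carrier (F N). \<pi> u = \<zero>\<^bsub>Y\<^esub>}"
    and s: "s \<in> mod_hom R X Y" and r: "r \<in> mod_hom R Y X"
    and rs: "\<And>u. u \<in> carrier X \<Longrightarrow> r (s u) = u"
  shows "acyclic_mod X"
  unfolding acyclic_mod_def
proof (intro allI ballI impI)
  fix b \<epsilon> i assume \<epsilon>: "\<epsilon> \<in> mod_hom R (F b) X" "\<epsilon> ` carrier (F b) = carrier X"
  interpret X: Module.module R X by (rule X)
  obtain \<alpha> where \<alpha>: "\<alpha> \<in> mod_hom R (F b) (F N)" "\<And>u. u \<in> carrier (F b) \<Longrightarrow> \<pi> (\<alpha> u) = s (\<epsilon> u)"
    by (rule free_mod_lift[OF modF Y \<pi>(1) mod_hom_comp[OF \<epsilon>(1) s]])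
       (use mod_hom_closed[OF \<epsilon>(1)] mod_hom_closed[OF s] \<pi>(2) in auto)
  obtain \<beta> where \<beta>: "\<beta> \<in> mod_hom R (F N) (F b)" "\<And>u. u \<in> carrier (F N) \<Longrightarrow> \<epsilon> (\<beta> u) = r (\<pi> u)"
    by (rule free_mod_lift[OF modF X \<epsilon>(1) mod_hom_comp[OF \<pi>(1) r]])
       (use mod_hom_closed[OF \<pi>(1)] mod_hom_closed[OF r] \<epsilon>(2) in auto)
  show "ext_vanish R i b {u \<in> carrier (F b). \<epsilon> u = \<zero>\<^bsub>X\<^esub>}"
  proof (rule ext_vanish_iso[OF submodule_kernel[OF modF Y \<pi>(1)] submodule_kernel[OF modF X \<epsilon>(1)]
        \<alpha>(1) \<beta>(1) _ _ _ V])
    show "\<alpha> k \<in> {u \<in> carrier (F N). \<pi> u = \<zero>\<^bsub>Y\<^esub>}" if "k \<in> {u \<in> carrier (F b). \<epsilon> u = \<zero>\<^bsub>X\<^esub>}" for k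
      using that \<alpha>(2) mod_hom_closed[OF \<alpha>(1)] mod_hom_zero[OF X Y s] by auto
    show "\<beta> k \<in> {u \<in> carrier (F b). \<epsilon> u = \<zero>\<^bsub>X\<^esub>}" if "k \<in> {u \<in> carrier (F N). \<pi> u = \<zero>\<^bsub>Y\<^esub>}" for k
      using that \<beta>(2) mod_hom_closed[OF \<beta>(1)] mod_hom_zero[OF Y X r] by auto
    fix v assume v: "v \<in> carrier (F b)"
    interpret M: Module.module R "F b" by (rule modF)
    have c: "\<beta> (\<alpha> v) \<in> carrier (F b)" "\<alpha> v \<in> carrier (F N)" "\<epsilon> v \<in> carrier X"
      using v mod_hom_closed[OF \<alpha>(1)] mod_hom_closed[OF \<beta>(1)] mod_hom_closed[OF \<epsilon>(1)] by auto
    have "\<epsilon> (v \<ominus>\<^bsub>F b\<^esub> \<beta> (\<alpha> v)) = \<epsilon> v \<ominus>\<^bsub>X\<^esub> \<epsilon> v"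
      using v c by (simp add: mod_hom_minus[OF modF X \<epsilon>(1)] \<beta>(2) \<alpha>(2) rs)
    thus "v \<ominus>\<^bsub>F b\<^esub> \<beta> (\<alpha> v) \<in> {u \<in> carrier (F b). \<epsilon> u = \<zero>\<^bsub>X\<^esub>}"
      using v c by (simp add: X.minus_eq X.r_neg)
  qed
qed

end

subsection \<open>Descent to the residue ring of an exact zerodivisor\<close>

locale exact_pair_ring = noetherian_base R for R :: "('a, 'e) ring_scheme" (structure) +
  fixes x y :: 'a
  assumes xy: "exact_pair x y"
begin

abbreviation "A \<equiv> R Quot (PIdl x)"
abbreviation "red a \<equiv> PIdl x +> a"

lemma xy_closed [simp]: "x \<in> carrier R" "y \<in> carrier R" using xy by (auto simp: exact_pair_def)

lemma x_annihilator: "a \<in> carrier R \<Longrightarrow> x \<otimes> a = \<zero> \<longleftrightarrow> (\<exists>b\<in>carrier R. a = y \<otimes> b)"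
  and y_annihilator: "a \<in> carrier R \<Longrightarrow> y \<otimes> a = \<zero> \<longleftrightarrow> (\<exists>b\<in>carrier R. a = x \<otimes> b)"
  using xy by (auto simp: exact_pair_def)

lemma xy_zero: "x \<otimes> y = \<zero>" using x_annihilator[of y] r_one[of y] by (metis one_closed xy_closed(2))

sublocale X: ideal "PIdl x" R by (rule cgenideal_ideal) simp

lemma mem_PIdl_x: "a \<in> PIdl x \<longleftrightarrow> (\<exists>b\<in>carrier R. a = x \<otimes> b)"
proof -
  have "b \<otimes> x = x \<otimes> b" if "b \<in> carrier R" for b using m_comm that xy_closed(1) by blast
  thus ?thesis unfolding cgenideal_def by (auto; metis)
qed

lemma crA: "cring A" by (rule X.quotient_is_cring[OF crR])

lemma carrier_A: "carrier A = (\<lambda>a. red a) ` carrier R"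
  by (auto simp: FactRing_def A_RCOSETS_def')

lemma red_closed: "a \<in> carrier R \<Longrightarrow> red a \<in> carrier A"
  by (simp add: carrier_A)

lemma red_ops:
  assumes "a \<in> carrier R" "b \<in> carrier R"
  shows "red (a \<oplus> b) = red a \<oplus>\<^bsub>A\<^esub> red b" "red (a \<otimes> b) = red a \<otimes>\<^bsub>A\<^esub> red b"
  using assms ring_hom_memE[OF X.rcos_ring_hom] by auto

lemma red_one: "red \<one> = \<one>\<^bsub>A\<^esub>" and red_zero: "red \<zero> = \<zero>\<^bsub>A\<^esub>"
  using ring_hom_one[OF X.rcos_ring_hom] ring_hom_zero[OF X.rcos_ring_hom ring_axioms X.quotient_is_ring] by auto

lemma red_eq_iff:
  assumes "a \<in> carrier R" "b \<in> carrier R"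
  shows "red a = red b \<longleftrightarrow> (\<exists>c\<in>carrier R. a = b \<oplus> x \<otimes> c)"
proof -
  have "red a = red b \<longleftrightarrow> a \<ominus> b \<in> PIdl x"
    using quotient_eq_iff_same_a_r_cos[OF X.ideal_axioms assms] by simp
  also have "\<dots> \<longleftrightarrow> (\<exists>c\<in>carrier R. a = b \<oplus> x \<otimes> c)"
  proof -
    have "a \<ominus> b = d \<longleftrightarrow> a = b \<oplus> d" if "d \<in> carrier R" for d
      using assms that by (auto simp: minus_eq a_lcomm r_neg l_neg a_comm)
         (metis a_assoc a_comm a_inv_closed r_neg r_zero)
    thus ?thesis unfolding mem_PIdl_x by (metis m_closed xy_closed(1))
  qed
  finally show ?thesis .
qed

lemma red_zero_iff: "a \<in> carrier R \<Longrightarrow> red a = \<zero>\<^bsub>A\<^esub> \<longleftrightarrow> (\<exists>c\<in>carrier R. a = x \<otimes> c)"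
  using red_eq_iff[of a \<zero>] by (simp add: red_zero)

text \<open>Restriction of scalars along the projection from \<open>R\<close> to
  \<open>R/(x)\<close>.\<close>

definition res :: "('a set, 'c, 'm) module_scheme \<Rightarrow> ('a, 'c) module" where
  "res X = \<lparr>carrier = carrier X, mult = mult X, one = one X, zero = zero X, add = add X,
            smult = (\<lambda>a m. red a \<odot>\<^bsub>X\<^esub> m)\<rparr>"

lemma res_simps [simp]:
  "carrier (res X) = carrier X" "zero (res X) = zero X" "add (res X) = add X"
  "smult (res X) = (\<lambda>a m. red a \<odot>\<^bsub>X\<^esub> m)"
  by (simp_all add: res_def)

lemma finsum_res: "finsum (res X) = finsum X"
  by (simp add: finsum_def fun_eq_iff finprod_def)

lemma module_res: assumes "Module.module A X" shows "Module.module R (res X)"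
proof -
  interpret M: Module.module A X by fact
  have "abelian_group (res X)"
  proof (rule abelian_groupI)
    fix u v w
    assume uvw: "u \<in> carrier (res X)" "v \<in> carrier (res X)" "w \<in> carrier (res X)"
    show "u \<oplus>\<^bsub>res X\<^esub> v \<oplus>\<^bsub>res X\<^esub> w = u \<oplus>\<^bsub>res X\<^esub> (v \<oplus>\<^bsub>res X\<^esub> w)"
      using uvw M.M.a_assoc by simp
  next
    show "\<exists>n\<in>carrier (res X). n \<oplus>\<^bsub>res X\<^esub> m = \<zero>\<^bsub>res X\<^esub>" if "m \<in> carrier (res X)" for m
      using that M.l_neg by (intro bexI[of _ "\<ominus>\<^bsub>X\<^esub> m"]) auto
  qed (auto intro: M.M.a_comm)
  thus ?thesis
    by (intro moduleI[OF crR])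
       (auto simp: M.smult_l_distr M.smult_r_distr M.smult_assoc1 red_ops red_one red_closed)
qed

text \<open>The projection from \<open>R\<close> to \<open>A\<close> is onto, so every
  \<open>R\<close>-linear map between \<open>A\<close>-modules is already \<open>A\<close>-linear.
  Maps can be moved between the two rings freely.\<close>

lemma mod_hom_res: "mod_hom R (res X) (res Y) = mod_hom A X Y"
  by (auto simp: mod_hom_def carrier_A)

lemma mod_hom_res_D: "f \<in> mod_hom A X Y \<Longrightarrow> f \<in> mod_hom R (res X) (res Y)"
  by (simp add: mod_hom_res)

lemma sub_res: "res (X\<lparr>carrier := K\<rparr>) = (res X)\<lparr>carrier := K\<rparr>"
  by (simp add: res_def)

text \<open>The isomorphism \<open>R/(x) \<cong> y R\<close> onto the annihilator of \<open>x\<close>.\<close>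
definition \<theta> :: "'a set \<Rightarrow> 'a" where
  "\<theta> C = y \<otimes> (SOME a. a \<in> carrier R \<and> red a = C)"

text \<open>Two representatives differ by a multiple of \<open>x\<close>, which \<open>y\<close>
  kills.\<close>

lemma \<theta>_red: assumes "a \<in> carrier R" shows "\<theta> (red a) = y \<otimes> a"
proof -
  define b where "b = (SOME b. b \<in> carrier R \<and> red b = red a)"
  have b: "b \<in> carrier R" "red b = red a"
    unfolding b_def using someI[of "\<lambda>b. b \<in> carrier R \<and> red b = red a" a] assms by auto
  then obtain c where "c \<in> carrier R" "b = a \<oplus> x \<otimes> c" using red_eq_iff assms by auto
  hence "y \<otimes> b = y \<otimes> a"
    using assms xy_zero by (simp add: r_distr m_assoc[symmetric] m_comm[of y x])
  thus ?thesis by (simp add: \<theta>_def b_def)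
qed

lemma \<theta>_hom: "\<theta> \<in> mod_hom R (res (ring_mod A)) RR"
  by (rule mod_homI) (auto simp: carrier_A \<theta>_red red_ops[symmetric] r_distr m_lcomm)

lemma \<theta>_inj: "inj_on \<theta> (carrier A)"
proof (rule inj_onI)
  fix C D assume "C \<in> carrier A" "D \<in> carrier A" and eq: "\<theta> C = \<theta> D"
  then obtain a b where ab: "a \<in> carrier R" "C = red a" "b \<in> carrier R" "D = red b"
    by (auto simp: carrier_A)
  have "y \<otimes> (a \<ominus> b) = \<zero>"
    using eq ab by (simp add: \<theta>_red minus_eq r_distr r_minus r_neg)
  then obtain c where "c \<in> carrier R" "a \<ominus> b = x \<otimes> c" using y_annihilator ab by auto
  moreover have "a = b \<oplus> (a \<ominus> b)" using ab by (simp add: minus_eq a_lcomm r_neg)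
  ultimately show "C = D" using ab red_eq_iff by auto
qed

lemma \<theta>_onto: assumes "a \<in> carrier R" "x \<otimes> a = \<zero>" shows "a \<in> \<theta> ` carrier A"
  using assms x_annihilator[OF assms(1)] by (force simp: carrier_A \<theta>_red)

definition redv :: "nat \<Rightarrow> (nat \<Rightarrow> 'a) \<Rightarrow> nat \<Rightarrow> 'a set" where
  "redv n u = restrict (\<lambda>i. red (u i)) {..<n}"

lemma redv_hom: "redv n \<in> mod_hom R (F n) (res (free_mod A n))"
  by (rule mod_homI) (auto simp: free_mod_simps redv_def fun_eq_iff red_ops[symmetric] PiE_def Pi_def red_closed)

lemma redv_onto: "redv n ` carrier (F n) = carrier (free_mod A n)"
proof (intro equalityI subsetI)
  fix w assume w: "w \<in> carrier (free_mod A n)"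
  have "\<forall>i. \<exists>a. i < n \<longrightarrow> a \<in> carrier R \<and> w i = red a"
    using free_mod_nth(1)[OF _ w] by (auto simp: carrier_A)
  then obtain u where u: "\<And>i. i < n \<Longrightarrow> u i \<in> carrier R \<and> w i = red (u i)" by metis
  have uF: "restrict u {..<n} \<in> carrier (F n)" using u by (intro free_mod_memI) auto
  moreover have "w = redv n (restrict u {..<n})"
    by (rule free_mod_eqI[OF w]) (use u mod_hom_closed[OF redv_hom uF] in \<open>auto simp: redv_def\<close>)
  ultimately show "w \<in> redv n ` carrier (F n)" by blast
qed (use mod_hom_closed[OF redv_hom] in auto)

lemma redv_kernel:
  assumes "u \<in> carrier (F n)"
  shows "redv n u = \<zero>\<^bsub>free_mod A n\<^esub> \<longleftrightarrow> (\<exists>w\<in>carrier (F n). u = x \<odot>\<^bsub>F n\<^esub> w)"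
proof
  interpret M: Module.module R "F n" by (rule modF)
  note un = free_mod_nth(1)[OF _ assms]
  assume z: "redv n u = \<zero>\<^bsub>free_mod A n\<^esub>"
  have "\<exists>c\<in>carrier R. u i = x \<otimes> c" if "i < n" for i
    using arg_cong[OF z, of "\<lambda>v. v i"] that un[OF that] red_zero_iff by (simp add: redv_def free_mod_nth)
  then obtain c where c: "\<And>i. i < n \<Longrightarrow> c i \<in> carrier R \<and> u i = x \<otimes> c i" by metis
  have cF: "restrict c {..<n} \<in> carrier (F n)" using c by (intro free_mod_memI) auto
  moreover have "u = x \<odot>\<^bsub>F n\<^esub> restrict c {..<n}"
    by (rule free_mod_eqI[OF assms M.smult_closed[OF _ cF]]) (use c in \<open>auto simp: free_mod_nth\<close>)
  ultimately show "\<exists>w\<in>carrier (F n). u = x \<odot>\<^bsub>F n\<^esub> w" by blast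
next
  assume "\<exists>w\<in>carrier (F n). u = x \<odot>\<^bsub>F n\<^esub> w"
  then obtain w where w: "w \<in> carrier (F n)" "u = x \<odot>\<^bsub>F n\<^esub> w" by auto
  have "red (u i) = \<zero>\<^bsub>A\<^esub>" if "i < n" for i
    using w free_mod_nth(1)[OF that w(1)] that red_zero_iff[of "u i"] by (auto simp: free_mod_nth)
  thus "redv n u = \<zero>\<^bsub>free_mod A n\<^esub>" by (auto simp: redv_def free_mod_simps fun_eq_iff)
qed

text \<open>An \<open>A\<close>-module is annihilated by \<open>x\<close>, so a map into it from
  \<open>R^c\<close> factors through \<open>A^c\<close>. Covers over \<open>R\<close> thus become
  covers over \<open>A\<close> with the same image.\<close>

lemma factor_redv:
  assumes X: "Module.module A X" and \<kappa>: "\<kappa> \<in> mod_hom R (F c) (res X)"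
  obtains \<kappa>' where "\<kappa>' \<in> mod_hom A (free_mod A c) X"
    "\<And>u. u \<in> carrier (F c) \<Longrightarrow> \<kappa>' (redv c u) = \<kappa> u"
    "\<kappa>' ` carrier (free_mod A c) = \<kappa> ` carrier (F c)"
proof -
  interpret M: Module.module A X by (rule X)
  define \<kappa>' where "\<kappa>' = lincomb X c (\<lambda>j. \<kappa> (unitvec R c j))"
  have e: "\<And>j. \<kappa> (unitvec R c j) \<in> carrier X"
    using mod_hom_closed[OF \<kappa> unitvec_closed[OF crR]] by simp
  have 1: "\<kappa>' \<in> mod_hom A (free_mod A c) X" unfolding \<kappa>'_def
    using e by (intro lincomb_hom[OF X]) auto
  have 2: "\<kappa>' (redv c u) = \<kappa> u" if u: "u \<in> carrier (F c)" for u
    unfolding mod_hom_eq_lincomb[OF module_res[OF X] \<kappa> u] \<kappa>'_def lincomb_def finsum_res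
    using e free_mod_nth(1)[OF _ u] red_closed
    by (intro M.finsum_cong') (auto simp: redv_def intro!: M.smult_closed red_closed)
  have "\<kappa>' ` carrier (free_mod A c) = (\<lambda>u. \<kappa>' (redv c u)) ` carrier (F c)"
    by (simp add: redv_onto[symmetric] image_image)
  also have "\<dots> = \<kappa> ` carrier (F c)" using 2 by (intro image_cong) auto
  finally show ?thesis using that 1 2 by blast
qed

lemma modFA: "Module.module A (free_mod A n)" by (rule module_free_mod[OF crA])
lemma modA: "Module.module A (ring_mod A)" by (rule module_ring_mod[OF crA])

section \<open>One syzygy step over R/(x) for a module acyclic over R\<close>

context
  fixes X :: "('a set, 'c, 'm) module_scheme" and \<epsilon> b K
  assumes X: "Module.module A X" and acyc: "acyclic_mod (res X)"
    and \<epsilon>: "\<epsilon> \<in> mod_hom A (free_mod A b) X" "\<epsilon> ` carrier (free_mod A b) = carrier X"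
  defines "K \<equiv> {u \<in> carrier (free_mod A b). \<epsilon> u = \<zero>\<^bsub>X\<^esub>}"
begin

text \<open>The preimage \<open>Z\<close> of \<open>K\<close> is the kernel of the composite cover
  of \<open>X\<close> by \<open>R^b\<close>. It is the syzygy of \<open>X\<close> over
  \<open>R\<close>, whereas \<open>K\<close> is the syzygy over \<open>A\<close>.\<close>

lemma kernel_pullback:
  defines "Z \<equiv> {u \<in> carrier (F b). redv b u \<in> K}"
  shows "submodule Z R (F b)" "ext_vanish R i b Z"
proof -
  have p: "(\<lambda>u. \<epsilon> (redv b u)) \<in> mod_hom R (F b) (res X)"
    by (rule mod_hom_comp[OF redv_hom mod_hom_res_D[OF \<epsilon>(1)]])
  have Z: "Z = {u \<in> carrier (F b). \<epsilon> (redv b u) = \<zero>\<^bsub>res X\<^esub>}"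
    using mod_hom_closed[OF redv_hom] by (auto simp: Z_def K_def)
  show "submodule Z R (F b)" unfolding Z by (rule submodule_kernel[OF modF module_res[OF X] p])
  have "(\<lambda>u. \<epsilon> (redv b u)) ` carrier (F b) = \<epsilon> ` redv b ` carrier (F b)" by (simp add: image_image)
  hence "(\<lambda>u. \<epsilon> (redv b u)) ` carrier (F b) = carrier (res X)" by (simp add: redv_onto \<epsilon>(2))
  thus "ext_vanish R i b Z" unfolding Z using acyc p by (auto simp: acyclic_mod_def)
qed

lemma K_sub: "submodule K A (free_mod A b)"
  unfolding K_def by (rule submodule_kernel[OF modFA X \<epsilon>(1)])

lemma K_carrier: "K \<subseteq> carrier (free_mod A b)" by (auto simp: K_def)

text \<open>Vanishing of \<open>Ext^1\<close> for \<open>X\<close> over \<open>A\<close>. Followed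
  by \<open>\<theta>\<close>, a functional on \<open>K\<close> becomes one on \<open>Z\<close> with
  values in \<open>R\<close>, which extends to \<open>\<psi>\<close> on \<open>R^b\<close>. Since
  \<open>\<psi>\<close> kills \<open>x R^b\<close>, its values are annihilated by \<open>x\<close>
  and lie in the image of \<open>\<theta>\<close>; undoing \<open>\<theta>\<close> gives the
  extension over \<open>A\<close>.\<close>

lemma kernel_functional_extends:
  assumes f: "f \<in> mod_hom A ((free_mod A b)\<lparr>carrier := K\<rparr>) (ring_mod A)"
  shows "\<exists>f'\<in>mod_hom A (free_mod A b) (ring_mod A). \<forall>k\<in>K. f' k = f k"
proof -
  interpret M: Module.module R "F b" by (rule modF)
  define Z where "Z = {u \<in> carrier (F b). redv b u \<in> K}"
  note Z = kernel_pullback[folded Z_def]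
  have ZF: "Z \<subseteq> carrier (F b)" by (auto simp: Z_def)
  have 1: "redv b \<in> mod_hom R ((F b)\<lparr>carrier := Z\<rparr>) ((res (free_mod A b))\<lparr>carrier := K\<rparr>)"
    by (subst mod_hom_into_sub) (use K_carrier mod_hom_sub[OF redv_hom ZF] in \<open>auto simp: Z_def\<close>)
  have "f \<in> mod_hom R ((res (free_mod A b))\<lparr>carrier := K\<rparr>) (res (ring_mod A))"
    using mod_hom_res_D[OF f] by (simp add: sub_res)
  from mod_hom_comp[OF mod_hom_comp[OF 1 this] \<theta>_hom]
  obtain \<psi> where \<psi>: "\<psi> \<in> mod_hom R (F b) RR" "\<And>k. k \<in> Z \<Longrightarrow> \<psi> k = \<theta> (f (redv b k))"
    using Z(2)[of 0] by auto
  have mK: "Module.module A ((free_mod A b)\<lparr>carrier := K\<rparr>)"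
    by (rule submodule.submodule_is_module[OF K_sub modFA])
  have f0: "f \<zero>\<^bsub>free_mod A b\<^esub> = \<zero>\<^bsub>A\<^esub>" using mod_hom_zero[OF mK modA f] by simp
  have x0: "x \<otimes> \<psi> w = \<zero>" if w: "w \<in> carrier (F b)" for w
  proof -
    have r: "redv b (x \<odot>\<^bsub>F b\<^esub> w) = \<zero>\<^bsub>free_mod A b\<^esub>" using redv_kernel w by auto
    hence "x \<odot>\<^bsub>F b\<^esub> w \<in> Z" using w submodule_zero_closed[OF modFA K_sub] by (auto simp: Z_def)
    hence "\<psi> (x \<odot>\<^bsub>F b\<^esub> w) = \<theta> \<zero>\<^bsub>A\<^esub>" using \<psi>(2) r f0 by simp
    also have "\<dots> = \<zero>" using mod_hom_zero[OF module_res[OF modA] modR \<theta>_hom] by simp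
    finally show ?thesis using mod_hom_smult[OF \<psi>(1) _ w] by simp
  qed
  obtain \<kappa> where \<kappa>: "\<kappa> \<in> mod_hom R (F b) (res (ring_mod A))" "\<And>u. u \<in> carrier (F b) \<Longrightarrow> \<theta> (\<kappa> u) = \<psi> u"
    by (rule free_mod_lift[OF module_res[OF modA] modR \<theta>_hom \<psi>(1)])
       (use x0 mod_hom_closed[OF \<psi>(1)] \<theta>_onto in auto)
  obtain f' where f': "f' \<in> mod_hom A (free_mod A b) (ring_mod A)"
    "\<And>u. u \<in> carrier (F b) \<Longrightarrow> f' (redv b u) = \<kappa> u"
    using factor_redv[OF modA \<kappa>(1)] by metis
  have "f' k = f k" if k: "k \<in> K" for k
  proof -
    obtain u where u: "u \<in> carrier (F b)" "k = redv b u"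
      using k K_carrier redv_onto[of b] by blast
    have "\<theta> (f' k) = \<theta> (f k)" using u k f'(2) \<kappa>(2) \<psi>(2) by (simp add: Z_def)
    moreover have "f k \<in> carrier A" using mod_hom_closed[OF f] k by simp
    moreover have "f' k \<in> carrier A" using mod_hom_closed[OF f'(1)] k K_carrier by auto
    ultimately show ?thesis using inj_onD[OF \<theta>_inj] by blast
  qed
  thus ?thesis using f'(1) by blast
qed

text \<open>Makes the syzygy step repeatable. \<open>Z\<close> is acyclic as a syzygy of
  \<open>X\<close>, and reduction maps it onto \<open>K\<close> with kernel \<open>x R^b\<close>. A
  cover of \<open>Z\<close> with one block for \<open>K\<close> and one for \<open>x R^b\<close> has
  the form treated by \<open>ext_vanish_project\<close>, which removes the second block.\<close>

lemma kernel_acyclic: "acyclic_mod (res ((free_mod A b)\<lparr>carrier := K\<rparr>))"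
  unfolding acyclic_mod_def
proof (intro allI ballI impI)
  fix c \<kappa> i
  assume \<kappa>': "\<kappa> \<in> mod_hom R (F c) (res ((free_mod A b)\<lparr>carrier := K\<rparr>))"
    "\<kappa> ` carrier (F c) = carrier (res ((free_mod A b)\<lparr>carrier := K\<rparr>))"
  have \<kappa>: "\<kappa> \<in> mod_hom R (F c) (res (free_mod A b))" and \<kappa>K: "\<kappa> ` carrier (F c) = K"
    using \<kappa>' mod_hom_into_sub[of K "res (free_mod A b)" \<kappa> R "F c"] K_carrier by (simp_all add: sub_res)
  define Z where "Z = {u \<in> carrier (F b). redv b u \<in> K}"
  note Z = kernel_pullback[folded Z_def]
  interpret M: Module.module R "F b" by (rule modF)
  interpret MA: Module.module R "res (free_mod A b)" by (rule module_res[OF modFA])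
  interpret E: Module.module R "F (c + b)" by (rule modF)
  note ir = inr_hom[OF crR] and il = inl_hom[OF crR]
  obtain g where g: "g \<in> mod_hom R (F c) (F b)" "\<And>u. u \<in> carrier (F c) \<Longrightarrow> redv b (g u) = \<kappa> u"
    by (rule free_mod_lift[OF modF module_res[OF modFA] redv_hom \<kappa>])
       (use mod_hom_closed[OF \<kappa>] in \<open>auto simp: redv_onto\<close>)
  \<comment> \<open>\<open>g\<close> lifts the given cover of \<open>K\<close>, and multiples of
    \<open>x\<close> account for the kernel of reduction; the image is \<open>Z\<close>, and
    \<open>ker G\<close> projects onto \<open>ker \<kappa>\<close>.\<close>
  define G where "G = (\<lambda>w. g (prl c w) \<oplus>\<^bsub>F b\<^esub> x \<odot>\<^bsub>F b\<^esub> prr c b w)"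
  have G: "G \<in> mod_hom R (F (c + b)) (F b)" unfolding G_def
    by (intro mod_hom_plus[OF modF] mod_hom_comp[OF prl_hom g(1)] mod_hom_scale[OF modF _ prr_hom]) simp
  have Gn: "G (inl R c b u \<oplus>\<^bsub>F (c + b)\<^esub> inr R c b v) = g u \<oplus>\<^bsub>F b\<^esub> x \<odot>\<^bsub>F b\<^esub> v"
    if "u \<in> carrier (F c)" "v \<in> carrier (F b)" for u v
  proof -
    note i = mod_hom_closed[OF il that(1), of b] mod_hom_closed[OF ir that(2), of c]
    interpret C: Module.module R "F c" by (rule modF)
    show ?thesis unfolding G_def
      using i that by (simp add: mod_hom_add[OF prl_hom] mod_hom_add[OF prr_hom] prl_inl prl_inr prr_inl prr_inr)
  qed
  have rG: "redv b (G w) = \<kappa> (prl c w)" if w: "w \<in> carrier (F (c + b))" for w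
  proof -
    note p = mod_hom_closed[OF prl_hom w] mod_hom_closed[OF prr_hom w]
    have "redv b (x \<odot>\<^bsub>F b\<^esub> prr c b w) = \<zero>\<^bsub>res (free_mod A b)\<^esub>"
      using redv_kernel[of "x \<odot>\<^bsub>F b\<^esub> prr c b w" b] p by auto
    thus ?thesis unfolding G_def
      using p mod_hom_closed[OF g(1) p(1)] mod_hom_closed[OF \<kappa> p(1)] MA.r_zero[of "\<kappa> (prl c w)"]
      by (simp add: mod_hom_add[OF redv_hom] g(2))
  qed
  have split: "\<exists>v\<in>carrier (F b). z = g u \<oplus>\<^bsub>F b\<^esub> x \<odot>\<^bsub>F b\<^esub> v"
    if z: "z \<in> carrier (F b)" and u: "u \<in> carrier (F c)" "redv b z = \<kappa> u" for z u
  proof -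
    have gu: "g u \<in> carrier (F b)" by (rule mod_hom_closed[OF g(1) u(1)])
    have "redv b (z \<ominus>\<^bsub>F b\<^esub> g u) = \<kappa> u \<ominus>\<^bsub>res (free_mod A b)\<^esub> \<kappa> u"
      using mod_hom_minus[OF modF module_res[OF modFA] redv_hom z gu] u g(2) by simp
    also have "\<dots> = \<zero>\<^bsub>free_mod A b\<^esub>"
      using mod_hom_closed[OF \<kappa> u(1)] MA.r_neg[of "\<kappa> u"] by (simp add: MA.minus_eq)
    finally obtain v where v: "v \<in> carrier (F b)" "z \<ominus>\<^bsub>F b\<^esub> g u = x \<odot>\<^bsub>F b\<^esub> v"
      using redv_kernel[of "z \<ominus>\<^bsub>F b\<^esub> g u" b] z gu by auto
    have "z = g u \<oplus>\<^bsub>F b\<^esub> (z \<ominus>\<^bsub>F b\<^esub> g u)" using z gu by (simp add: M.minus_eq M.a_lcomm M.r_neg)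
    thus ?thesis using v by metis
  qed
  have GZ: "G ` carrier (F (c + b)) = Z"
  proof (intro equalityI subsetI)
    fix z assume "z \<in> G ` carrier (F (c + b))"
    then obtain w where w: "w \<in> carrier (F (c + b))" "z = G w" by auto
    thus "z \<in> Z" using rG[OF w(1)] \<kappa>K mod_hom_closed[OF prl_hom w(1)] mod_hom_closed[OF G w(1)]
      by (auto simp: Z_def)
  next
    fix z assume z: "z \<in> Z"
    hence zF: "z \<in> carrier (F b)" "redv b z \<in> \<kappa> ` carrier (F c)" unfolding \<kappa>K by (auto simp: Z_def)
    then obtain u where u: "u \<in> carrier (F c)" "redv b z = \<kappa> u" by auto
    then obtain v where v: "v \<in> carrier (F b)" "z = g u \<oplus>\<^bsub>F b\<^esub> x \<odot>\<^bsub>F b\<^esub> v" using split zF by metis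
    thus "z \<in> G ` carrier (F (c + b))" using Gn[OF u(1) v(1)] mod_hom_closed[OF il u(1)] mod_hom_closed[OF ir v(1)]
      by (intro image_eqI[of _ _ "inl R c b u \<oplus>\<^bsub>F (c + b)\<^esub> inr R c b v"]) auto
  qed
  let ?K2 = "{w \<in> carrier (F (c + b)). G w = \<zero>\<^bsub>F b\<^esub>}"
  have "ext_vanish R i c (prl c ` ?K2)"
  proof (rule ext_vanish_project[OF xy submodule_kernel[OF modF modF G]])
    show "(\<lambda>u. \<ominus>\<^bsub>F b\<^esub> g u) \<in> mod_hom R (F c) (F b)" by (rule mod_hom_uminus[OF modF g(1)])
    show "x \<odot>\<^bsub>F b\<^esub> prr c b w = \<ominus>\<^bsub>F b\<^esub> g (prl c w)" if w: "w \<in> ?K2" for w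
    proof -
      have wF: "w \<in> carrier (F (c + b))" using w by simp
      note p = mod_hom_closed[OF prl_hom wF] mod_hom_closed[OF prr_hom wF]
      have "g (prl c w) \<oplus>\<^bsub>F b\<^esub> x \<odot>\<^bsub>F b\<^esub> prr c b w = \<zero>\<^bsub>F b\<^esub>" using w by (simp add: G_def)
      thus ?thesis using p mod_hom_closed[OF g(1) p(1)]
        by (metis M.minus_equality M.minus_minus M.smult_closed xy_closed(1))
    qed
    show "inr R c b v \<in> ?K2 \<longleftrightarrow> (\<exists>v'\<in>carrier (F b). v = y \<odot>\<^bsub>F b\<^esub> v')" if v: "v \<in> carrier (F b)" for v
    proof -
      have "G (inr R c b v) = x \<odot>\<^bsub>F b\<^esub> v"
        unfolding G_def prl_inr prr_inr[OF v] mod_hom_zero[OF modF modF g(1)] using v by simp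
      thus ?thesis using mod_hom_closed[OF ir v, of c] exact_pair_free_mod[OF xy v] by simp
    qed
    \<comment> \<open>\<open>ker G\<close> is a second syzygy of \<open>X\<close>, so index
      \<open>Suc i\<close> is used for \<open>Z\<close>.\<close>
    show "ext_vanish R i (c + b) ?K2" using Z(2)[of "Suc i"] G GZ by auto
  qed
  moreover have "prl c ` ?K2 = {u \<in> carrier (F c). \<kappa> u = \<zero>\<^bsub>free_mod A b\<^esub>}"
  proof (intro equalityI subsetI)
    fix u assume "u \<in> prl c ` ?K2"
    then obtain w where w: "w \<in> carrier (F (c + b))" "G w = \<zero>\<^bsub>F b\<^esub>" "u = prl c w" by auto
    have "\<kappa> u = \<zero>\<^bsub>free_mod A b\<^esub>"
      using rG[OF w(1)] w mod_hom_zero[OF modF module_res[OF modFA] redv_hom, of b] by simp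
    thus "u \<in> {u \<in> carrier (F c). \<kappa> u = \<zero>\<^bsub>free_mod A b\<^esub>}" using w mod_hom_closed[OF prl_hom w(1)] by simp
  next
    fix u assume u: "u \<in> {u \<in> carrier (F c). \<kappa> u = \<zero>\<^bsub>free_mod A b\<^esub>}"
    hence uF: "u \<in> carrier (F c)" and "redv b \<zero>\<^bsub>F b\<^esub> = \<kappa> u"
      using mod_hom_zero[OF modF module_res[OF modFA] redv_hom, of b] by auto
    then obtain v where v: "v \<in> carrier (F b)" "\<zero>\<^bsub>F b\<^esub> = g u \<oplus>\<^bsub>F b\<^esub> x \<odot>\<^bsub>F b\<^esub> v"
      using split[OF M.zero_closed uF] by metis
    let ?w = "inl R c b u \<oplus>\<^bsub>F (c + b)\<^esub> inr R c b v"
    interpret C: Module.module R "F c" by (rule modF)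
    note i = mod_hom_closed[OF il uF, of b] mod_hom_closed[OF ir v(1), of c]
    have "prl c ?w = u" using i uF by (simp add: mod_hom_add[OF prl_hom] prl_inl prl_inr)
    moreover have "?w \<in> ?K2" using Gn[OF uF v(1)] v(2)[symmetric] i by simp
    ultimately show "u \<in> prl c ` ?K2" by (intro image_eqI[OF sym])
  qed
  ultimately show "ext_vanish R i c {u \<in> carrier (F c). \<kappa> u = \<zero>\<^bsub>res ((free_mod A b)\<lparr>carrier := K\<rparr>)\<^esub>}"
    by simp
qed

end

text \<open>Finite generation descends from \<open>R\<close>: the preimage of \<open>K\<close> in
  \<open>R^b\<close> is finitely generated, and reducing its generators modulo \<open>x\<close>
  gives generators of \<open>K\<close>.\<close>

lemma submodule_A_fin_gen:
  assumes "submodule K A (free_mod A b)"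
  obtains c g where "g \<in> mod_hom A (free_mod A c) (free_mod A b)" "g ` carrier (free_mod A c) = K"
proof -
  interpret FA: Module.module A "free_mod A b" by (rule modFA)
  interpret M: Module.module R "F b" by (rule modF)
  note KE = FA.submoduleE[OF assms]
  let ?Z = "{u \<in> carrier (F b). redv b u \<in> K}"
  have "submodule ?Z R (F b)"
  proof (rule M.submoduleI)
    show "\<zero>\<^bsub>F b\<^esub> \<in> ?Z"
      using mod_hom_zero[OF modF module_res[OF modFA] redv_hom, of b] submodule_zero_closed[OF modFA assms] by simp
    have "\<ominus>\<^bsub>res (free_mod A b)\<^esub> v = \<ominus>\<^bsub>free_mod A b\<^esub> v" for v
      by (simp add: a_inv_def m_inv_def)
    thus "\<ominus>\<^bsub>F b\<^esub> a \<in> ?Z" if "a \<in> ?Z" for a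
      using that KE mod_hom_neg[OF modF module_res[OF modFA] redv_hom] by auto
    show "a \<oplus>\<^bsub>F b\<^esub> v \<in> ?Z" if "a \<in> ?Z" "v \<in> ?Z" for a v
      using that KE by (auto simp: mod_hom_add[OF redv_hom])
    show "a \<odot>\<^bsub>F b\<^esub> v \<in> ?Z" if "a \<in> carrier R" "v \<in> ?Z" for a v
      using that KE red_closed by (auto simp: mod_hom_smult[OF redv_hom])
  qed auto
  then obtain c g where g: "g \<in> mod_hom R (F c) (F b)" "g ` carrier (F c) = ?Z"
    by (rule submodule_fin_gen)
  obtain \<kappa>' where "\<kappa>' \<in> mod_hom A (free_mod A c) (free_mod A b)"
    "\<kappa>' ` carrier (free_mod A c) = (\<lambda>u. redv b (g u)) ` carrier (F c)"
    using factor_redv[OF modFA mod_hom_comp[OF g(1) redv_hom]] by metis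
  moreover have "(\<lambda>u. redv b (g u)) ` carrier (F c) = redv b ` ?Z" using g(2) by (auto simp: image_image[symmetric])
  moreover have "redv b ` ?Z = K"
    using KE(1) redv_onto[of b] by auto
  ultimately show ?thesis using that by auto
qed

text \<open>Links the syzygy form of vanishing with the definition by a free resolution. Acyclicity
  over \<open>R\<close> survives each syzygy over \<open>A\<close>, so a resolution can be built in
  which functionals extend from the image of every differential.\<close>

lemma Ext_vanishing:
  assumes X: "Module.module A X" and acyc: "acyclic_mod (res X)"
    and \<epsilon>: "\<epsilon> \<in> mod_hom A (free_mod A b0) X" "\<epsilon> ` carrier (free_mod A b0) = carrier X"
  shows "Ext_succ_zero A X j"
proof -
  \<comment> \<open>Vanishing of \<open>Ext^1\<close> for \<open>A^b / K\<close>, as extendability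
    of functionals.\<close>
  define E where "E b K \<longleftrightarrow> (\<forall>f\<in>mod_hom A ((free_mod A b)\<lparr>carrier := K\<rparr>) (ring_mod A).
      \<exists>f'\<in>mod_hom A (free_mod A b) (ring_mod A). \<forall>k\<in>K. f' k = f k)" for b K
  \<comment> \<open>A state is one differential \<open>g\<close> from \<open>A^c\<close> to
    \<open>A^b\<close>. Acyclicity of its image keeps the construction going; \<open>E\<close> is
    what the cohomology needs in the end.\<close>
  define P where "P = (\<lambda>(b, c, g). g \<in> mod_hom A (free_mod A c) (free_mod A b) \<and>
      acyclic_mod (res ((free_mod A b)\<lparr>carrier := g ` carrier (free_mod A c)\<rparr>)) \<and>
      E b (g ` carrier (free_mod A c)))"
  define ker where "ker b c g = {u \<in> carrier (free_mod A c). g u = \<zero>\<^bsub>free_mod A b\<^esub>}"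
    for b c and g :: "(nat \<Rightarrow> 'a set) \<Rightarrow> (nat \<Rightarrow> 'a set)"
  define Q where "Q = (\<lambda>(b, c, g) (b', c', g'). b' = c \<and> g' ` carrier (free_mod A c') = ker b c g)"
  obtain c0 g0 where g0: "g0 \<in> mod_hom A (free_mod A c0) (free_mod A b0)"
    "g0 ` carrier (free_mod A c0) = {u \<in> carrier (free_mod A b0). \<epsilon> u = \<zero>\<^bsub>X\<^esub>}"
    by (rule submodule_A_fin_gen[OF submodule_kernel[OF modFA X \<epsilon>(1)]])
  have P0: "P (b0, c0, g0)" unfolding P_def E_def prod.case g0(2)
    by (intro conjI g0(1) kernel_acyclic[OF X acyc \<epsilon>] ballI kernel_functional_extends[OF X acyc \<epsilon>])
  have step: "\<exists>s'. P s' \<and> Q s s'" if "P s" for s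
  proof -
    obtain b c g where s: "s = (b, c, g)" by (cases s)
    have g: "g \<in> mod_hom A (free_mod A c) (free_mod A b)"
      and ac: "acyclic_mod (res ((free_mod A b)\<lparr>carrier := g ` carrier (free_mod A c)\<rparr>))"
      using that by (auto simp: P_def s)
    let ?Y = "(free_mod A b)\<lparr>carrier := g ` carrier (free_mod A c)\<rparr>"
    have Y: "Module.module A ?Y"
      by (rule submodule.submodule_is_module[OF submodule_range[OF modFA modFA g] modFA])
    have gY: "g \<in> mod_hom A (free_mod A c) ?Y"
      by (subst mod_hom_into_sub) (use g mod_hom_closed[OF g] in auto)
    have gon: "g ` carrier (free_mod A c) = carrier ?Y" by simp
    have k: "{u \<in> carrier (free_mod A c). g u = \<zero>\<^bsub>?Y\<^esub>} = ker b c g" by (simp add: ker_def)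
    obtain c' g' where g': "g' \<in> mod_hom A (free_mod A c') (free_mod A c)"
      "g' ` carrier (free_mod A c') = ker b c g" unfolding ker_def
      by (rule submodule_A_fin_gen[OF submodule_kernel[OF modFA modFA g]])
    have "P (c, c', g')" unfolding P_def E_def prod.case g'(2)
      by (intro conjI g'(1) kernel_acyclic[OF Y ac gY gon, unfolded k] ballI
            kernel_functional_extends[OF Y ac gY gon, unfolded k])
    thus ?thesis using g' by (intro exI[of _ "(c, c', g')"]) (auto simp: Q_def s)
  qed
  \<comment> \<open>Dependent choice splices the steps into one resolution. The clause for
    \<open>n = 0\<close> fixes the first differential as \<open>g0\<close>, whose image is
    \<open>ker \<epsilon>\<close>.\<close>
  have "\<exists>f. \<forall>n. (P (f n) \<and> (n = 0 \<longrightarrow> f n = (b0, c0, g0))) \<and> Q (f n) (f (Suc n))"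
    using dependent_nat_choice[of "\<lambda>n s. P s \<and> (n = 0 \<longrightarrow> s = (b0, c0, g0))" "\<lambda>_. Q"] P0 step by auto
  then obtain f where f: "\<And>n. P (f n)" "f 0 = (b0, c0, g0)" "\<And>n. Q (f n) (f (Suc n))" by blast
  define b where "b n = fst (f n)" for n
  define d where "d n = snd (snd (f n))" for n
  have fn: "f n = (b n, b (Suc n), d n)" for n
    using f(3)[of n] by (auto simp: b_def d_def Q_def split: prod.splits)
  have d: "d n \<in> mod_hom A (free_mod A (b (Suc n))) (free_mod A (b n))"
    and En: "E (b n) (d n ` carrier (free_mod A (b (Suc n))))" for n
    using f(1)[of n] by (auto simp: P_def fn)
  have ex: "d (Suc n) ` carrier (free_mod A (b (Suc (Suc n)))) = ker (b n) (b (Suc n)) (d n)" for n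
    using f(3)[of n] by (simp add: Q_def fn)
  have 0: "b 0 = b0" "b (Suc 0) = c0" "d 0 = g0" using f(2) by (auto simp: fn)
  have "free_resolution A X b d \<epsilon>" unfolding free_resolution_def
    using \<epsilon> d ex 0 g0 by (auto simp: ker_def)
  moreover have "\<exists>\<psi>\<in>carrier (dual_mod A (free_mod A (b j))). \<forall>u\<in>carrier (free_mod A (b (Suc j))). \<phi> u = \<psi> (d j u)"
    if \<phi>': "\<phi> \<in> carrier (dual_mod A (free_mod A (b (Suc j))))"
      and \<phi>d: "\<And>u. u \<in> carrier (free_mod A (b (Suc (Suc j)))) \<Longrightarrow> \<phi> (d (Suc j) u) = \<zero>\<^bsub>A\<^esub>" for \<phi>
  proof -
    have \<phi>: "\<phi> \<in> mod_hom A (free_mod A (b (Suc j))) (ring_mod A)" using \<phi>' by (simp add: dual_mod_def)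
    interpret FA: Module.module A "free_mod A (b (Suc j))" by (rule modFA)
    interpret FA': Module.module A "free_mod A (b j)" by (rule modFA)
    interpret RA: Module.module A "ring_mod A" by (rule modA)
    let ?C = "carrier (free_mod A (b (Suc j)))"
    \<comment> \<open>A cocycle \<open>\<phi>\<close> vanishes on the image of
      \<open>d (Suc j)\<close>, which is the kernel of \<open>d j\<close>, so it descends to a
      functional on the image of \<open>d j\<close>. Extending that functional to the free module
      shows that \<open>\<phi>\<close> is a coboundary.\<close>
    define h where "h k = \<phi> (SOME u. u \<in> ?C \<and> d j u = k)" for k
    have \<phi>0: "\<phi> u = \<phi> v" if uv: "u \<in> ?C" "v \<in> ?C" "d j u = d j v" for u v
    proof -
      have "d j (u \<ominus>\<^bsub>free_mod A (b (Suc j))\<^esub> v) = \<zero>\<^bsub>free_mod A (b j)\<^esub>"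
        using uv mod_hom_closed[OF d] by (simp add: mod_hom_minus[OF modFA modFA d] FA'.minus_eq FA'.r_neg)
      hence "u \<ominus>\<^bsub>free_mod A (b (Suc j))\<^esub> v \<in> ker (b j) (b (Suc j)) (d j)" using uv by (simp add: ker_def)
      then obtain w where "w \<in> carrier (free_mod A (b (Suc (Suc j))))" "u \<ominus>\<^bsub>free_mod A (b (Suc j))\<^esub> v = d (Suc j) w"
        unfolding ex[symmetric] by auto
      hence "\<phi> (u \<ominus>\<^bsub>free_mod A (b (Suc j))\<^esub> v) = \<zero>\<^bsub>ring_mod A\<^esub>" using \<phi>d by simp
      hence "\<phi> u \<ominus>\<^bsub>ring_mod A\<^esub> \<phi> v = \<zero>\<^bsub>ring_mod A\<^esub>" using uv by (simp add: mod_hom_minus[OF modFA modA \<phi>])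
      thus ?thesis using mod_hom_closed[OF \<phi> uv(1)] mod_hom_closed[OF \<phi> uv(2)]
        by (metis RA.a_inv_closed RA.minus_equality RA.minus_eq RA.minus_minus)
    qed
    have h: "h (d j u) = \<phi> u" if u: "u \<in> ?C" for u
    proof -
      have "\<exists>v. v \<in> ?C \<and> d j v = d j u" using u by blast
      from someI_ex[OF this] show ?thesis unfolding h_def using \<phi>0 u by blast
    qed
    have "h \<in> mod_hom A ((free_mod A (b j))\<lparr>carrier := d j ` ?C\<rparr>) (ring_mod A)"
    proof (rule mod_homI)
      fix k assume "k \<in> carrier ((free_mod A (b j))\<lparr>carrier := d j ` ?C\<rparr>)"
      then obtain u where u: "u \<in> ?C" "k = d j u" by auto
      show "h k \<in> carrier (ring_mod A)" using h u mod_hom_closed[OF \<phi> u(1)] by simp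
      show "h (k \<oplus>\<^bsub>(free_mod A (b j))\<lparr>carrier := d j ` ?C\<rparr>\<^esub> l) = h k \<oplus>\<^bsub>ring_mod A\<^esub> h l"
        if l: "l \<in> carrier ((free_mod A (b j))\<lparr>carrier := d j ` ?C\<rparr>)" for l
      proof -
        obtain v where v: "v \<in> ?C" "l = d j v" using l by auto
        show ?thesis using h[of "u \<oplus>\<^bsub>free_mod A (b (Suc j))\<^esub> v"] u v h mod_hom_add[OF d u(1) v(1)] mod_hom_add[OF \<phi> u(1) v(1)] by simp
      qed
      fix a assume a: "a \<in> carrier A"
      show "h (a \<odot>\<^bsub>(free_mod A (b j))\<lparr>carrier := d j ` ?C\<rparr>\<^esub> k) = a \<odot>\<^bsub>ring_mod A\<^esub> h k"
        using h[of "a \<odot>\<^bsub>free_mod A (b (Suc j))\<^esub> u"] u h mod_hom_smult[OF d a u(1)] mod_hom_smult[OF \<phi> a u(1)] a by simp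
    qed
    then obtain h' where h': "h' \<in> mod_hom A (free_mod A (b j)) (ring_mod A)" "\<forall>k\<in>d j ` ?C. h' k = h k"
      using En[of j] unfolding E_def by blast
    show ?thesis
      by (rule bexI[of _ "restrict h' (carrier (free_mod A (b j)))"])
         (use h' h mod_hom_closed[OF d] in \<open>auto simp: dual_mod_def mod_hom_restrict_iff[OF modFA]\<close>)
  qed
  ultimately show ?thesis unfolding Ext_succ_zero_def
    by (intro exI[of _ b] exI[of _ d] exI[of _ \<epsilon>] conjI ballI impI) simp_all
qed

end

subsection \<open>Quotient modules\<close>

text \<open>The fields \<open>mult\<close> and \<open>one\<close> are part of the record type only and play no role.\<close>
definition quot_module :: "('r, 'c, 'm) module_scheme \<Rightarrow> 'c set \<Rightarrow> ('r, 'c set) module" where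
  "quot_module M K = \<lparr>carrier = a_rcosets\<^bsub>M\<^esub> K, mult = (\<lambda>C D. K), one = K, zero = K,
     add = set_add M, smult = (\<lambda>a C. \<Union>m\<in>C. K +>\<^bsub>M\<^esub> (a \<odot>\<^bsub>M\<^esub> m))\<rparr>"

definition quot_lift :: "('r, 'c, 'm) module_scheme \<Rightarrow> 'c set \<Rightarrow> ('c \<Rightarrow> 'd) \<Rightarrow> 'c set \<Rightarrow> 'd" where
  "quot_lift M K h C = h (SOME m. m \<in> carrier M \<and> K +>\<^bsub>M\<^esub> m = C)"

locale quotient_module = Module.module R M for R and M (structure) +
  fixes K assumes K: "submodule K R M"
begin

lemma abelian_subgroup_K: "abelian_subgroup K M"
  by (rule abelian_subgroupI3[OF additive_subgroup.intro])
     (use K submodule.axioms(1) M.abelian_group_axioms in auto)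

interpretation K: abelian_subgroup K M by (rule abelian_subgroup_K)

abbreviation "Q \<equiv> quot_module M K"

lemma carrier_Q: "carrier Q = (\<lambda>m. K +> m) ` carrier M"
  by (auto simp: quot_module_def A_RCOSETS_def')

lemma coset_eq_iff:
  assumes "a \<in> carrier M" "b \<in> carrier M"
  shows "K +> a = K +> b \<longleftrightarrow> a \<ominus> b \<in> K"
proof -
  have "K +> a = K +> b \<longleftrightarrow> a \<in> K +> b"
    using K.a_repr_independenceD[OF assms(1)] K.a_repr_independence'[OF _ assms(2), of a] assms(1)
    by (metis K.a_rcos_self)
  also have "\<dots> \<longleftrightarrow> a \<ominus> b \<in> K" using K.a_rcos_module[OF assms(2,1)] by (simp add: M.minus_eq)
  finally show ?thesis .
qed

lemma coset_closed: "m \<in> carrier M \<Longrightarrow> K +> m \<in> carrier Q"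
  by (auto simp: carrier_Q)

lemma coset_add:
  "a \<in> carrier M \<Longrightarrow> b \<in> carrier M \<Longrightarrow> (K +> a) \<oplus>\<^bsub>Q\<^esub> (K +> b) = K +> (a \<oplus> b)"
  by (simp add: quot_module_def K.a_rcos_sum)

lemma coset_smult:
  assumes a: "a \<in> carrier R" and m: "m \<in> carrier M"
  shows "a \<odot>\<^bsub>Q\<^esub> (K +> m) = K +> (a \<odot> m)"
proof -
  have "K +> (a \<odot> m') = K +> (a \<odot> m)" if m': "m' \<in> K +> m" for m'
  proof -
    have m'M: "m' \<in> carrier M" using K.a_elemrcos_carrier[OF m m'] .
    have "m' \<ominus> m \<in> K" using coset_eq_iff[OF m'M m] K.a_repr_independence'[OF m' m] by simp
    hence "a \<odot> (m' \<ominus> m) \<in> K" using submoduleE(4)[OF K a] by blast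
    moreover have "a \<odot> (m' \<ominus> m) = a \<odot> m' \<ominus> a \<odot> m"
      using a m m'M by (simp add: M.minus_eq smult_r_distr smult_r_minus)
    ultimately show ?thesis using coset_eq_iff a m m'M by simp
  qed
  moreover have "m \<in> K +> m" using m by (rule K.a_rcos_self)
  ultimately show ?thesis unfolding quot_module_def module.simps by blast
qed

lemma coset_zero: "K +> \<zero> = \<zero>\<^bsub>Q\<^esub>"
  by (simp add: quot_module_def K.a_subset)

lemma coset_zero_iff: "m \<in> carrier M \<Longrightarrow> K +> m = \<zero>\<^bsub>Q\<^esub> \<longleftrightarrow> m \<in> K"
  using coset_eq_iff[of m \<zero>] by (simp add: coset_zero M.minus_eq M.neg_zero)

lemma module_Q: "Module.module R Q"
proof -
  have "abelian_group Q"
  proof (rule abelian_groupI)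
    fix u v w
    assume "u \<in> carrier Q" "v \<in> carrier Q" "w \<in> carrier Q"
    thus "u \<oplus>\<^bsub>Q\<^esub> v \<oplus>\<^bsub>Q\<^esub> w = u \<oplus>\<^bsub>Q\<^esub> (v \<oplus>\<^bsub>Q\<^esub> w)"
      by (auto simp: carrier_Q coset_add M.a_assoc)
  next
    fix u v assume "u \<in> carrier Q" "v \<in> carrier Q"
    thus "u \<oplus>\<^bsub>Q\<^esub> v = v \<oplus>\<^bsub>Q\<^esub> u" "u \<oplus>\<^bsub>Q\<^esub> v \<in> carrier Q"
      by (auto simp: carrier_Q coset_add M.a_comm)
  next
    fix u assume "u \<in> carrier Q"
    then obtain m where m: "m \<in> carrier M" "u = K +> m" by (auto simp: carrier_Q)
    show "\<zero>\<^bsub>Q\<^esub> \<oplus>\<^bsub>Q\<^esub> u = u" using m by (simp add: coset_zero[symmetric] coset_add)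
    show "\<exists>v\<in>carrier Q. v \<oplus>\<^bsub>Q\<^esub> u = \<zero>\<^bsub>Q\<^esub>"
      using m by (intro bexI[of _ "K +> (\<ominus> m)"]) (auto simp: coset_zero[symmetric] coset_add M.l_neg coset_closed)
  next
    show "\<zero>\<^bsub>Q\<^esub> \<in> carrier Q" by (auto simp: carrier_Q coset_zero[symmetric])
  qed
  thus ?thesis
    by (intro moduleI[OF R.is_cring])
       (auto simp: carrier_Q coset_add coset_smult smult_l_distr smult_r_distr smult_assoc1)
qed

lemma coset_hom: "(\<lambda>m. K +> m) \<in> mod_hom R M Q"
  by (rule mod_homI) (auto simp: coset_closed coset_add coset_smult)

lemma quot_lift:
  assumes N: "Module.module R N" and h: "h \<in> mod_hom R M N" and hK: "\<And>k. k \<in> K \<Longrightarrow> h k = \<zero>\<^bsub>N\<^esub>"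
  shows quot_lift_coset: "m \<in> carrier M \<Longrightarrow> quot_lift M K h (K +> m) = h m"
    and quot_lift_hom: "quot_lift M K h \<in> mod_hom R Q N"
proof -
  interpret N: Module.module R N by fact
  show *: "quot_lift M K h (K +> m) = h m" if m: "m \<in> carrier M" for m
  proof -
    define m' where "m' = (SOME m'. m' \<in> carrier M \<and> K +> m' = K +> m)"
    have m': "m' \<in> carrier M" "K +> m' = K +> m"
      unfolding m'_def using someI[of "\<lambda>m'. m' \<in> carrier M \<and> K +> m' = K +> m" m] m by auto
    hence "h (m' \<ominus> m) = \<zero>\<^bsub>N\<^esub>" using hK coset_eq_iff m by auto
    hence "h m' \<ominus>\<^bsub>N\<^esub> h m = \<zero>\<^bsub>N\<^esub>" using mod_hom_minus[OF module_axioms N h m'(1) m] by simp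
    moreover have "h m' \<in> carrier N" "h m \<in> carrier N" using mod_hom_closed[OF h] m m' by auto
    ultimately have "h m' = h m"
      by (metis N.a_inv_closed N.minus_equality N.minus_eq N.minus_minus)
    thus ?thesis by (simp add: quot_lift_def m'_def)
  qed
  show "quot_lift M K h \<in> mod_hom R Q N"
    by (rule mod_homI)
       (auto simp: carrier_Q coset_add coset_smult * mod_homD[OF h])
qed

end

section \<open>Dual modules\<close>

lemma dual_mod_simps:
  "carrier (dual_mod A M) = mod_hom A M (ring_mod A) \<inter> extensional (carrier M)"
  "zero (dual_mod A M) = restrict (\<lambda>u. \<zero>\<^bsub>A\<^esub>) (carrier M)"
  "add (dual_mod A M) = (\<lambda>f g. restrict (\<lambda>u. f u \<oplus>\<^bsub>A\<^esub> g u) (carrier M))"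
  "smult (dual_mod A M) = (\<lambda>a f. restrict (\<lambda>u. a \<otimes>\<^bsub>A\<^esub> f u) (carrier M))"
  by (simp_all add: dual_mod_def)

lemma dual_modI:
  assumes "Module.module A M" "f \<in> mod_hom A M (ring_mod A)"
  shows "restrict f (carrier M) \<in> carrier (dual_mod A M)"
  using assms by (simp add: dual_mod_simps mod_hom_restrict_iff)

lemma dual_mod_eqI:
  assumes "f \<in> carrier (dual_mod A M)" "g \<in> carrier (dual_mod A M)" "\<And>u. u \<in> carrier M \<Longrightarrow> f u = g u"
  shows "f = g"
  using assms by (auto simp: dual_mod_simps intro: extensionalityI)

lemma module_dual_mod:
  assumes "Module.module A M" shows "Module.module A (dual_mod A M)"
proof -
  interpret M: Module.module A M by fact
  note RM = module_ring_mod[OF M.R.is_cring]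
  let ?D = "dual_mod A M"
  note eqI = dual_mod_eqI[where A = A and M = M]
  have D: "f \<in> mod_hom A M (ring_mod A)" "\<And>u. u \<in> carrier M \<Longrightarrow> f u \<in> carrier A" if "f \<in> carrier ?D" for f
    using that mod_hom_closed[of f A M "ring_mod A"] by (auto simp: dual_mod_simps)
  have z: "\<zero>\<^bsub>?D\<^esub> \<in> carrier ?D"
    using dual_modI[OF assms mod_hom_const_zero[OF RM]] by (simp add: dual_mod_simps)
  have a: "f \<oplus>\<^bsub>?D\<^esub> g \<in> carrier ?D" if "f \<in> carrier ?D" "g \<in> carrier ?D" for f g
    using dual_modI[OF assms mod_hom_plus[OF RM D(1)[OF that(1)] D(1)[OF that(2)]]]
    by (simp add: dual_mod_simps)
  have s: "c \<odot>\<^bsub>?D\<^esub> f \<in> carrier ?D" if "c \<in> carrier A" "f \<in> carrier ?D" for c f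
    using dual_modI[OF assms mod_hom_scale[OF RM that(1) D(1)[OF that(2)]]]
    by (simp add: dual_mod_simps)
  have ev: "(f \<oplus>\<^bsub>?D\<^esub> g) u = f u \<oplus>\<^bsub>A\<^esub> g u" "(c \<odot>\<^bsub>?D\<^esub> f) u = c \<otimes>\<^bsub>A\<^esub> f u" "\<zero>\<^bsub>?D\<^esub> u = \<zero>\<^bsub>A\<^esub>"
    if "u \<in> carrier M" for f g c u using that by (simp_all add: dual_mod_simps)
  have "abelian_group ?D"
  proof (rule abelian_groupI)
    fix f g h assume fgh: "f \<in> carrier ?D" "g \<in> carrier ?D" "h \<in> carrier ?D"
    show "f \<oplus>\<^bsub>?D\<^esub> g \<oplus>\<^bsub>?D\<^esub> h = f \<oplus>\<^bsub>?D\<^esub> (g \<oplus>\<^bsub>?D\<^esub> h)"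
      by (rule eqI) (use fgh in \<open>auto simp: a ev D M.R.a_assoc\<close>)
  next
    fix f g assume fg: "f \<in> carrier ?D" "g \<in> carrier ?D"
    show "f \<oplus>\<^bsub>?D\<^esub> g = g \<oplus>\<^bsub>?D\<^esub> f"
      by (rule eqI) (use fg in \<open>auto simp: a ev D M.R.a_comm\<close>)
  next
    fix f assume f: "f \<in> carrier ?D"
    show "\<zero>\<^bsub>?D\<^esub> \<oplus>\<^bsub>?D\<^esub> f = f"
      by (rule eqI) (use f z in \<open>auto simp: a ev D\<close>)
    have n: "restrict (\<lambda>u. \<ominus>\<^bsub>ring_mod A\<^esub> f u) (carrier M) \<in> carrier ?D"
      by (intro dual_modI assms mod_hom_uminus[OF RM] D f)
    show "\<exists>g\<in>carrier ?D. g \<oplus>\<^bsub>?D\<^esub> f = \<zero>\<^bsub>?D\<^esub>"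
      by (rule bexI[OF eqI n]) (use f n z in \<open>auto simp: a ev D a_inv_ring_mod M.R.l_neg\<close>)
  qed (auto simp: a z)
  thus ?thesis
  proof (rule moduleI[OF M.R.is_cring])
    fix f assume f: "f \<in> carrier ?D"
    show "\<one>\<^bsub>A\<^esub> \<odot>\<^bsub>?D\<^esub> f = f"
      by (rule eqI) (use f in \<open>auto simp: a s ev D\<close>)
    fix b assume b: "b \<in> carrier A"
    show "b \<odot>\<^bsub>?D\<^esub> (f \<oplus>\<^bsub>?D\<^esub> g) = b \<odot>\<^bsub>?D\<^esub> f \<oplus>\<^bsub>?D\<^esub> b \<odot>\<^bsub>?D\<^esub> g" if "g \<in> carrier ?D" for g
      by (rule eqI) (use b f that in \<open>auto simp: a s ev D M.R.r_distr\<close>)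
    fix c assume c: "c \<in> carrier A"
    show "(b \<oplus>\<^bsub>A\<^esub> c) \<odot>\<^bsub>?D\<^esub> f = b \<odot>\<^bsub>?D\<^esub> f \<oplus>\<^bsub>?D\<^esub> c \<odot>\<^bsub>?D\<^esub> f"
      by (rule eqI) (use b c f in \<open>auto simp: a s ev D M.R.l_distr\<close>)
    show "b \<otimes>\<^bsub>A\<^esub> c \<odot>\<^bsub>?D\<^esub> f = b \<odot>\<^bsub>?D\<^esub> (c \<odot>\<^bsub>?D\<^esub> f)"
      by (rule eqI) (use b c f in \<open>auto simp: a s ev D M.R.m_assoc\<close>)
  qed (auto simp: s)
qed

subsection \<open>A periodic presentation matrix\<close>

text \<open>Multiplication by the block matrix with rows \<open>(x I, z)\<close> and
  \<open>(0, -y)\<close>. Column \<open>i < n\<close> is the relation \<open>x e_i = 0\<close> and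
  column \<open>n\<close> is \<open>y f = sum of z_i e_i\<close>. With the sign of \<open>y\<close>,
  the product with the matrix for exchanged \<open>x\<close> and \<open>y\<close> has off-diagonal
  block \<open>x z - z x = 0\<close>.\<close>

definition pres :: "('r, 'e) ring_scheme \<Rightarrow> nat \<Rightarrow> 'r \<Rightarrow> 'r \<Rightarrow> (nat \<Rightarrow> 'r) \<Rightarrow> (nat \<Rightarrow> 'r) \<Rightarrow> nat \<Rightarrow> 'r" where
  "pres A n x y z v = restrict (\<lambda>i. if i < n then x \<otimes>\<^bsub>A\<^esub> v i \<oplus>\<^bsub>A\<^esub> z i \<otimes>\<^bsub>A\<^esub> v n else \<ominus>\<^bsub>A\<^esub> (y \<otimes>\<^bsub>A\<^esub> v n)) {..<Suc n}"

text \<open>Multiplication by the transposed matrix; \<open>dot_pres\<close> states the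
  adjointness.\<close>

definition presT :: "('r, 'e) ring_scheme \<Rightarrow> nat \<Rightarrow> 'r \<Rightarrow> 'r \<Rightarrow> (nat \<Rightarrow> 'r) \<Rightarrow> (nat \<Rightarrow> 'r) \<Rightarrow> nat \<Rightarrow> 'r" where
  "presT A n x y z v = restrict (\<lambda>i. if i < n then x \<otimes>\<^bsub>A\<^esub> v i
      else (\<Oplus>\<^bsub>A\<^esub>j\<in>{..<n}. z j \<otimes>\<^bsub>A\<^esub> v j) \<ominus>\<^bsub>A\<^esub> y \<otimes>\<^bsub>A\<^esub> v n) {..<Suc n}"

context noetherian_base
begin

text \<open>The standard pairing on \<open>F (Suc n)\<close>; the index is \<open>n\<close>, as for
  the matrices.\<close>

definition dot :: "nat \<Rightarrow> (nat \<Rightarrow> 'a) \<Rightarrow> (nat \<Rightarrow> 'a) \<Rightarrow> 'a" where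
  "dot n u v = (\<Oplus>i\<in>{..<Suc n}. u i \<otimes> v i)"

lemma dot_eq:
  assumes "u \<in> carrier (F (Suc n))" "v \<in> carrier (F (Suc n))"
  shows "dot n u v = (\<Oplus>i\<in>{..<n}. u i \<otimes> v i) \<oplus> u n \<otimes> v n"
  using free_mod_nth(1)[OF _ assms(1)] free_mod_nth(1)[OF _ assms(2)]
  unfolding dot_def lessThan_Suc
  by (subst finsum_insert) (auto intro!: a_comm)

lemma dot_comm:
  assumes "u \<in> carrier (F (Suc n))" "v \<in> carrier (F (Suc n))"
  shows "dot n u v = dot n v u"
  using free_mod_nth(1)[OF _ assms(1)] free_mod_nth(1)[OF _ assms(2)]
  unfolding dot_def by (intro finsum_cong') (auto simp: m_comm)

lemma dot_lincomb:
  assumes "u \<in> carrier (F (Suc n))" "v \<in> carrier (F (Suc n))"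
  shows "dot n u v = lincomb RR (Suc n) u v"
  using free_mod_nth(1)[OF _ assms(1)] free_mod_nth(1)[OF _ assms(2)]
  unfolding dot_def lincomb_def finsum_ring_mod by (intro finsum_cong') (auto simp: m_comm)

lemma dot_hom:
  assumes "u \<in> carrier (F (Suc n))" shows "dot n u \<in> mod_hom R (F (Suc n)) RR"
proof -
  have "lincomb RR (Suc n) u \<in> mod_hom R (F (Suc n)) RR"
    by (rule lincomb_hom[OF modR]) (use free_mod_nth(1)[OF _ assms] in auto)
  thus ?thesis
    by (simp add: mod_hom_def Pi_iff dot_lincomb[OF assms] Module.module.smult_closed[OF modF]
        abelian_monoid.a_closed[OF abelian_group.axioms(1)[OF Module.module.axioms(2)[OF modF]]])
qed

lemma functional_dot:
  assumes "\<phi> \<in> mod_hom R (F (Suc n)) RR"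
  obtains a where "a \<in> carrier (F (Suc n))" "\<And>v. v \<in> carrier (F (Suc n)) \<Longrightarrow> \<phi> v = dot n a v"
proof -
  define a where "a = restrict (\<lambda>j. \<phi> (unitvec R (Suc n) j)) {..<Suc n}"
  have e: "\<phi> (unitvec R (Suc n) j) \<in> carrier R" for j
    using mod_hom_closed[OF assms unitvec_closed[OF crR]] by simp
  have a: "a \<in> carrier (F (Suc n))" unfolding a_def by (rule free_mod_memI) (rule e)
  have "\<phi> v = dot n a v" if v: "v \<in> carrier (F (Suc n))" for v
    unfolding mod_hom_eq_lincomb[OF modR assms v] dot_lincomb[OF a v] lincomb_def finsum_ring_mod
    by (rule finsum_cong') (use e free_mod_nth(1)[OF _ v] in \<open>auto simp: a_def\<close>)
  with a that show ?thesis by blast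
qed

lemma dot_nondegenerate:
  assumes a: "a \<in> carrier (F (Suc n))" and 0: "\<And>v. v \<in> carrier (F (Suc n)) \<Longrightarrow> dot n a v = \<zero>"
  shows "a = \<zero>\<^bsub>F (Suc n)\<^esub>"
proof (rule free_mod_eqI[OF a])
  show "\<zero>\<^bsub>F (Suc n)\<^esub> \<in> carrier (F (Suc n))" using modF by (auto simp: free_mod_simps)
  fix i assume i: "i < Suc n"
  have "dot n a (unitvec R (Suc n) i) = a i"
    unfolding dot_lincomb[OF a unitvec_closed[OF crR]]
    by (rule lincomb_unitvec[OF modR _ i]) (use free_mod_nth(1)[OF _ a] in auto)
  thus "a i = \<zero>\<^bsub>F (Suc n)\<^esub> i" using 0[OF unitvec_closed[OF crR]] i by (simp add: free_mod_nth)
qed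

context
  fixes n :: nat and z :: "nat \<Rightarrow> 'a"
  assumes zc: "z \<in> {..<n} \<rightarrow> carrier R"
begin

lemma z: "i < n \<Longrightarrow> z i \<in> carrier R" using zc by auto

lemma pres_hom:
  assumes "x \<in> carrier R" "y \<in> carrier R"
  shows "pres R n x y z \<in> mod_hom R (F (Suc n)) (F (Suc n))"
  unfolding pres_def
proof (rule mod_hom_into_free)
  fix i assume i: "i < Suc n"
  note c = free_mod_coord[OF i, of R] free_mod_coord[of n "Suc n" R, OF lessI]
  have "(\<lambda>u. (x \<odot>\<^bsub>RR\<^esub> u i) \<oplus>\<^bsub>RR\<^esub> (z i \<odot>\<^bsub>RR\<^esub> u n)) \<in> mod_hom R (F (Suc n)) RR" if "i < n"
    by (intro mod_hom_plus mod_hom_scale modR c assms z that)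
  moreover have "(\<lambda>u. \<ominus>\<^bsub>RR\<^esub> (y \<odot>\<^bsub>RR\<^esub> u n)) \<in> mod_hom R (F (Suc n)) RR"
    by (intro mod_hom_uminus mod_hom_scale modR c assms)
  ultimately show "(\<lambda>u. if i < n then x \<otimes> u i \<oplus> z i \<otimes> u n else \<ominus> (y \<otimes> u n)) \<in> mod_hom R (F (Suc n)) RR"
    by (cases "i < n") (simp_all add: a_inv_ring_mod)
qed

lemma presT_hom:
  assumes "x \<in> carrier R" "y \<in> carrier R"
  shows "presT R n x y z \<in> mod_hom R (F (Suc n)) (F (Suc n))"
  unfolding presT_def
proof (rule mod_hom_into_free)
  fix i assume i: "i < Suc n"
  note c = free_mod_coord[OF i, of R] free_mod_coord[of n "Suc n" R, OF lessI]
  have n1: "F (Suc n) = F (n + 1)" by simp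
  have "(\<lambda>u. lincomb RR n z (prl n u)) \<in> mod_hom R (F (Suc n)) RR"
    unfolding n1 by (intro mod_hom_comp[OF prl_hom] lincomb_hom[OF modR]) (use z in auto)
  hence "(\<lambda>u. lincomb RR n z (prl n u) \<ominus>\<^bsub>RR\<^esub> y \<odot>\<^bsub>RR\<^esub> u n) \<in> mod_hom R (F (Suc n)) RR"
    by (intro mod_hom_diff mod_hom_scale modR c assms)
  moreover have "lincomb RR n z (prl n u) = (\<Oplus>j\<in>{..<n}. z j \<otimes> u j)" if "u \<in> carrier (F (Suc n))" for u
    unfolding lincomb_def finsum_ring_mod
    by (rule finsum_cong') (use z free_mod_nth(1)[OF _ that] in \<open>auto simp: prl_def m_comm\<close>)
  ultimately have "(\<lambda>u. (\<Oplus>j\<in>{..<n}. z j \<otimes> u j) \<ominus> y \<otimes> u n) \<in> mod_hom R (F (Suc n)) RR"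
    by (simp add: mod_hom_def a_minus_def a_inv_ring_mod Pi_iff Module.module.smult_closed[OF modF]
        abelian_monoid.a_closed[OF abelian_group.axioms(1)[OF Module.module.axioms(2)[OF modF]]])
  moreover have "(\<lambda>u. x \<otimes> u i) \<in> mod_hom R (F (Suc n)) RR"
    using mod_hom_scale[OF modR assms(1) c(1)] by simp
  ultimately show "(\<lambda>u. if i < n then x \<otimes> u i else (\<Oplus>j\<in>{..<n}. z j \<otimes> u j) \<ominus> y \<otimes> u n) \<in> mod_hom R (F (Suc n)) RR"
    by (cases "i < n") simp_all
qed

lemma dot_pres:
  assumes x: "x \<in> carrier R" and y: "y \<in> carrier R"
    and a: "a \<in> carrier (F (Suc n))" and v: "v \<in> carrier (F (Suc n))"
  shows "dot n a (pres R n x y z v) = dot n (presT R n x y z a) v"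
proof -
  have an: "a i \<in> carrier R" "v i \<in> carrier R" if "i < Suc n" for i
    using free_mod_nth(1)[OF that] a v by auto
  have nn: "a n \<in> carrier R" "v n \<in> carrier R" using an by auto
  have "dot n a (pres R n x y z v) =
      (\<Oplus>i\<in>{..<n}. a i \<otimes> (x \<otimes> v i \<oplus> z i \<otimes> v n)) \<oplus> a n \<otimes> (\<ominus> (y \<otimes> v n))"
    unfolding dot_eq[OF a mod_hom_closed[OF pres_hom[OF x y] v]]
    using an x y z nn by (intro arg_cong2[of _ _ _ _ "add R"] finsum_cong') (auto simp: pres_def)
  also have "(\<Oplus>i\<in>{..<n}. a i \<otimes> (x \<otimes> v i \<oplus> z i \<otimes> v n)) =
      (\<Oplus>i\<in>{..<n}. (x \<otimes> a i) \<otimes> v i \<oplus> (z i \<otimes> a i) \<otimes> v n)"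
    using an x z nn by (intro finsum_cong') (auto simp: r_distr m_ac)
  also have "\<dots> = (\<Oplus>i\<in>{..<n}. (x \<otimes> a i) \<otimes> v i) \<oplus> (\<Oplus>i\<in>{..<n}. (z i \<otimes> a i) \<otimes> v n)"
    using an x z nn by (intro finsum_addf) auto
  also have "(\<Oplus>i\<in>{..<n}. (z i \<otimes> a i) \<otimes> v n) = (\<Oplus>i\<in>{..<n}. z i \<otimes> a i) \<otimes> v n"
    using an z nn by (intro finsum_ldistr[symmetric]) auto
  also have "(\<Oplus>i\<in>{..<n}. (x \<otimes> a i) \<otimes> v i) \<oplus> (\<Oplus>i\<in>{..<n}. z i \<otimes> a i) \<otimes> v n \<oplus> a n \<otimes> (\<ominus> (y \<otimes> v n)) =
     (\<Oplus>i\<in>{..<n}. (x \<otimes> a i) \<otimes> v i) \<oplus> ((\<Oplus>i\<in>{..<n}. z i \<otimes> a i) \<ominus> y \<otimes> a n) \<otimes> v n"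
  proof -
    have s: "(\<Oplus>i\<in>{..<n}. z i \<otimes> a i) \<in> carrier R" "(\<Oplus>i\<in>{..<n}. (x \<otimes> a i) \<otimes> v i) \<in> carrier R"
      using an z x by (auto intro!: finsum_closed)
    have "((\<Oplus>i\<in>{..<n}. z i \<otimes> a i) \<ominus> y \<otimes> a n) \<otimes> v n =
        (\<Oplus>i\<in>{..<n}. z i \<otimes> a i) \<otimes> v n \<oplus> (\<ominus> (y \<otimes> a n)) \<otimes> v n"
      using s nn y by (simp add: minus_eq l_distr)
    moreover have "a n \<otimes> \<ominus> (y \<otimes> v n) = (\<ominus> (y \<otimes> a n)) \<otimes> v n"
      using nn y by (simp add: r_minus l_minus m_ac)
    ultimately show ?thesis using s nn y by (simp add: a_assoc)
  qed
  also have "\<dots> = dot n (presT R n x y z a) v"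
    unfolding dot_eq[OF mod_hom_closed[OF presT_hom[OF x y] a] v]
    using an x y z nn by (intro arg_cong2[of _ _ _ _ "add R"] finsum_cong') (auto simp: presT_def)
  finally show ?thesis .
qed

text \<open>The kernel is solved from the last row upwards. \<open>y v_n = 0\<close> gives
  \<open>v_n = x s\<close>; row \<open>i\<close> becomes \<open>x (v_i + z_i s) = 0\<close> and
  gives \<open>v_i + z_i s = y u_i\<close>. The preimage has entries \<open>u_i\<close> and last
  entry \<open>-s\<close>.\<close>

lemma pres_exact:
  assumes "exact_pair x y"
  shows "pres R n y x z ` carrier (F (Suc n)) = {v \<in> carrier (F (Suc n)). pres R n x y z v = \<zero>\<^bsub>F (Suc n)\<^esub>}"
proof (intro equalityI subsetI)
  have xy: "x \<in> carrier R" "y \<in> carrier R" using assms by (auto simp: exact_pair_def)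
  have xy0: "x \<otimes> y = \<zero>" using assms r_one[of y] xy unfolding exact_pair_def by (metis one_closed)
  hence yx0: "y \<otimes> x = \<zero>" using xy m_comm by metis
  {
    fix v assume "v \<in> pres R n y x z ` carrier (F (Suc n))"
    then obtain w where w: "w \<in> carrier (F (Suc n))" "v = pres R n y x z w" by auto
    have wn: "w i \<in> carrier R" if "i < Suc n" for i by (rule free_mod_nth(1)[OF that w(1)])
    have v: "v \<in> carrier (F (Suc n))" unfolding w(2) by (rule mod_hom_closed[OF pres_hom[OF xy(2,1)] w(1)])
    have wn': "w n \<in> carrier R" using wn by simp
    have "pres R n x y z v i = \<zero>" if i: "i < Suc n" for i
    proof (cases "i < n")
      case True
      have "x \<otimes> (y \<otimes> w i \<oplus> z i \<otimes> w n) \<oplus> z i \<otimes> (\<ominus> (x \<otimes> w n)) =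
            (x \<otimes> y) \<otimes> w i \<oplus> (x \<otimes> (z i \<otimes> w n) \<oplus> \<ominus> (x \<otimes> (z i \<otimes> w n)))"
        using wn[OF i] wn' xy z[OF True] by (simp add: r_distr r_minus m_ac a_ac)
      also have "\<dots> = \<zero>" using wn[OF i] wn' xy z[OF True] by (simp add: xy0 r_neg)
      finally show ?thesis using True i by (simp add: pres_def w(2))
    next
      case False
      have "y \<otimes> (\<ominus> (x \<otimes> w n)) = \<ominus> ((y \<otimes> x) \<otimes> w n)" using wn' xy by (simp add: r_minus m_assoc)
      thus ?thesis using False i wn' by (simp add: pres_def w(2) yx0)
    qed
    hence "pres R n x y z v = \<zero>\<^bsub>F (Suc n)\<^esub>"
      by (intro free_mod_eqI[OF mod_hom_closed[OF pres_hom[OF xy] v]])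
         (auto simp: free_mod_nth Module.module_def modF free_mod_simps)
    thus "v \<in> {v \<in> carrier (F (Suc n)). pres R n x y z v = \<zero>\<^bsub>F (Suc n)\<^esub>}" using v by simp
  next
    fix v assume "v \<in> {v \<in> carrier (F (Suc n)). pres R n x y z v = \<zero>\<^bsub>F (Suc n)\<^esub>}"
    hence v: "v \<in> carrier (F (Suc n))" and e: "pres R n x y z v = \<zero>\<^bsub>F (Suc n)\<^esub>" by auto
    have vn: "v i \<in> carrier R" if "i < Suc n" for i by (rule free_mod_nth(1)[OF that v])
    have vn': "v n \<in> carrier R" using vn by simp
    have ei: "pres R n x y z v i = \<zero>" if "i < Suc n" for i unfolding e using that by (simp add: free_mod_nth)
    have "\<ominus> (y \<otimes> v n) = \<zero>" using ei[of n] by (simp add: pres_def)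
    hence "y \<otimes> v n = \<zero>" using vn' xy by (metis m_closed minus_minus minus_zero)
    then obtain s where s: "s \<in> carrier R" "v n = x \<otimes> s" using assms vn' by (auto simp: exact_pair_def)
    have "\<exists>u\<in>carrier R. v i \<oplus> z i \<otimes> s = y \<otimes> u" if i: "i < n" for i
    proof -
      have vi: "v i \<in> carrier R" using vn i by simp
      have "x \<otimes> v i \<oplus> z i \<otimes> (x \<otimes> s) = \<zero>" using ei[of i] i s by (simp add: pres_def)
      hence "x \<otimes> (v i \<oplus> z i \<otimes> s) = \<zero>" using vi s xy z[OF i] by (simp add: r_distr m_lcomm)
      thus ?thesis using assms vi z[OF i] s by (auto simp: exact_pair_def)
    qed
    then obtain u where u: "\<And>i. i < n \<Longrightarrow> u i \<in> carrier R" "\<And>i. i < n \<Longrightarrow> v i \<oplus> z i \<otimes> s = y \<otimes> u i" by metis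
    define w where "w = restrict (\<lambda>i. if i < n then u i else \<ominus> s) {..<Suc n}"
    have w: "w \<in> carrier (F (Suc n))" unfolding w_def by (rule free_mod_memI) (use u s in auto)
    have "pres R n y x z w = v"
    proof (rule free_mod_eqI[OF mod_hom_closed[OF pres_hom[OF xy(2,1)] w] v])
      fix i assume i: "i < Suc n"
      show "pres R n y x z w i = v i"
      proof (cases "i < n")
        case True
        have vi: "v i \<in> carrier R" using vn i by simp
        have "y \<otimes> u i \<oplus> z i \<otimes> (\<ominus> s) = v i"
          using vi s z[OF True] by (simp add: u(2)[OF True, symmetric] a_assoc r_minus r_neg)
        thus ?thesis using True by (simp add: pres_def w_def)
      next
        case False
        hence "i = n" using i by simp
        thus ?thesis using s xy by (simp add: pres_def w_def r_minus)
      qed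
    qed
    thus "v \<in> pres R n y x z ` carrier (F (Suc n))" using w by blast
  }
qed

text \<open>Solved from the top: \<open>x v_i = 0\<close> gives \<open>v_i = y u_i\<close>, and the
  last row becomes \<open>y\<close> times \<open>sum of z_j u_j - v_n\<close>, so this difference is
  \<open>x s\<close>. The preimage has entries \<open>u_i\<close> and last entry
  \<open>s\<close>.\<close>

lemma presT_exact:
  assumes "exact_pair x y"
  shows "presT R n y x z ` carrier (F (Suc n)) = {v \<in> carrier (F (Suc n)). presT R n x y z v = \<zero>\<^bsub>F (Suc n)\<^esub>}"
proof (intro equalityI subsetI)
  have xy: "x \<in> carrier R" "y \<in> carrier R" using assms by (auto simp: exact_pair_def)
  have xy0: "x \<otimes> y = \<zero>" using assms r_one[of y] xy unfolding exact_pair_def by (metis one_closed)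
  hence yx0: "y \<otimes> x = \<zero>" using xy m_comm by metis
  have dist: "(\<Oplus>j\<in>{..<n}. z j \<otimes> (y \<otimes> w j)) = y \<otimes> (\<Oplus>j\<in>{..<n}. z j \<otimes> w j)" "(\<Oplus>j\<in>{..<n}. z j \<otimes> w j) \<in> carrier R"
    if "\<And>j. j < n \<Longrightarrow> w j \<in> carrier R" for w
  proof -
    have "(\<Oplus>j\<in>{..<n}. z j \<otimes> (y \<otimes> w j)) = (\<Oplus>j\<in>{..<n}. y \<otimes> (z j \<otimes> w j))"
      using that z xy by (intro finsum_cong') (auto simp: m_lcomm)
    also have "\<dots> = y \<otimes> (\<Oplus>j\<in>{..<n}. z j \<otimes> w j)"
      using that z xy by (intro finsum_rdistr[symmetric]) auto
    finally show "(\<Oplus>j\<in>{..<n}. z j \<otimes> (y \<otimes> w j)) = y \<otimes> (\<Oplus>j\<in>{..<n}. z j \<otimes> w j)" .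
    show "(\<Oplus>j\<in>{..<n}. z j \<otimes> w j) \<in> carrier R" using that z by (auto intro!: finsum_closed)
  qed
  {
    fix v assume "v \<in> presT R n y x z ` carrier (F (Suc n))"
    then obtain w where w: "w \<in> carrier (F (Suc n))" "v = presT R n y x z w" by auto
    have wn: "w i \<in> carrier R" if "i < Suc n" for i by (rule free_mod_nth(1)[OF that w(1)])
    have v: "v \<in> carrier (F (Suc n))" unfolding w(2) by (rule mod_hom_closed[OF presT_hom[OF xy(2,1)] w(1)])
    have wn': "w n \<in> carrier R" using wn by simp
    note d = dist[of w, OF wn[OF less_SucI]]
    have "presT R n x y z v i = \<zero>" if i: "i < Suc n" for i
    proof (cases "i < n")
      case True
      have "x \<otimes> (y \<otimes> w i) = (x \<otimes> y) \<otimes> w i" using wn[OF i] xy by (simp add: m_assoc)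
      thus ?thesis using True i wn[OF i] by (simp add: presT_def w(2) xy0)
    next
      case False
      have "(\<Oplus>j\<in>{..<n}. z j \<otimes> v j) = (\<Oplus>j\<in>{..<n}. z j \<otimes> (y \<otimes> w j))"
        using wn xy z by (intro finsum_cong') (auto simp: w(2) presT_def)
      moreover have "v n = (\<Oplus>j\<in>{..<n}. z j \<otimes> w j) \<ominus> x \<otimes> w n" by (simp add: w(2) presT_def)
      moreover have "y \<otimes> (\<Oplus>j\<in>{..<n}. z j \<otimes> w j) \<ominus> y \<otimes> ((\<Oplus>j\<in>{..<n}. z j \<otimes> w j) \<ominus> x \<otimes> w n) = (y \<otimes> x) \<otimes> w n"
        using d(2) xy wn' by (simp add: minus_eq r_distr r_minus minus_add m_assoc a_assoc[symmetric] r_neg)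
      ultimately show ?thesis using False i wn' d(1) by (simp add: presT_def yx0)
    qed
    hence "presT R n x y z v = \<zero>\<^bsub>F (Suc n)\<^esub>"
      by (intro free_mod_eqI[OF mod_hom_closed[OF presT_hom[OF xy] v]])
         (auto simp: free_mod_nth Module.module_def modF free_mod_simps)
    thus "v \<in> {v \<in> carrier (F (Suc n)). presT R n x y z v = \<zero>\<^bsub>F (Suc n)\<^esub>}" using v by simp
  next
    fix v assume "v \<in> {v \<in> carrier (F (Suc n)). presT R n x y z v = \<zero>\<^bsub>F (Suc n)\<^esub>}"
    hence v: "v \<in> carrier (F (Suc n))" and e: "presT R n x y z v = \<zero>\<^bsub>F (Suc n)\<^esub>" by auto
    have vn: "v i \<in> carrier R" if "i < Suc n" for i by (rule free_mod_nth(1)[OF that v])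
    have vn': "v n \<in> carrier R" using vn by simp
    have ei: "presT R n x y z v i = \<zero>" if "i < Suc n" for i unfolding e using that by (simp add: free_mod_nth)
    have "\<exists>u\<in>carrier R. v i = y \<otimes> u" if i: "i < n" for i
      using ei[of i] i vn[of i] assms by (auto simp: exact_pair_def presT_def)
    then obtain u where u: "\<And>i. i < n \<Longrightarrow> u i \<in> carrier R" "\<And>i. i < n \<Longrightarrow> v i = y \<otimes> u i" by metis
    note d = dist[of u, OF u(1)]
    let ?s = "\<Oplus>j\<in>{..<n}. z j \<otimes> u j"
    have "(\<Oplus>j\<in>{..<n}. z j \<otimes> v j) = (\<Oplus>j\<in>{..<n}. z j \<otimes> (y \<otimes> u j))"
      using u xy z by (intro finsum_cong') auto
    hence "y \<otimes> ?s \<ominus> y \<otimes> v n = \<zero>" using ei[of n] d(1) by (simp add: presT_def)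
    hence "y \<otimes> (?s \<ominus> v n) = \<zero>" using d(2) vn' xy by (simp add: minus_eq r_distr r_minus)
    then obtain s where s: "s \<in> carrier R" "?s \<ominus> v n = x \<otimes> s" using assms vn' d(2) by (auto simp: exact_pair_def)
    have vs: "?s \<ominus> x \<otimes> s = v n" unfolding s(2)[symmetric] using d(2) vn'
      by (simp add: minus_eq minus_add a_assoc[symmetric] r_neg)
    define w where "w = restrict (\<lambda>i. if i < n then u i else s) {..<Suc n}"
    have w: "w \<in> carrier (F (Suc n))" unfolding w_def by (rule free_mod_memI) (use u s in auto)
    have "presT R n y x z w = v"
    proof (rule free_mod_eqI[OF mod_hom_closed[OF presT_hom[OF xy(2,1)] w] v])
      fix i assume i: "i < Suc n"
      show "presT R n y x z w i = v i"
      proof (cases "i < n")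
        case True
        thus ?thesis using u by (simp add: presT_def w_def)
      next
        case False
        have "(\<Oplus>j\<in>{..<n}. z j \<otimes> w j) = ?s" using u z by (intro finsum_cong') (auto simp: w_def)
        moreover have "i = n" using i False by simp
        moreover have "w n = s" by (simp add: w_def)
        ultimately show ?thesis using vs by (simp add: presT_def)
      qed
    qed
    thus "v \<in> presT R n y x z ` carrier (F (Suc n))" using w by blast
  }
qed

text \<open>By adjointness and nondegeneracy of \<open>dot\<close>, the kernel of the transpose
  consists of the vectors orthogonal to the image. This is how exactness of the transposes turns
  into exactness of the dual sequence.\<close>

lemma presT_zero_iff:
  assumes x: "x \<in> carrier R" and y: "y \<in> carrier R" and a: "a \<in> carrier (F (Suc n))"
  shows "presT R n x y z a = \<zero>\<^bsub>F (Suc n)\<^esub> \<longleftrightarrow> (\<forall>v\<in>carrier (F (Suc n)). dot n a (pres R n x y z v) = \<zero>)"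
proof
  assume "presT R n x y z a = \<zero>\<^bsub>F (Suc n)\<^esub>"
  moreover have "dot n \<zero>\<^bsub>F (Suc n)\<^esub> v = \<zero>" if v: "v \<in> carrier (F (Suc n))" for v
  proof -
    have z: "\<zero>\<^bsub>F (Suc n)\<^esub> \<in> carrier (F (Suc n))" by (auto simp: free_mod_simps)
    show ?thesis using dot_comm[OF z v] mod_hom_zero[OF modF modR dot_hom[OF v]] by simp
  qed
  ultimately show "\<forall>v\<in>carrier (F (Suc n)). dot n a (pres R n x y z v) = \<zero>" using dot_pres[OF x y a] by simp
next
  assume "\<forall>v\<in>carrier (F (Suc n)). dot n a (pres R n x y z v) = \<zero>"
  thus "presT R n x y z a = \<zero>\<^bsub>F (Suc n)\<^esub>"
    using dot_pres[OF x y a] by (intro dot_nondegenerate mod_hom_closed[OF presT_hom[OF x y] a]) auto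
qed

lemma pres_zero_iff:
  assumes x: "x \<in> carrier R" and y: "y \<in> carrier R" and a: "a \<in> carrier (F (Suc n))"
  shows "pres R n x y z a = \<zero>\<^bsub>F (Suc n)\<^esub> \<longleftrightarrow> (\<forall>v\<in>carrier (F (Suc n)). dot n a (presT R n x y z v) = \<zero>)"
proof -
  have eq: "dot n a (presT R n x y z v) = dot n (pres R n x y z a) v" if v: "v \<in> carrier (F (Suc n))" for v
    using dot_comm[OF a mod_hom_closed[OF presT_hom[OF x y] v]] dot_pres[OF x y v a]
      dot_comm[OF v mod_hom_closed[OF pres_hom[OF x y] a]] by simp
  show ?thesis
  proof
    assume "pres R n x y z a = \<zero>\<^bsub>F (Suc n)\<^esub>"
    moreover have "dot n \<zero>\<^bsub>F (Suc n)\<^esub> v = \<zero>" if v: "v \<in> carrier (F (Suc n))" for v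
    proof -
      have z: "\<zero>\<^bsub>F (Suc n)\<^esub> \<in> carrier (F (Suc n))" by (auto simp: free_mod_simps)
      show ?thesis using dot_comm[OF z v] mod_hom_zero[OF modF modR dot_hom[OF v]] by simp
    qed
    ultimately show "\<forall>v\<in>carrier (F (Suc n)). dot n a (presT R n x y z v) = \<zero>" using eq by simp
  next
    assume "\<forall>v\<in>carrier (F (Suc n)). dot n a (presT R n x y z v) = \<zero>"
    thus "pres R n x y z a = \<zero>\<^bsub>F (Suc n)\<^esub>"
      using eq by (intro dot_nondegenerate mod_hom_closed[OF pres_hom[OF x y] a]) auto
  qed
qed

text \<open>\<open>\<phi>\<close> is the pairing with some \<open>a\<close>; vanishing on the image
  of the exchanged matrix puts \<open>a\<close> in the kernel of its transpose. So \<open>a\<close>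
  is the transpose of the given matrix applied to some \<open>b\<close>, and \<open>\<psi>\<close>
  is the pairing with \<open>b\<close>.\<close>

lemma pres_dual_exact:
  assumes xy: "exact_pair x y" and \<phi>: "\<phi> \<in> mod_hom R (F (Suc n)) RR"
    and 0: "\<And>v. v \<in> carrier (F (Suc n)) \<Longrightarrow> \<phi> (pres R n y x z v) = \<zero>"
  shows "\<exists>\<psi>\<in>mod_hom R (F (Suc n)) RR. \<forall>v\<in>carrier (F (Suc n)). \<phi> v = \<psi> (pres R n x y z v)"
proof -
  have c: "x \<in> carrier R" "y \<in> carrier R" using xy by (auto simp: exact_pair_def)
  obtain a where a: "a \<in> carrier (F (Suc n))" "\<And>v. v \<in> carrier (F (Suc n)) \<Longrightarrow> \<phi> v = dot n a v"
    using functional_dot[OF \<phi>] by metis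
  have "presT R n y x z a = \<zero>\<^bsub>F (Suc n)\<^esub>"
    unfolding presT_zero_iff[OF c(2,1) a(1)] using 0 a(2) mod_hom_closed[OF pres_hom[OF c(2,1)]] by metis
  then obtain b where b: "b \<in> carrier (F (Suc n))" "a = presT R n x y z b"
    using presT_exact[OF exact_pair_sym[OF xy]] a(1) by blast
  show ?thesis
    by (rule bexI[OF _ dot_hom[OF b(1)]]) (use a(2) b dot_pres[OF c b(1)] in auto)
qed

lemma presT_dual_exact:
  assumes xy: "exact_pair x y" and \<phi>: "\<phi> \<in> mod_hom R (F (Suc n)) RR"
    and 0: "\<And>v. v \<in> carrier (F (Suc n)) \<Longrightarrow> \<phi> (presT R n y x z v) = \<zero>"
  shows "\<exists>\<psi>\<in>mod_hom R (F (Suc n)) RR. \<forall>v\<in>carrier (F (Suc n)). \<phi> v = \<psi> (presT R n x y z v)"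
proof -
  have c: "x \<in> carrier R" "y \<in> carrier R" using xy by (auto simp: exact_pair_def)
  obtain a where a: "a \<in> carrier (F (Suc n))" "\<And>v. v \<in> carrier (F (Suc n)) \<Longrightarrow> \<phi> v = dot n a v"
    using functional_dot[OF \<phi>] by metis
  have "pres R n y x z a = \<zero>\<^bsub>F (Suc n)\<^esub>"
    unfolding pres_zero_iff[OF c(2,1) a(1)] using 0 a(2) mod_hom_closed[OF presT_hom[OF c(2,1)]] by metis
  then obtain b where b: "b \<in> carrier (F (Suc n))" "a = pres R n x y z b"
    using pres_exact[OF exact_pair_sym[OF xy]] a(1) by blast
  have "\<phi> v = dot n b (presT R n x y z v)" if v: "v \<in> carrier (F (Suc n))" for v
    using a(2)[OF v] b dot_pres[OF c v b(1)] dot_comm[OF a(1) v] 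
      dot_comm[OF b(1) mod_hom_closed[OF presT_hom[OF c] v]] by simp
  thus ?thesis by (intro bexI[OF _ dot_hom[OF b(1)]]) auto
qed

lemma ext_vanish_pres:
  assumes "exact_pair x y"
  shows "ext_vanish R i (Suc n) (pres R n x y z ` carrier (F (Suc n)))"
proof -
  have c: "x \<in> carrier R" "y \<in> carrier R" using assms by (auto simp: exact_pair_def)
  show ?thesis
    by (rule ext_vanish_periodic[OF pres_hom[OF c] pres_hom[OF c(2,1)]])
       (simp_all only: pres_exact assms exact_pair_sym pres_dual_exact)
qed

lemma ext_vanish_presT:
  assumes "exact_pair x y"
  shows "ext_vanish R i (Suc n) (presT R n x y z ` carrier (F (Suc n)))"
proof -
  have c: "x \<in> carrier R" "y \<in> carrier R" using assms by (auto simp: exact_pair_def)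
  show ?thesis
    by (rule ext_vanish_periodic[OF presT_hom[OF c] presT_hom[OF c(2,1)]])
       (simp_all only: presT_exact assms exact_pair_sym presT_dual_exact)
qed

end

end

subsection \<open>Total reflexivity of direct summands\<close>

lemma bidual_map_hom:
  assumes "Module.module A X"
  shows "bidual_map A X \<in> mod_hom A X (dual_mod A (dual_mod A X))"
proof -
  interpret X: Module.module A X by fact
  have D: "f \<in> mod_hom A X (ring_mod A)" if "f \<in> carrier (dual_mod A X)" for f
    using that by (simp add: dual_mod_simps)
  have ev: "(\<lambda>f. f u) \<in> mod_hom A (dual_mod A X) (ring_mod A)" if "u \<in> carrier X" for u
    using that mod_hom_closed[OF D that] by (intro mod_homI) (auto simp: dual_mod_simps)
  have bid: "bidual_map A X u \<in> carrier (dual_mod A (dual_mod A X))" if "u \<in> carrier X" for u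
    unfolding bidual_map_def by (rule dual_modI[OF module_dual_mod[OF assms] ev[OF that]])
  show ?thesis
  proof (rule mod_homI)
    fix u assume u: "u \<in> carrier X"
    thus "bidual_map A X u \<in> carrier (dual_mod A (dual_mod A X))" by (rule bid)
    show "bidual_map A X (u \<oplus>\<^bsub>X\<^esub> v) = bidual_map A X u \<oplus>\<^bsub>dual_mod A (dual_mod A X)\<^esub> bidual_map A X v"
      if "v \<in> carrier X" for v
      using mod_hom_add[OF D u that] u that
      by (simp add: bidual_map_def dual_mod_simps(3)[of A "dual_mod A X"] cong: restrict_cong)
    show "bidual_map A X (a \<odot>\<^bsub>X\<^esub> u) = a \<odot>\<^bsub>dual_mod A (dual_mod A X)\<^esub> bidual_map A X u" if "a \<in> carrier A" for a
      using mod_hom_smult[OF D that u] u that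
      by (simp add: bidual_map_def dual_mod_simps(4)[of A "dual_mod A X"] cong: restrict_cong)
  qed
qed

text \<open>\<open>M\<close> is the cokernel of \<open>T\<close>. The classes of the first
  \<open>n\<close> unit vectors are the generators \<open>e_i\<close>, that of the last one is
  \<open>f\<close>.\<close>

locale presentation = exact_pair_ring R x y for R :: "('a, 'e) ring_scheme" (structure) and x y +
  fixes n :: nat and z :: "nat \<Rightarrow> 'a"
  assumes zc: "z \<in> {..<n} \<rightarrow> carrier R"
begin

abbreviation "N \<equiv> Suc n"
abbreviation "T \<equiv> pres R n x y z"
abbreviation "S \<equiv> pres R n y x z"
abbreviation "Tt \<equiv> presT R n x y z"
abbreviation "St \<equiv> presT R n y x z"
abbreviation "K \<equiv> T ` carrier (F N)"
abbreviation "M \<equiv> quot_module (F N) K"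
abbreviation "cls v \<equiv> K +>\<^bsub>F N\<^esub> v"

lemma T_hom: "T \<in> mod_hom R (F N) (F N)" and S_hom: "S \<in> mod_hom R (F N) (F N)"
  and Tt_hom: "Tt \<in> mod_hom R (F N) (F N)"
  by (rule pres_hom[OF zc xy_closed] pres_hom[OF zc xy_closed(2,1)]
        presT_hom[OF zc xy_closed])+

lemma K_submodule: "submodule K R (F N)" by (rule submodule_range[OF modF modF T_hom])

sublocale QM: quotient_module R "F N" K
  by (intro quotient_module.intro modF quotient_module_axioms.intro K_submodule)

lemma modM: "Module.module R M" by (rule QM.module_Q)

lemma S_zero_iff: "v \<in> carrier (F N) \<Longrightarrow> S v = \<zero>\<^bsub>F N\<^esub> \<longleftrightarrow> v \<in> K"
  unfolding pres_exact[OF zc exact_pair_sym[OF xy]] by simp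

lemma T_zero_iff: "v \<in> carrier (F N) \<Longrightarrow> T v = \<zero>\<^bsub>F N\<^esub> \<longleftrightarrow> v \<in> S ` carrier (F N)"
  unfolding pres_exact[OF zc xy] by simp

lemma St_zero_iff: "v \<in> carrier (F N) \<Longrightarrow> St v = \<zero>\<^bsub>F N\<^esub> \<longleftrightarrow> v \<in> Tt ` carrier (F N)"
  unfolding presT_exact[OF zc exact_pair_sym[OF xy]] by simp

lemma Tt_zero_iff: "v \<in> carrier (F N) \<Longrightarrow> Tt v = \<zero>\<^bsub>F N\<^esub> \<longleftrightarrow> v \<in> St ` carrier (F N)"
  unfolding presT_exact[OF zc xy] by simp

text \<open>The pairing of \<open>c\<close> with \<open>S v\<close> depends only on the class of
  \<open>v\<close>, because \<open>S T = 0\<close>. As a function of \<open>c\<close> it maps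
  \<open>F N\<close> onto the dual of \<open>M\<close> with kernel \<open>im Tt\<close>, so the dual
  is the cokernel of the transposed matrix.\<close>

definition pair_S :: "(nat \<Rightarrow> 'a) \<Rightarrow> (nat \<Rightarrow> 'a) set \<Rightarrow> 'a" where
  "pair_S c = restrict (quot_lift (F N) K (\<lambda>v. dot n c (S v))) (carrier M)"

lemma pair_S_aux:
  assumes "c \<in> carrier (F N)"
  shows "(\<lambda>v. dot n c (S v)) \<in> mod_hom R (F N) RR" "\<And>k. k \<in> K \<Longrightarrow> dot n c (S k) = \<zero>\<^bsub>RR\<^esub>"
proof -
  show "(\<lambda>v. dot n c (S v)) \<in> mod_hom R (F N) RR"
    by (rule mod_hom_comp[OF S_hom dot_hom[OF assms]])
  fix k assume k: "k \<in> K"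
  hence "S k = \<zero>\<^bsub>F N\<^esub>" using S_zero_iff mod_hom_closed[OF T_hom] by blast
  thus "dot n c (S k) = \<zero>\<^bsub>RR\<^esub>" using mod_hom_zero[OF modF modR dot_hom[OF assms]] by simp
qed

lemma pair_S_cls:
  assumes "c \<in> carrier (F N)" "v \<in> carrier (F N)"
  shows "pair_S c (cls v) = dot n c (S v)"
  using QM.quot_lift_coset[OF modR pair_S_aux[OF assms(1)] assms(2)] assms(2)
  by (simp add: pair_S_def QM.coset_closed)

lemma pair_S_closed: "c \<in> carrier (F N) \<Longrightarrow> pair_S c \<in> carrier (dual_mod R M)"
  unfolding pair_S_def by (intro dual_modI modM QM.quot_lift_hom modR pair_S_aux)

lemma pair_S_hom: "pair_S \<in> mod_hom R (F N) (dual_mod R M)"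
proof (rule mod_homI)
  interpret FN: Module.module R "F N" by (rule modF)
  interpret D: Module.module R "dual_mod R M" by (rule module_dual_mod[OF modM])
  note eqI = dual_mod_eqI[where A = R and M = M]
  fix c assume c: "c \<in> carrier (F N)"
  show "pair_S c \<in> carrier (dual_mod R M)" by (rule pair_S_closed[OF c])
  show "pair_S (c \<oplus>\<^bsub>F N\<^esub> d) = pair_S c \<oplus>\<^bsub>dual_mod R M\<^esub> pair_S d" if d: "d \<in> carrier (F N)" for d
  proof (rule eqI)
    fix u assume "u \<in> carrier M"
    then obtain v where v: "v \<in> carrier (F N)" "u = cls v" by (auto simp: QM.carrier_Q)
    note Sv = mod_hom_closed[OF S_hom v(1)]
    have "dot n (c \<oplus>\<^bsub>F N\<^esub> d) (S v) = dot n c (S v) \<oplus> dot n d (S v)"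
      using mod_hom_add[OF dot_hom[OF Sv] c d] c d Sv by (simp add: dot_comm[OF _ Sv])
    thus "pair_S (c \<oplus>\<^bsub>F N\<^esub> d) u = (pair_S c \<oplus>\<^bsub>dual_mod R M\<^esub> pair_S d) u"
      using c d v by (simp add: pair_S_cls dual_mod_simps(3) QM.coset_closed)
  qed (auto intro: pair_S_closed c d)
  show "pair_S (a \<odot>\<^bsub>F N\<^esub> c) = a \<odot>\<^bsub>dual_mod R M\<^esub> pair_S c" if a: "a \<in> carrier R" for a
  proof (rule eqI)
    fix u assume "u \<in> carrier M"
    then obtain v where v: "v \<in> carrier (F N)" "u = cls v" by (auto simp: QM.carrier_Q)
    note Sv = mod_hom_closed[OF S_hom v(1)]
    have "dot n (a \<odot>\<^bsub>F N\<^esub> c) (S v) = a \<otimes> dot n c (S v)"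
      using mod_hom_smult[OF dot_hom[OF Sv] a c] a c Sv by (simp add: dot_comm[OF _ Sv])
    thus "pair_S (a \<odot>\<^bsub>F N\<^esub> c) u = (a \<odot>\<^bsub>dual_mod R M\<^esub> pair_S c) u"
      using c a v by (simp add: pair_S_cls dual_mod_simps(4) QM.coset_closed)
  qed (auto intro: pair_S_closed c a)
qed

text \<open>A functional on \<open>M\<close> is the pairing with some \<open>a\<close> orthogonal to
  \<open>im T\<close>, that is, with \<open>Tt a = 0\<close>. Hence \<open>a = St c\<close>, and
  adjointness moves \<open>St\<close> to the other side as \<open>S\<close>.\<close>

lemma pair_S_onto: "pair_S ` carrier (F N) = carrier (dual_mod R M)"
proof (intro equalityI subsetI)
  fix l assume l: "l \<in> carrier (dual_mod R M)"
  hence lh: "l \<in> mod_hom R M RR" by (simp add: dual_mod_simps)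
  note lc = mod_hom_comp[OF QM.coset_hom lh]
  obtain a where a: "a \<in> carrier (F N)" "\<And>v. v \<in> carrier (F N) \<Longrightarrow> l (cls v) = dot n a v"
    using functional_dot[OF lc] by metis
  have "dot n a (T v) = \<zero>" if "v \<in> carrier (F N)" for v
  proof -
    have "cls (T v) = \<zero>\<^bsub>M\<^esub>" using QM.coset_zero_iff that mod_hom_closed[OF T_hom] by auto
    hence "dot n a (T v) = l \<zero>\<^bsub>M\<^esub>" using a(2)[OF mod_hom_closed[OF T_hom that]] by simp
    thus ?thesis using mod_hom_zero[OF modM modR lh] by simp
  qed
  hence "Tt a = \<zero>\<^bsub>F N\<^esub>" using presT_zero_iff[OF zc xy_closed a(1)] by blast
  then obtain c where c: "c \<in> carrier (F N)" "a = St c" using Tt_zero_iff a(1) by auto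
  have "l = pair_S c"
  proof (rule dual_mod_eqI[OF l pair_S_closed[OF c(1)]])
    fix u assume "u \<in> carrier M"
    then obtain v where v: "v \<in> carrier (F N)" "u = cls v" by (auto simp: QM.carrier_Q)
    thus "l u = pair_S c u" using a(2) c dot_pres[OF zc xy_closed(2,1) c(1) v(1)] by (simp add: pair_S_cls)
  qed
  thus "l \<in> pair_S ` carrier (F N)" using c by blast
qed (use pair_S_closed in auto)

lemma pair_S_zero_iff:
  assumes "c \<in> carrier (F N)"
  shows "pair_S c = \<zero>\<^bsub>dual_mod R M\<^esub> \<longleftrightarrow> c \<in> Tt ` carrier (F N)"
proof -
  interpret D: Module.module R "dual_mod R M" by (rule module_dual_mod[OF modM])
  have "pair_S c = \<zero>\<^bsub>dual_mod R M\<^esub> \<longleftrightarrow> (\<forall>v\<in>carrier (F N). dot n c (S v) = \<zero>)"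
  proof
    assume e: "pair_S c = \<zero>\<^bsub>dual_mod R M\<^esub>"
    show "\<forall>v\<in>carrier (F N). dot n c (S v) = \<zero>"
    proof
      fix v assume v: "v \<in> carrier (F N)"
      have "pair_S c (cls v) = \<zero>" unfolding e using v by (simp add: dual_mod_simps(2) QM.coset_closed)
      thus "dot n c (S v) = \<zero>" using pair_S_cls[OF assms v] by simp
    qed
  next
    assume *: "\<forall>v\<in>carrier (F N). dot n c (S v) = \<zero>"
    show "pair_S c = \<zero>\<^bsub>dual_mod R M\<^esub>"
      by (rule dual_mod_eqI[OF pair_S_closed[OF assms] D.zero_closed])
         (use * in \<open>auto simp: QM.carrier_Q pair_S_cls[OF assms] dual_mod_simps(2)\<close>)
  qed
  thus ?thesis using presT_zero_iff[OF zc xy_closed(2,1) assms] St_zero_iff[OF assms] by simp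
qed

text \<open>Injectivity of the map to the bidual: \<open>ker S = K\<close>, so \<open>S\<close>
  embeds \<open>M\<close> in a free module, where the pairing separates points.\<close>

lemma M_separated:
  assumes "m \<in> carrier M" "\<And>l. l \<in> carrier (dual_mod R M) \<Longrightarrow> l m = \<zero>"
  shows "m = \<zero>\<^bsub>M\<^esub>"
proof -
  obtain v where v: "v \<in> carrier (F N)" "m = cls v" using assms(1) by (auto simp: QM.carrier_Q)
  have "dot n (S v) c = \<zero>" if c: "c \<in> carrier (F N)" for c
    using assms(2)[OF pair_S_closed[OF c]] pair_S_cls[OF c v(1)] v
      dot_comm[OF c mod_hom_closed[OF S_hom v(1)]] by simp
  hence "S v = \<zero>\<^bsub>F N\<^esub>" by (intro dot_nondegenerate mod_hom_closed[OF S_hom v(1)])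
  thus ?thesis using S_zero_iff QM.coset_zero_iff v by simp
qed

text \<open>Surjectivity onto the bidual. Pulled back along \<open>pair_S\<close>, the functional
  \<open>\<Theta>\<close> is the pairing with some \<open>w\<close>; it kills \<open>im Tt\<close>,
  so \<open>T w = 0\<close> and \<open>w = S v\<close>. Then \<open>\<Theta>\<close> is evaluation
  at the class of \<open>v\<close>.\<close>

lemma M_reflexive:
  assumes "\<Theta> \<in> mod_hom R (dual_mod R M) RR"
  obtains m where "m \<in> carrier M" "\<And>l. l \<in> carrier (dual_mod R M) \<Longrightarrow> \<Theta> l = l m"
proof -
  interpret D: Module.module R "dual_mod R M" by (rule module_dual_mod[OF modM])
  note h = mod_hom_comp[OF pair_S_hom assms]
  obtain w where w: "w \<in> carrier (F N)" "\<And>c. c \<in> carrier (F N) \<Longrightarrow> \<Theta> (pair_S c) = dot n w c"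
    using functional_dot[OF h] by metis
  have "dot n w (Tt c) = \<zero>" if c: "c \<in> carrier (F N)" for c
  proof -
    note Tc = mod_hom_closed[OF Tt_hom c]
    have "pair_S (Tt c) = \<zero>\<^bsub>dual_mod R M\<^esub>" using pair_S_zero_iff[OF Tc] c by blast
    hence "dot n w (Tt c) = \<Theta> \<zero>\<^bsub>dual_mod R M\<^esub>" using w(2)[OF Tc] by simp
    thus ?thesis using mod_hom_zero[OF D.module_axioms modR assms] by simp
  qed
  hence "T w = \<zero>\<^bsub>F N\<^esub>" using pres_zero_iff[OF zc xy_closed w(1)] by blast
  then obtain v where v: "v \<in> carrier (F N)" "w = S v" using T_zero_iff w(1) by auto
  have "\<Theta> l = l (cls v)" if l: "l \<in> carrier (dual_mod R M)" for l
  proof -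
    obtain c where c: "c \<in> carrier (F N)" "l = pair_S c" using l pair_S_onto by blast
    thus ?thesis using w(2)[OF c(1)] pair_S_cls[OF c(1) v(1)] v dot_comm[OF w(1) c(1)] by simp
  qed
  thus ?thesis using that[OF QM.coset_closed[OF v(1)]] by blast
qed

text \<open>An \<open>A\<close>-module is killed by \<open>x\<close>, so an \<open>R\<close>-valued
  functional on it has values in the annihilator of \<open>x\<close>, which is the image of
  \<open>\<theta>\<close>. This identifies functionals into \<open>R\<close> with functionals into
  \<open>A\<close>.\<close>

lemma \<theta>_factor:
  assumes X: "Module.module A X" and \<mu>: "\<mu> \<in> mod_hom R (res X) RR"
  shows "(\<lambda>u. inv_into (carrier A) \<theta> (\<mu> u)) \<in> mod_hom A X (ring_mod A)"
    and "\<And>u. u \<in> carrier X \<Longrightarrow> \<theta> (inv_into (carrier A) \<theta> (\<mu> u)) = \<mu> u"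
proof -
  interpret X': Module.module A X by (rule X)
  interpret XR: Module.module R "res X" by (rule module_res[OF X])
  interpret RA: Module.module R "res (ring_mod A)" by (rule module_res[OF modA])
  have im: "\<mu> u \<in> \<theta> ` carrier A" if u: "u \<in> carrier X" for u
  proof (rule \<theta>_onto)
    show "\<mu> u \<in> carrier R" using mod_hom_closed[OF \<mu>] u by simp
    have "red x = \<zero>\<^bsub>A\<^esub>" using red_zero_iff[of x] by (metis one_closed r_one xy_closed(1))
    hence "x \<odot>\<^bsub>res X\<^esub> u = \<zero>\<^bsub>res X\<^esub>" using u X'.smult_l_null by simp
    hence "\<mu> (x \<odot>\<^bsub>res X\<^esub> u) = \<zero>" using mod_hom_zero[OF XR.module_axioms modR \<mu>] by simp
    thus "x \<otimes> \<mu> u = \<zero>" using mod_hom_smult[OF \<mu> xy_closed(1)] u by simp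
  qed
  show e: "\<theta> (inv_into (carrier A) \<theta> (\<mu> u)) = \<mu> u" if "u \<in> carrier X" for u
    by (rule f_inv_into_f[OF im[OF that]])
  have c: "inv_into (carrier A) \<theta> (\<mu> u) \<in> carrier A" if "u \<in> carrier X" for u
    by (rule inv_into_into[OF im[OF that]])
  have "(\<lambda>u. inv_into (carrier A) \<theta> (\<mu> u)) \<in> mod_hom R (res X) (res (ring_mod A))"
  proof (rule mod_homI)
    fix u v assume u: "u \<in> carrier (res X)" and v: "v \<in> carrier (res X)"
    note cc = c[of u] c[of v] c[of "u \<oplus>\<^bsub>X\<^esub> v"] X'.a_closed[of u v]
    have "\<theta> (inv_into (carrier A) \<theta> (\<mu> (u \<oplus>\<^bsub>X\<^esub> v))) =
      \<theta> (inv_into (carrier A) \<theta> (\<mu> u) \<oplus>\<^bsub>A\<^esub> inv_into (carrier A) \<theta> (\<mu> v))"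
      using mod_hom_add[OF \<theta>_hom, of "inv_into (carrier A) \<theta> (\<mu> u)" "inv_into (carrier A) \<theta> (\<mu> v)"]
        mod_hom_add[OF \<mu> u v] e[of "u \<oplus>\<^bsub>X\<^esub> v"] e[of u] e[of v] cc u v by simp
    thus "inv_into (carrier A) \<theta> (\<mu> (u \<oplus>\<^bsub>res X\<^esub> v)) =
      inv_into (carrier A) \<theta> (\<mu> u) \<oplus>\<^bsub>res (ring_mod A)\<^esub> inv_into (carrier A) \<theta> (\<mu> v)"
      using inj_onD[OF \<theta>_inj] cc u v RA.a_closed by (simp add: inj_on_eq_iff[OF \<theta>_inj])
  next
    fix a u assume a: "a \<in> carrier R" and u: "u \<in> carrier (res X)"
    note cc = c[of u] c[of "red a \<odot>\<^bsub>X\<^esub> u"] X'.smult_closed[of "red a" u] red_closed[OF a]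
    have "\<theta> (inv_into (carrier A) \<theta> (\<mu> (red a \<odot>\<^bsub>X\<^esub> u))) = \<theta> (red a \<otimes>\<^bsub>A\<^esub> inv_into (carrier A) \<theta> (\<mu> u))"
      using mod_hom_smult[OF \<theta>_hom a, of "inv_into (carrier A) \<theta> (\<mu> u)"]
        mod_hom_smult[OF \<mu> a u] e[of "red a \<odot>\<^bsub>X\<^esub> u"] e[of u] cc u by simp
    thus "inv_into (carrier A) \<theta> (\<mu> (a \<odot>\<^bsub>res X\<^esub> u)) = a \<odot>\<^bsub>res (ring_mod A)\<^esub> inv_into (carrier A) \<theta> (\<mu> u)"
      using cc u a RA.smult_closed[of a] by (simp add: inj_on_eq_iff[OF \<theta>_inj])
  qed (use c in simp)
  thus "(\<lambda>u. inv_into (carrier A) \<theta> (\<mu> u)) \<in> mod_hom A X (ring_mod A)" by (simp add: mod_hom_res)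
qed

text \<open>\<open>X\<close> is an \<open>A\<close>-module which, over \<open>R\<close>, is a
  retract of \<open>M\<close>. Through \<open>\<theta>\<close> its \<open>A\<close>-dual is a
  retract of the \<open>R\<close>-dual of \<open>M\<close>, so both modules are acyclic over
  \<open>R\<close> and their Ext over \<open>A\<close> vanishes; reflexivity is carried over from
  \<open>M\<close> by the same maps.\<close>

theorem summand_totally_reflexive:
  fixes X :: "('a set, 'c, 'm) module_scheme"
  assumes X: "Module.module A X"
    and \<epsilon>: "\<epsilon> \<in> mod_hom A (free_mod A b) X" "\<epsilon> ` carrier (free_mod A b) = carrier X"
    and s: "s \<in> mod_hom R (res X) M" and r: "r \<in> mod_hom R M (res X)"
    and rs: "\<And>u. u \<in> carrier X \<Longrightarrow> r (s u) = u"
  shows "totally_reflexive A X"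
proof -
  interpret X': Module.module A X by (rule X)
  let ?D = "dual_mod A X" and ?DM = "dual_mod R M"
  have modD: "Module.module A ?D" by (rule module_dual_mod[OF X])
  have modDM: "Module.module R ?DM" by (rule module_dual_mod[OF modM])
  interpret D': Module.module A ?D by (rule modD)
  have D: "f \<in> mod_hom A X (ring_mod A)" if "f \<in> carrier ?D" for f
    using that by (simp add: dual_mod_simps)
  have DR: "f \<in> mod_hom R (res X) (res (ring_mod A))" if "f \<in> carrier ?D" for f
    by (rule mod_hom_res_D[OF D[OF that]])
  have Dc: "f u \<in> carrier A" if "f \<in> carrier ?D" "u \<in> carrier X" for f u
    using mod_hom_closed[OF D[OF that(1)] that(2)] by simp
  have DM: "l \<in> mod_hom R M RR" if "l \<in> carrier ?DM" for l
    using that by (simp add: dual_mod_simps)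
  have rc: "r m \<in> carrier X" if "m \<in> carrier M" for m using mod_hom_closed[OF r that] by simp
  have sc: "s u \<in> carrier M" if "u \<in> carrier X" for u using mod_hom_closed[OF s] that by simp
  have acM: "acyclic_mod (res X)"
  proof (rule acyclic_mod_retract[OF module_res[OF X] modM QM.coset_hom _ _ s r])
    show "cls ` carrier (F N) = carrier M" by (simp add: QM.carrier_Q)
    have "{u \<in> carrier (F N). cls u = \<zero>\<^bsub>M\<^esub>} = K"
      using QM.coset_zero_iff QM.submoduleE(1)[OF K_submodule] by blast
    thus "ext_vanish R i N {u \<in> carrier (F N). cls u = \<zero>\<^bsub>M\<^esub>}" for i
      using ext_vanish_pres[OF zc xy] by simp
  qed (use rs in auto)
  \<comment> \<open>An \<open>A\<close>-functional on \<open>X\<close> is pulled back along the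
    retraction and sent into \<open>R\<close> by \<open>\<theta>\<close>.\<close>
  define sD where "sD f = restrict (\<lambda>m. \<theta> (f (r m))) (carrier M)" for f
  have sD_closed: "sD f \<in> carrier ?DM" if "f \<in> carrier ?D" for f
    unfolding sD_def by (intro dual_modI modM mod_hom_comp[OF mod_hom_comp[OF r DR[OF that]] \<theta>_hom])
  note eqIM = dual_mod_eqI[where A = R and M = M] and eqI = dual_mod_eqI[where A = A and M = X]
  have sD: "sD \<in> mod_hom R (res ?D) ?DM"
  proof (rule mod_homI)
    fix f assume "f \<in> carrier (res ?D)"
    hence f: "f \<in> carrier ?D" by simp
    show "sD f \<in> carrier ?DM" by (rule sD_closed[OF f])
    show "sD (f \<oplus>\<^bsub>res ?D\<^esub> g) = sD f \<oplus>\<^bsub>?DM\<^esub> sD g" if "g \<in> carrier (res ?D)" for g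
    proof -
      have g: "g \<in> carrier ?D" using that by simp
      have "\<theta> ((f \<oplus>\<^bsub>?D\<^esub> g) (r m)) = \<theta> (f (r m)) \<oplus> \<theta> (g (r m))" if "m \<in> carrier M" for m
        using mod_hom_add[OF \<theta>_hom, of "f (r m)" "g (r m)"] rc[OF that] Dc f g by (simp add: dual_mod_simps)
      thus ?thesis by (simp add: sD_def dual_mod_simps(3)[of R] cong: restrict_cong)
    qed
    show "sD (a \<odot>\<^bsub>res ?D\<^esub> f) = a \<odot>\<^bsub>?DM\<^esub> sD f" if a: "a \<in> carrier R" for a
    proof -
      have "\<theta> ((red a \<odot>\<^bsub>?D\<^esub> f) (r m)) = a \<otimes> \<theta> (f (r m))" if "m \<in> carrier M" for m
        using mod_hom_smult[OF \<theta>_hom a, of "f (r m)"] rc[OF that] Dc f by (simp add: dual_mod_simps)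
      thus ?thesis by (simp add: sD_def dual_mod_simps(4)[of R] cong: restrict_cong)
    qed
  qed
  \<comment> \<open>Restriction along the section \<open>s\<close>, with \<open>\<theta>\<close>
    undone; a left inverse of \<open>sD\<close>.\<close>
  define rD where "rD l = restrict (\<lambda>u. inv_into (carrier A) \<theta> (l (s u))) (carrier X)" for l
  have rD_closed: "rD l \<in> carrier ?D" if "l \<in> carrier ?DM" for l
    unfolding rD_def by (intro dual_modI X \<theta>_factor(1) mod_hom_comp[OF s DM[OF that]])
  have \<theta>rD: "\<theta> (rD l u) = l (s u)" if "l \<in> carrier ?DM" "u \<in> carrier X" for l u
    using \<theta>_factor(2)[OF X mod_hom_comp[OF s DM[OF that(1)]] that(2)] that(2) by (simp add: rD_def)
  have rD_eqI: "rD l = f" if "l \<in> carrier ?DM" "f \<in> carrier ?D" "\<And>u. u \<in> carrier X \<Longrightarrow> l (s u) = \<theta> (f u)" for l f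
  proof (rule eqI[OF rD_closed[OF that(1)] that(2)])
    fix u assume u: "u \<in> carrier X"
    have "\<theta> (rD l u) = \<theta> (f u)" using \<theta>rD[OF that(1) u] that(3)[OF u] by simp
    thus "rD l u = f u" using inj_onD[OF \<theta>_inj] Dc rD_closed that u by blast
  qed
  interpret DRes: Module.module R "res ?D" by (rule module_res[OF modD])
  interpret DM': Module.module R ?DM by (rule modDM)
  have rD: "rD \<in> mod_hom R ?DM (res ?D)"
  proof (rule mod_homI)
    fix l assume l: "l \<in> carrier ?DM"
    show "rD l \<in> carrier (res ?D)" using rD_closed[OF l] by simp
    show "rD (l \<oplus>\<^bsub>?DM\<^esub> l') = rD l \<oplus>\<^bsub>res ?D\<^esub> rD l'" if l': "l' \<in> carrier ?DM" for l'
    proof (rule rD_eqI)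
      show "(l \<oplus>\<^bsub>?DM\<^esub> l') (s u) = \<theta> ((rD l \<oplus>\<^bsub>res ?D\<^esub> rD l') u)" if u: "u \<in> carrier X" for u
        using mod_hom_add[OF \<theta>_hom, of "rD l u" "rD l' u"] Dc[OF rD_closed[OF l] u] Dc[OF rD_closed[OF l'] u]
          \<theta>rD[OF l u] \<theta>rD[OF l' u] sc[OF u] u by (simp add: dual_mod_simps)
    qed (use l l' rD_closed in auto)
    show "rD (a \<odot>\<^bsub>?DM\<^esub> l) = a \<odot>\<^bsub>res ?D\<^esub> rD l" if a: "a \<in> carrier R" for a
    proof (rule rD_eqI)
      show "(a \<odot>\<^bsub>?DM\<^esub> l) (s u) = \<theta> ((a \<odot>\<^bsub>res ?D\<^esub> rD l) u)" if u: "u \<in> carrier X" for u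
        using mod_hom_smult[OF \<theta>_hom a, of "rD l u"] Dc[OF rD_closed[OF l] u]
          \<theta>rD[OF l u] sc[OF u] u by (simp add: dual_mod_simps)
    qed (use l a rD_closed red_closed in auto)
  qed
  have rsD: "rD (sD f) = f" if f: "f \<in> carrier ?D" for f
    by (rule rD_eqI[OF sD_closed[OF f] f]) (simp add: sD_def sc rs)
  have acD: "acyclic_mod (res ?D)"
  proof (rule acyclic_mod_retract[OF module_res[OF modD] modDM pair_S_hom pair_S_onto _ sD rD])
    have "{u \<in> carrier (F N). pair_S u = \<zero>\<^bsub>?DM\<^esub>} = Tt ` carrier (F N)"
      using pair_S_zero_iff mod_hom_closed[OF Tt_hom] by auto
    thus "ext_vanish R i N {u \<in> carrier (F N). pair_S u = \<zero>\<^bsub>?DM\<^esub>}" for i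
      using ext_vanish_presT[OF zc xy] by simp
  qed (use rsD in auto)
  \<comment> \<open>The \<open>N\<close> generators of the dual of \<open>M\<close> also generate
    its retract, which gives the finite \<open>A\<close>-free cover of the dual of \<open>X\<close>
    from which a resolution can start.\<close>
  obtain \<epsilon>D where \<epsilon>D: "\<epsilon>D \<in> mod_hom A (free_mod A N) ?D"
    "\<epsilon>D ` carrier (free_mod A N) = (\<lambda>c. rD (pair_S c)) ` carrier (F N)"
    using factor_redv[OF modD mod_hom_comp[OF pair_S_hom rD]] by metis
  have "(\<lambda>c. rD (pair_S c)) ` carrier (F N) = rD ` carrier ?DM"
    by (simp add: pair_S_onto[symmetric] image_image)
  also have "\<dots> = carrier ?D"
  proof (intro equalityI subsetI)
    fix f assume f: "f \<in> carrier ?D"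
    show "f \<in> rD ` carrier ?DM" using rsD[OF f] sD_closed[OF f] by (intro image_eqI[of _ _ "sD f"]) auto
  qed (use rD_closed in auto)
  finally have \<epsilon>D_onto: "\<epsilon>D ` carrier (free_mod A N) = carrier ?D" using \<epsilon>D(2) by simp
  have gen: "generates A X b (\<lambda>j. \<epsilon> (unitvec A b j))"
    unfolding generates_def
  proof (intro conjI ballI)
    show "(\<lambda>j. \<epsilon> (unitvec A b j)) \<in> {..<b} \<rightarrow> carrier X"
      using mod_hom_closed[OF \<epsilon>(1) unitvec_closed[OF crA]] by auto
    fix m assume "m \<in> carrier X"
    then obtain c where c: "c \<in> carrier (free_mod A b)" "m = \<epsilon> c" using \<epsilon>(2) by blast
    thus "\<exists>c\<in>{..<b} \<rightarrow> carrier A. m = (\<Oplus>\<^bsub>X\<^esub>i\<in>{..<b}. c i \<odot>\<^bsub>X\<^esub> \<epsilon> (unitvec A b i))"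
      using mod_hom_eq_lincomb[OF X \<epsilon>(1) c(1)]
      by (intro bexI[of _ c]) (auto simp: lincomb_def free_mod_simps)
  qed
  have inj: "inj_on (bidual_map A X) (carrier X)"
  proof (rule inj_onI)
    fix u v assume u: "u \<in> carrier X" and v: "v \<in> carrier X" and eq: "bidual_map A X u = bidual_map A X v"
    have ev: "f u = f v" if "f \<in> carrier ?D" for f
      using fun_cong[OF eq, of f] that by (simp add: bidual_map_def)
    interpret M': Module.module R M by (rule modM)
    have "s u \<ominus>\<^bsub>M\<^esub> s v = \<zero>\<^bsub>M\<^esub>"
    proof (rule M_separated)
      show "s u \<ominus>\<^bsub>M\<^esub> s v \<in> carrier M" using sc u v by simp
      fix l assume l: "l \<in> carrier ?DM"
      have "l (s u) = l (s v)" using ev[OF rD_closed[OF l]] \<theta>rD[OF l u] \<theta>rD[OF l v] by simp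
      moreover have "l (s v) \<in> carrier R" using mod_hom_closed[OF DM[OF l] sc[OF v]] by simp
      ultimately show "l (s u \<ominus>\<^bsub>M\<^esub> s v) = \<zero>"
        using mod_hom_minus[OF modM modR DM[OF l] sc[OF u] sc[OF v]]
        by (simp add: a_minus_def a_inv_ring_mod r_neg)
    qed
    hence "s u = s v" using sc[OF u] sc[OF v]
      by (metis M'.a_inv_closed M'.minus_equality M'.minus_eq M'.minus_minus)
    thus "u = v" using rs u v by metis
  qed
  have surj: "w \<in> bidual_map A X ` carrier X" if w: "w \<in> carrier (dual_mod A ?D)" for w
  proof -
    have wh: "w \<in> mod_hom R (res ?D) (res (ring_mod A))"
      using w by (intro mod_hom_res_D) (simp add: dual_mod_simps)
    \<comment> \<open>Composed with \<open>rD\<close> and \<open>\<theta>\<close>, the element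
      \<open>w\<close> of the bidual of \<open>X\<close> is a functional on the dual of
      \<open>M\<close>, hence evaluation at some \<open>m\<close>. Then \<open>w\<close> is
      evaluation at \<open>r m\<close>.\<close>
    obtain m where m: "m \<in> carrier M" "\<And>l. l \<in> carrier ?DM \<Longrightarrow> \<theta> (w (rD l)) = l m"
      using M_reflexive[OF mod_hom_comp[OF rD mod_hom_comp[OF wh \<theta>_hom]]] by metis
    have "w f = f (r m)" if f: "f \<in> carrier ?D" for f
    proof -
      have "\<theta> (w f) = \<theta> (f (r m))" using m(2)[OF sD_closed[OF f]] rsD[OF f] m(1) by (simp add: sD_def)
      moreover have "w f \<in> carrier A" using mod_hom_closed[OF wh, of f] f by simp
      ultimately show ?thesis using inj_onD[OF \<theta>_inj] Dc[OF f rc[OF m(1)]] by blast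
    qed
    hence "w = bidual_map A X (r m)"
      using w mod_hom_closed[OF bidual_map_hom[OF X] rc[OF m(1)]]
      by (intro dual_mod_eqI[where A = A and M = ?D]) (auto simp: bidual_map_def)
    thus ?thesis using rc[OF m(1)] by blast
  qed
  show ?thesis
    unfolding totally_reflexive_def bij_betw_def
    using X gen bidual_map_hom[OF X] inj surj mod_hom_closed[OF bidual_map_hom[OF X]]
      Ext_vanishing[OF X acM \<epsilon>] Ext_vanishing[OF modD acD \<epsilon>D(1) \<epsilon>D_onto]
    by (auto simp: fin_gen_def)
qed

end

section \<open>The short exact sequence of the presentation\<close>

lemma mod_hom_inj:
  assumes "Module.module A M" "Module.module A N" "f \<in> mod_hom A M N"
    and 0: "\<And>u. u \<in> carrier M \<Longrightarrow> f u = \<zero>\<^bsub>N\<^esub> \<Longrightarrow> u = \<zero>\<^bsub>M\<^esub>"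
  shows "inj_on f (carrier M)"
proof (rule inj_onI)
  interpret M: Module.module A M by fact
  interpret N: Module.module A N by fact
  fix u v assume u: "u \<in> carrier M" and v: "v \<in> carrier M" and e: "f u = f v"
  have "f (u \<ominus>\<^bsub>M\<^esub> v) = \<zero>\<^bsub>N\<^esub>"
    using mod_hom_minus[OF assms(1-3) u v] e mod_hom_closed[OF assms(3) v] by (simp add: N.minus_eq N.r_neg)
  hence "u \<ominus>\<^bsub>M\<^esub> v = \<zero>\<^bsub>M\<^esub>" using 0 u v by simp
  thus "u = v" using u v by (metis M.a_inv_closed M.minus_equality M.minus_eq M.minus_minus)
qed

text \<open>\<open>mod_hom\<close> sees only carrier, addition and scalar multiplication. The
  records \<open>quot_mod R (PIdl x)\<close> and \<open>res (ring_mod A)\<close> agree in these, so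
  they have the same homomorphisms.\<close>

lemma mod_hom_cong_struct:
  assumes "carrier N = carrier N'" "add N = add N'" "smult N = smult N'"
  shows "mod_hom A M N = mod_hom A M N'"
  using assms by (simp add: mod_hom_def)

lemma mod_hom_cong_struct':
  assumes "carrier M = carrier M'" "add M = add M'" "smult M = smult M'"
  shows "mod_hom A M N = mod_hom A M' N"
  using assms by (simp add: mod_hom_def)

context exact_pair_ring
begin

text \<open>The variant of \<open>factor_redv\<close> for an arbitrary \<open>R\<close>-module such
  as \<open>M\<close>, in which only the image of \<open>\<kappa>\<close> is killed by
  \<open>x\<close>.\<close>

lemma factor_redv_R:
  assumes Y: "Module.module R Y" and \<kappa>: "\<kappa> \<in> mod_hom R (F c) Y"
    and 0: "\<And>w. w \<in> carrier (F c) \<Longrightarrow> \<kappa> (x \<odot>\<^bsub>F c\<^esub> w) = \<zero>\<^bsub>Y\<^esub>"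
  obtains \<kappa>' where "\<kappa>' \<in> mod_hom R (res (free_mod A c)) Y"
    "\<And>u. u \<in> carrier (F c) \<Longrightarrow> \<kappa>' (redv c u) = \<kappa> u"
    "\<kappa>' ` carrier (free_mod A c) = \<kappa> ` carrier (F c)"
proof -
  interpret Fc: Module.module R "F c" by (rule modF)
  interpret FA: Module.module R "res (free_mod A c)" by (rule module_res[OF modFA])
  interpret Y: Module.module R Y by (rule Y)
  define \<kappa>' where "\<kappa>' w = \<kappa> (SOME u. u \<in> carrier (F c) \<and> redv c u = w)" for w
  have e: "\<kappa>' (redv c u) = \<kappa> u" if u: "u \<in> carrier (F c)" for u
  proof -
    define v where "v = (SOME v. v \<in> carrier (F c) \<and> redv c v = redv c u)"
    have v: "v \<in> carrier (F c)" "redv c v = redv c u"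
      unfolding v_def using someI[of "\<lambda>v. v \<in> carrier (F c) \<and> redv c v = redv c u" u] u by auto
    have "redv c (v \<ominus>\<^bsub>F c\<^esub> u) = \<zero>\<^bsub>free_mod A c\<^esub>"
      using mod_hom_minus[OF modF module_res[OF modFA] redv_hom v(1) u] v(2) mod_hom_closed[OF redv_hom u]
        FA.r_neg[of "redv c u"] by (simp add: FA.minus_eq)
    then obtain w where "w \<in> carrier (F c)" "v \<ominus>\<^bsub>F c\<^esub> u = x \<odot>\<^bsub>F c\<^esub> w"
      using redv_kernel[of "v \<ominus>\<^bsub>F c\<^esub> u" c] v u by auto
    hence "\<kappa> v \<ominus>\<^bsub>Y\<^esub> \<kappa> u = \<zero>\<^bsub>Y\<^esub>" using 0 mod_hom_minus[OF modF Y \<kappa> v(1) u] by metis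
    hence "\<kappa> v = \<kappa> u" using mod_hom_closed[OF \<kappa> u] mod_hom_closed[OF \<kappa> v(1)]
      by (metis Y.a_inv_closed Y.minus_equality Y.minus_eq Y.minus_minus)
    thus ?thesis by (simp add: \<kappa>'_def v_def)
  qed
  have "\<kappa>' \<in> mod_hom R (res (free_mod A c)) Y"
  proof (rule mod_homI)
    fix w assume "w \<in> carrier (res (free_mod A c))"
    then obtain u where u: "u \<in> carrier (F c)" "w = redv c u" using redv_onto[of c] by auto
    show "\<kappa>' w \<in> carrier Y" using e u mod_hom_closed[OF \<kappa> u(1)] by simp
    show "\<kappa>' (w \<oplus>\<^bsub>res (free_mod A c)\<^esub> w') = \<kappa>' w \<oplus>\<^bsub>Y\<^esub> \<kappa>' w'" if w': "w' \<in> carrier (res (free_mod A c))" for w'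
    proof -
      obtain v where v: "v \<in> carrier (F c)" "w' = redv c v" using redv_onto[of c] w' by auto
      have "\<kappa>' (redv c (u \<oplus>\<^bsub>F c\<^esub> v)) = \<kappa> u \<oplus>\<^bsub>Y\<^esub> \<kappa> v" using e u v mod_hom_add[OF \<kappa>] by simp
      thus ?thesis using mod_hom_add[OF redv_hom u(1) v(1)] e u v by simp
    qed
    fix a assume a: "a \<in> carrier R"
    have "\<kappa>' (redv c (a \<odot>\<^bsub>F c\<^esub> u)) = a \<odot>\<^bsub>Y\<^esub> \<kappa> u" using e u a mod_hom_smult[OF \<kappa>] by simp
    thus "\<kappa>' (a \<odot>\<^bsub>res (free_mod A c)\<^esub> w) = a \<odot>\<^bsub>Y\<^esub> \<kappa>' w"
      using mod_hom_smult[OF redv_hom a u(1)] e u by simp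
  qed
  moreover have "\<kappa>' ` carrier (free_mod A c) = (\<lambda>u. \<kappa>' (redv c u)) ` carrier (F c)"
    by (simp add: redv_onto[symmetric] image_image)
  moreover have "\<dots> = \<kappa> ` carrier (F c)" using e by (rule image_cong[OF refl])
  ultimately show ?thesis using that e by simp
qed

lemma quot_mod_struct:
  "carrier (quot_mod R (PIdl x)) = carrier (res (ring_mod A))"
  "add (quot_mod R (PIdl x)) = add (res (ring_mod A))"
  "smult (quot_mod R (PIdl x)) = smult (res (ring_mod A))"
  "zero (quot_mod R (PIdl x)) = \<zero>\<^bsub>A\<^esub>"
  by (simp_all add: quot_mod_def FactRing_def)

lemma pow_quot_mod_struct:
  "carrier (pow_mod (quot_mod R (PIdl x)) n) = carrier (res (free_mod A n))"
  "add (pow_mod (quot_mod R (PIdl x)) n) = add (res (free_mod A n))"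
  "smult (pow_mod (quot_mod R (PIdl x)) n) = smult (res (free_mod A n))"
  by (simp_all add: pow_mod_def free_mod_def quot_mod_struct)

lemma exact_pair_ring_swap: "exact_pair_ring R y x"
  by (rule exact_pair_ring.intro[OF noetherian_base_axioms exact_pair_ring_axioms.intro[OF exact_pair_sym[OF xy]]])

lemma red_hom: "(\<lambda>a. red a) \<in> mod_hom R RR (res (ring_mod A))"
  by (rule mod_homI) (auto simp: red_ops red_closed)

lemma res_quot_module: "res (quot_module Y K) = quot_module (res Y) K"
proof -
  have 1: "a_r_coset (res Y) = a_r_coset Y"
    by (simp add: a_r_coset_def r_coset_def fun_eq_iff)
  have 2: "a_rcosets\<^bsub>res Y\<^esub> K = a_rcosets\<^bsub>Y\<^esub> K"
    by (simp add: A_RCOSETS_def RCOSETS_def r_coset_def)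
  have 3: "set_add (res Y) = set_add Y"
    by (simp add: set_add_def set_mult_def fun_eq_iff)
  show ?thesis unfolding quot_module_def 1 2 3 by (simp add: res_def)
qed

end

context presentation
begin

abbreviation "incl \<equiv> inl R n 1"

lemma incl_hom: "incl \<in> mod_hom R (F n) (F N)"
  using inl_hom[OF crR, of n 1] by simp

lemma incl_nth:
  assumes "u \<in> carrier (F n)"
  shows "i < n \<Longrightarrow> incl u i = u i" "incl u n = \<zero>"
  by (simp_all add: inl_def)

lemma clsincl_hom: "(\<lambda>u. cls (incl u)) \<in> mod_hom R (F n) M"
  by (rule mod_hom_comp[OF incl_hom QM.coset_hom])

text \<open>\<open>K = ker S\<close>, and on vectors with last entry zero \<open>S\<close> is
  multiplication by \<open>y\<close>, whose kernel is \<open>x F n\<close>. So the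
  \<open>e_i\<close> span a free \<open>A\<close>-module of rank \<open>n\<close> inside
  \<open>M\<close>.\<close>

lemma incl_in_K_iff:
  assumes u: "u \<in> carrier (F n)"
  shows "incl u \<in> K \<longleftrightarrow> redv n u = \<zero>\<^bsub>free_mod A n\<^esub>"
proof -
  note iu = mod_hom_closed[OF incl_hom u]
  note un = free_mod_nth(1)[OF _ u]
  interpret Fn: Module.module R "F n" by (rule modF)
  have S1: "S (incl u) i = y \<otimes> u i" if "i < n" for i
    using that un[OF that] z[OF zc that] incl_nth[OF u] by (simp add: pres_def)
  have S2: "S (incl u) n = \<zero>" using incl_nth[OF u] by (simp add: pres_def)
  have "incl u \<in> K \<longleftrightarrow> S (incl u) = \<zero>\<^bsub>F N\<^esub>" using S_zero_iff[OF iu] by simp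
  also have "\<dots> \<longleftrightarrow> (\<forall>i<n. y \<otimes> u i = \<zero>)"
  proof
    assume e: "S (incl u) = \<zero>\<^bsub>F N\<^esub>"
    show "\<forall>i<n. y \<otimes> u i = \<zero>" using S1 e by (metis free_mod_nth(2) less_SucI)
  next
    assume *: "\<forall>i<n. y \<otimes> u i = \<zero>"
    show "S (incl u) = \<zero>\<^bsub>F N\<^esub>"
      by (rule free_mod_eqI[OF mod_hom_closed[OF S_hom iu] QM.M.zero_closed])
         (use * S1 S2 in \<open>auto simp: free_mod_nth less_Suc_eq\<close>)
  qed
  also have "\<dots> \<longleftrightarrow> y \<odot>\<^bsub>F n\<^esub> u = \<zero>\<^bsub>F n\<^esub>"
    by (auto simp: free_mod_simps fun_eq_iff)
  also have "\<dots> \<longleftrightarrow> redv n u = \<zero>\<^bsub>free_mod A n\<^esub>"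
    using exact_pair_free_mod[OF exact_pair_sym[OF xy] u] redv_kernel[OF u] by simp
  finally show ?thesis .
qed

lemma cls_incl_smult_x: "w \<in> carrier (F n) \<Longrightarrow> cls (incl (x \<odot>\<^bsub>F n\<^esub> w)) = \<zero>\<^bsub>M\<^esub>"
proof -
  assume w: "w \<in> carrier (F n)"
  interpret Fn: Module.module R "F n" by (rule modF)
  have xw: "x \<odot>\<^bsub>F n\<^esub> w \<in> carrier (F n)" using w by simp
  have "redv n (x \<odot>\<^bsub>F n\<^esub> w) = \<zero>\<^bsub>free_mod A n\<^esub>" using redv_kernel[OF xw] w by blast
  thus ?thesis using incl_in_K_iff[OF xw] QM.coset_zero_iff mod_hom_closed[OF incl_hom xw] by simp
qed

lemma incl_prl:
  assumes v: "v \<in> carrier (F N)" and "v n = \<zero>"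
  shows "incl (prl n v) = v" "prl n v \<in> carrier (F n)"
proof -
  show "prl n v \<in> carrier (F n)" using prl_hom[of n R 1] mod_hom_closed v by (metis Suc_eq_plus1)
  hence "incl (prl n v) \<in> carrier (F N)" by (rule mod_hom_closed[OF incl_hom])
  thus "incl (prl n v) = v"
    by (rule free_mod_eqI[OF _ v]) (use assms in \<open>auto simp: inl_def prl_def less_Suc_eq\<close>)
qed

lemma short_exact_presentation:
  "\<exists>f g. short_exact R (pow_mod (quot_mod R (PIdl x)) n) M (quot_mod R (PIdl y)) f g"
proof -
  interpret Y: exact_pair_ring R y x by (rule exact_pair_ring_swap)
  interpret Fn: Module.module R "F n" by (rule modF)
  let ?B = "R Quot PIdl y"
  let ?C = "Y.res (ring_mod ?B)"
  obtain f where f: "f \<in> mod_hom R (res (free_mod A n)) M"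
    "\<And>u. u \<in> carrier (F n) \<Longrightarrow> f (redv n u) = cls (incl u)"
    "f ` carrier (free_mod A n) = (\<lambda>u. cls (incl u)) ` carrier (F n)"
    using factor_redv_R[OF modM clsincl_hom cls_incl_smult_x] by metis
  have f_inj: "inj_on f (carrier (res (free_mod A n)))"
  proof (rule mod_hom_inj[OF module_res[OF modFA] modM f(1)])
    fix w assume w: "w \<in> carrier (res (free_mod A n))" and 0: "f w = \<zero>\<^bsub>M\<^esub>"
    obtain u where u: "u \<in> carrier (F n)" "w = redv n u" using w redv_onto[of n] by auto
    hence "cls (incl u) = \<zero>\<^bsub>M\<^esub>" using 0 f(2) by simp
    hence "incl u \<in> K" using QM.coset_zero_iff mod_hom_closed[OF incl_hom u(1)] by simp
    thus "w = \<zero>\<^bsub>res (free_mod A n)\<^esub>" using incl_in_K_iff u by simp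
  qed
  have modC: "Module.module R ?C" by (rule Y.module_res[OF Y.modA])
  have h: "(\<lambda>v. Y.red (v n)) \<in> mod_hom R (F N) ?C"
    by (rule mod_hom_comp[OF free_mod_coord[OF lessI] Y.red_hom])
  have hK: "Y.red (k n) = \<zero>\<^bsub>?C\<^esub>" if k: "k \<in> K" for k
  proof -
    obtain w where w: "w \<in> carrier (F N)" "k = T w" using k by blast
    have wn: "w n \<in> carrier R" by (rule free_mod_nth(1)[OF lessI w(1)])
    have "k n = y \<otimes> (\<ominus> w n)" using wn w by (simp add: pres_def r_minus)
    thus ?thesis using Y.red_zero_iff[of "k n"] wn by auto
  qed
  \<comment> \<open>The last coordinate modulo \<open>y\<close>; it descends to \<open>M\<close>
    because last entries of relations are multiples of \<open>y\<close>.\<close>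
  define g where "g = quot_lift (F N) K (\<lambda>v. Y.red (v n))"
  have g: "g \<in> mod_hom R M ?C" unfolding g_def by (rule QM.quot_lift_hom[OF modC h]) (rule hK)
  have gc: "g (cls v) = Y.red (v n)" if "v \<in> carrier (F N)" for v
    unfolding g_def by (rule QM.quot_lift_coset[OF modC h _ that]) (rule hK)
  have ker: "g m = \<zero>\<^bsub>?C\<^esub> \<longleftrightarrow> m \<in> (\<lambda>u. cls (incl u)) ` carrier (F n)" if m: "m \<in> carrier M" for m
  proof
    obtain v where v: "v \<in> carrier (F N)" "m = cls v" using m by (auto simp: QM.carrier_Q)
    assume "g m = \<zero>\<^bsub>?C\<^esub>"
    then obtain t where t: "t \<in> carrier R" "v n = y \<otimes> t"
      using gc v Y.red_zero_iff[of "v n"] free_mod_nth(1)[OF lessI v(1)] by auto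
    \<comment> \<open>The last entry of \<open>T e\<close> is \<open>-(y t)\<close>. Adding this
      relation to \<open>v\<close> keeps its class and makes the last coordinate zero, so the class
      comes from \<open>F n\<close>.\<close>
    define e where "e = t \<odot>\<^bsub>F N\<^esub> unitvec R N n"
    have e: "e \<in> carrier (F N)" "e n = t" using t unitvec_closed[OF crR, of N n]
      by (auto simp: e_def free_mod_nth unitvec_def)
    define v' where "v' = v \<oplus>\<^bsub>F N\<^esub> T e"
    note Te = mod_hom_closed[OF T_hom e(1)]
    have v': "v' \<in> carrier (F N)" using v Te by (simp add: v'_def)
    have "v' n = \<zero>" using t e by (simp add: v'_def free_mod_nth pres_def r_neg)
    moreover have "cls v' = m"
      using QM.coset_add[OF v(1) Te] QM.coset_zero_iff[OF Te] e(1) v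
      by (simp add: v'_def modM abelian_monoid.r_zero[OF abelian_group.axioms(1)[OF Module.module.axioms(2)[OF modM]]] QM.coset_closed)
    ultimately have "m = cls (incl (prl n v'))" "prl n v' \<in> carrier (F n)" using incl_prl[OF v'] by auto
    thus "m \<in> (\<lambda>u. cls (incl u)) ` carrier (F n)" by blast
  next
    assume "m \<in> (\<lambda>u. cls (incl u)) ` carrier (F n)"
    then obtain u where u: "u \<in> carrier (F n)" "m = cls (incl u)" by auto
    show "g m = \<zero>\<^bsub>?C\<^esub>" using gc[OF mod_hom_closed[OF incl_hom u(1)]] u Y.red_zero incl_nth(2)[OF u(1)] by simp
  qed
  have onto: "g ` carrier M = carrier ?C"
  proof (intro equalityI subsetI)
    fix c assume "c \<in> carrier ?C"
    then obtain a where a: "a \<in> carrier R" "c = Y.red a" by (auto simp: Y.carrier_A)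
    have "a \<odot>\<^bsub>F N\<^esub> unitvec R N n \<in> carrier (F N)" using a unitvec_closed[OF crR] by simp
    moreover from this have "g (cls (a \<odot>\<^bsub>F N\<^esub> unitvec R N n)) = c"
      using gc a by (simp add: free_mod_nth unitvec_def)
    ultimately show "c \<in> g ` carrier M" using QM.coset_closed by blast
  qed (use mod_hom_closed[OF g] in auto)
  have "(\<lambda>u. cls (incl u)) ` carrier (F n) \<subseteq> carrier M"
    using mod_hom_closed[OF clsincl_hom] by blast
  hence im: "f ` carrier (free_mod A n) = {m \<in> carrier M. g m = \<zero>\<^bsub>Y.A\<^esub>}"
    unfolding f(3) using ker unfolding Y.res_simps ring_mod_simps by blast
  have "f \<in> mod_hom R (pow_mod (quot_mod R (PIdl x)) n) M"
    using f(1) mod_hom_cong_struct'[OF pow_quot_mod_struct] by blast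
  moreover have "g \<in> mod_hom R M (quot_mod R (PIdl y))"
    using g mod_hom_cong_struct[OF Y.quot_mod_struct(1-3)] by blast
  ultimately have "short_exact R (pow_mod (quot_mod R (PIdl x)) n) M (quot_mod R (PIdl y)) f g"
    unfolding short_exact_def pow_quot_mod_struct(1) Y.quot_mod_struct(1,4)
    using f_inj onto im by simp
  thus ?thesis by blast
qed

end

text \<open>A nonzero free module has a nonempty basis, and the coordinate belonging to its first
  element takes the value one on that element.\<close>

lemma free_coordinate:
  assumes X: "Module.module A X" and "free A X" and "carrier X \<noteq> {\<zero>\<^bsub>X\<^esub>}"
  obtains h b where "h \<in> mod_hom A X (ring_mod A)" "b \<in> carrier X" "h b = \<one>\<^bsub>A\<^esub>"
proof -
  interpret X: Module.module A X by (rule X)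
  note crA = X.R.is_cring
  obtain k :: nat and b where "b \<in> {..<k} \<rightarrow> carrier X \<and>
      (\<forall>m\<in>carrier X. \<exists>!c. c \<in> {..<k} \<rightarrow>\<^sub>E carrier A \<and> m = (\<Oplus>\<^bsub>X\<^esub>i\<in>{..<k}. c i \<odot>\<^bsub>X\<^esub> b i))"
    using assms(2) unfolding free_def by (elim exE)
  hence b: "b \<in> {..<k} \<rightarrow> carrier X"
    "\<And>m. m \<in> carrier X \<Longrightarrow> \<exists>!c. c \<in> carrier (free_mod A k) \<and> m = lincomb X k b c"
    by (simp_all add: lincomb_def free_mod_simps)
  define co where "co m = (THE c. c \<in> carrier (free_mod A k) \<and> m = lincomb X k b c)" for m
  have co: "co m \<in> carrier (free_mod A k)" "m = lincomb X k b (co m)" if "m \<in> carrier X" for m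
    using theI'[OF b(2)[OF that], folded co_def] by simp_all
  have co_eq: "co m = c" if "m \<in> carrier X" "c \<in> carrier (free_mod A k)" "m = lincomb X k b c" for m c
    unfolding co_def by (rule the1_equality[OF b(2)[OF that(1)]]) (use that in blast)
  note lc = lincomb_hom[OF X b(1)]
  have kpos: "0 < k"
  proof (rule ccontr)
    assume "\<not> 0 < k"
    hence "u = \<zero>\<^bsub>X\<^esub>" if "u \<in> carrier X" for u using co(2)[OF that] by (simp add: lincomb_def)
    thus False using assms(3) X.zero_closed by blast
  qed
  interpret FA: Module.module A "free_mod A k" by (rule module_free_mod[OF crA])
  have h: "(\<lambda>m. co m 0) \<in> mod_hom A X (ring_mod A)"
  proof (rule mod_homI)
    fix m assume m: "m \<in> carrier X"
    show "co m 0 \<in> carrier (ring_mod A)" using free_mod_nth(1)[OF kpos co(1)[OF m]] by simp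
    show "co (m \<oplus>\<^bsub>X\<^esub> m') 0 = co m 0 \<oplus>\<^bsub>ring_mod A\<^esub> co m' 0" if m': "m' \<in> carrier X" for m'
    proof -
      have "m \<oplus>\<^bsub>X\<^esub> m' = lincomb X k b (co m \<oplus>\<^bsub>free_mod A k\<^esub> co m')"
        using mod_hom_add[OF lc co(1)[OF m] co(1)[OF m']] co(2)[OF m] co(2)[OF m'] by simp
      hence "co (m \<oplus>\<^bsub>X\<^esub> m') = co m \<oplus>\<^bsub>free_mod A k\<^esub> co m'"
        by (rule co_eq[OF X.a_closed[OF m m'] FA.a_closed[OF co(1)[OF m] co(1)[OF m']]])
      thus ?thesis using kpos by (simp add: free_mod_nth)
    qed
    show "co (a \<odot>\<^bsub>X\<^esub> m) 0 = a \<odot>\<^bsub>ring_mod A\<^esub> co m 0" if a: "a \<in> carrier A" for a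
    proof -
      have "a \<odot>\<^bsub>X\<^esub> m = lincomb X k b (a \<odot>\<^bsub>free_mod A k\<^esub> co m)"
        using mod_hom_smult[OF lc a co(1)[OF m]] co(2)[OF m] by simp
      hence "co (a \<odot>\<^bsub>X\<^esub> m) = a \<odot>\<^bsub>free_mod A k\<^esub> co m"
        by (rule co_eq[OF X.smult_closed[OF a m] FA.smult_closed[OF a co(1)[OF m]]])
      thus ?thesis using kpos by (simp add: free_mod_nth)
    qed
  qed
  have b0: "b 0 \<in> carrier X" using b(1) kpos by auto
  have "co (b 0) = unitvec A k 0"
    by (rule co_eq[OF b0 unitvec_closed[OF crA]]) (rule lincomb_unitvec[OF X b(1) kpos, symmetric])
  hence "co (b 0) 0 = \<one>\<^bsub>A\<^esub>" using kpos by (simp add: unitvec_def)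
  thus ?thesis by (rule that[OF h b0])
qed

subsection \<open>Local rings\<close>

lemma set_add_iff: "m \<in> P <+>\<^bsub>M\<^esub> Q \<longleftrightarrow> (\<exists>p\<in>P. \<exists>q\<in>Q. m = p \<oplus>\<^bsub>M\<^esub> q)"
  by (auto simp: set_add_def set_mult_def)

text \<open>Krull's theorem by Zorn's lemma. Properness is expressed as omitting
  \<open>\<one>\<close>, which is visibly preserved by unions of chains.\<close>

lemma (in cring) exists_maximal_ideal:
  assumes "ideal I R" "\<one> \<notin> I"
  shows "\<exists>m. maximalideal m R \<and> I \<subseteq> m"
proof -
  define \<A> where "\<A> = {J. ideal J R \<and> I \<subseteq> J \<and> \<one> \<notin> J}"
  have "\<exists>m\<in>\<A>. \<forall>J\<in>\<A>. m \<subseteq> J \<longrightarrow> J = m"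
  proof (rule subset_Zorn_nonempty)
    show "\<A> \<noteq> {}" using assms by (auto simp: \<A>_def)
    fix C assume C: "C \<noteq> {}" "subset.chain \<A> C"
    hence CA: "C \<subseteq> \<A>" and tot: "\<And>J J'. J \<in> C \<Longrightarrow> J' \<in> C \<Longrightarrow> J \<subseteq> J' \<or> J' \<subseteq> J"
      by (auto simp: subset.chain_def)
    hence idl: "\<And>J. J \<in> C \<Longrightarrow> ideal J R" by (auto simp: \<A>_def)
    obtain J0 where J0: "J0 \<in> C" using C by auto
    have sg: "\<And>J. J \<in> C \<Longrightarrow> additive_subgroup J R" using idl ideal.axioms(1) by blast
    have "ideal (\<Union>C) R"
    proof (rule idealI[OF ring_axioms])
      show "subgroup (\<Union>C) (add_monoid R)"
      proof (rule add.subgroupI)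
        show "\<Union>C \<subseteq> carrier R" using sg additive_subgroup.a_subset by blast
        show "\<Union>C \<noteq> {}" using J0 additive_subgroup.zero_closed[OF sg[OF J0]] by blast
        show "\<ominus> a \<in> \<Union>C" if a: "a \<in> \<Union>C" for a
        proof -
          obtain J where J: "J \<in> C" "a \<in> J" using a by blast
          have "\<ominus> a \<in> J" by (rule additive_subgroup.a_inv_closed[OF sg[OF J(1)] J(2)])
          thus ?thesis using J by blast
        qed
        show "a \<oplus> b \<in> \<Union>C" if ab: "a \<in> \<Union>C" "b \<in> \<Union>C" for a b
        proof -
          obtain J where "J \<in> C" "a \<in> J" "b \<in> J" using ab tot by blast
          thus ?thesis using additive_subgroup.a_closed[OF sg] by blast
        qed
      qed
      fix a b assume ab: "a \<in> \<Union>C" "b \<in> carrier R"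
      then obtain J where J: "J \<in> C" "a \<in> J" by blast
      show "b \<otimes> a \<in> \<Union>C" using ideal.I_l_closed[OF idl[OF J(1)] J(2) ab(2)] J by blast
      show "a \<otimes> b \<in> \<Union>C" using ideal.I_r_closed[OF idl[OF J(1)] J(2) ab(2)] J by blast
    qed
    moreover have "I \<subseteq> \<Union>C" "\<one> \<notin> \<Union>C" using CA J0 by (auto simp: \<A>_def)
    ultimately show "\<Union>C \<in> \<A>" by (simp add: \<A>_def)
  qed
  then obtain m where m: "m \<in> \<A>" "\<And>J. J \<in> \<A> \<Longrightarrow> m \<subseteq> J \<Longrightarrow> J = m" by blast
  have mi: "ideal m R" "I \<subseteq> m" "\<one> \<notin> m" using m(1) by (auto simp: \<A>_def)
  have "maximalideal m R"
  proof (rule maximalidealI[OF mi(1)])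
    show "carrier R \<noteq> m" using mi(3) by auto
    fix J assume J: "ideal J R" "m \<subseteq> J" "J \<subseteq> carrier R"
    show "J = m \<or> J = carrier R"
    proof (cases "\<one> \<in> J")
      case True
      thus ?thesis using ideal.one_imp_carrier[OF J(1)] by simp
    next
      case False
      hence "J \<in> \<A>" using J mi by (auto simp: \<A>_def)
      thus ?thesis using m(2) J by blast
    qed
  qed
  thus ?thesis using mi by blast
qed

locale local_cring = cring R for R (structure) +
  assumes local: "local_ring R"
begin

abbreviation "\<mm> \<equiv> max_ideal R"

lemma maximal_m: "maximalideal \<mm> R"
  using local theI'[of "\<lambda>m. maximalideal m R"] by (auto simp: local_ring_def max_ideal_def)

sublocale m: maximalideal \<mm> R by (rule maximal_m)

lemma one_notin_m: "\<one> \<notin> \<mm>"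
  using m.one_imp_carrier m.I_notcarr by blast

lemma unit_if_notin_m:
  assumes "a \<in> carrier R" "a \<notin> \<mm>"
  obtains b where "b \<in> carrier R" "b \<otimes> a = \<one>"
proof -
  have "\<one> \<in> PIdl a"
  proof (rule ccontr)
    assume "\<one> \<notin> PIdl a"
    then obtain m' where "maximalideal m' R" "PIdl a \<subseteq> m'"
      using exists_maximal_ideal[OF cgenideal_ideal[OF assms(1)]] by blast
    moreover from this have "m' = \<mm>" using local maximal_m by (auto simp: local_ring_def)
    ultimately show False using assms cgenideal_self by blast
  qed
  thus ?thesis using that by (auto simp: cgenideal_def)
qed

lemma finsum_in_m: "(\<And>i. i \<in> I \<Longrightarrow> f i \<in> \<mm>) \<Longrightarrow> (\<Oplus>i\<in>I. f i) \<in> \<mm>"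
proof (induction I rule: infinite_finite_induct)
  case (insert i I)
  have "(\<Oplus>i\<in>insert i I. f i) = f i \<oplus> (\<Oplus>i\<in>I. f i)"
    using insert m.Icarr by (intro finsum_insert) auto
  thus ?case using insert m.a_closed by auto
qed auto

end

subsection \<open>Indecomposability\<close>

text \<open>\<open>indep\<close> says that the classes of the \<open>z_i\<close> are a minimal
  generating system of the ideal they generate in \<open>R/(x,y)\<close>: no relation among them has
  a unit coefficient.\<close>

locale local_presentation = presentation R x y n z + local_cring R
  for R :: "('a, 'e) ring_scheme" (structure) and x y n z +
  assumes xm: "x \<in> \<mm>" and ym: "y \<in> \<mm>"
    and indep: "\<And>c. c \<in> {..<n} \<rightarrow> carrier R \<Longrightarrow>
      (\<exists>s\<in>carrier R. \<exists>t\<in>carrier R. (\<Oplus>i\<in>{..<n}. c i \<otimes> z i) = x \<otimes> s \<oplus> y \<otimes> t) \<Longrightarrow> (\<forall>i<n. c i \<in> \<mm>)"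
begin

text \<open>The vector \<open>v\<close> witnesses that \<open>P\<close> maps onto
  \<open>R/(y)\<close>. The other summand then has to come from the \<open>e_i\<close> alone, and a
  nonzero such summand contradicts \<open>indep\<close>.\<close>

lemma summand_zero:
  assumes G: "G_regular A"
    and P: "submodule P R M" and Q: "submodule Q R M"
    and PQ0: "P \<inter> Q = {\<zero>\<^bsub>M\<^esub>}" and PQ: "P <+>\<^bsub>M\<^esub> Q = carrier M"
    and v: "v \<in> carrier (F N)" "v n = \<one>" "cls v \<in> P"
  shows "Q = {\<zero>\<^bsub>M\<^esub>}"
proof (rule ccontr)
  assume Qne: "Q \<noteq> {\<zero>\<^bsub>M\<^esub>}"
  interpret M': Module.module R M by (rule modM)
  interpret Fn: Module.module R "F n" by (rule modF)
  note PE = M'.submoduleE[OF P] and QE = M'.submoduleE[OF Q]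
  note P0 = submodule_zero_closed[OF modM P] and Q0 = submodule_zero_closed[OF modM Q]
  have PM: "p \<in> carrier M" if "p \<in> P" for p using PE(1) that by auto
  have QM: "q \<in> carrier M" if "q \<in> Q" for q using QE(1) that by auto
  \<comment> \<open>The projection of \<open>M\<close> onto \<open>Q\<close> along
    \<open>P\<close>.\<close>
  define e where "e m = (SOME q. q \<in> Q \<and> (\<exists>p\<in>P. m = p \<oplus>\<^bsub>M\<^esub> q))" for m
  have e_unique: "e (p \<oplus>\<^bsub>M\<^esub> q) = q" if p: "p \<in> P" and q: "q \<in> Q" for p q
  proof -
    have "\<exists>q'. q' \<in> Q \<and> (\<exists>p'\<in>P. p \<oplus>\<^bsub>M\<^esub> q = p' \<oplus>\<^bsub>M\<^esub> q')" using p q by blast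
    from someI_ex[OF this] obtain p' where p': "e (p \<oplus>\<^bsub>M\<^esub> q) \<in> Q" "p' \<in> P" "p \<oplus>\<^bsub>M\<^esub> q = p' \<oplus>\<^bsub>M\<^esub> e (p \<oplus>\<^bsub>M\<^esub> q)"
      unfolding e_def[symmetric] by blast
    define q' where "q' = e (p \<oplus>\<^bsub>M\<^esub> q)"
    have q': "q' \<in> Q" "p \<oplus>\<^bsub>M\<^esub> q = p' \<oplus>\<^bsub>M\<^esub> q'" using p' by (auto simp: q'_def)
    note c = PM[OF p] QM[OF q] PM[OF p'(2)] QM[OF q'(1)]
    have "\<ominus>\<^bsub>M\<^esub> p' \<oplus>\<^bsub>M\<^esub> p = \<ominus>\<^bsub>M\<^esub> p' \<oplus>\<^bsub>M\<^esub> (p \<oplus>\<^bsub>M\<^esub> q) \<oplus>\<^bsub>M\<^esub> \<ominus>\<^bsub>M\<^esub> q"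
      using c by (simp add: M'.M.a_assoc M'.r_neg)
    also have "\<dots> = q' \<oplus>\<^bsub>M\<^esub> \<ominus>\<^bsub>M\<^esub> q"
      unfolding q'(2) using c by (simp add: M'.M.a_assoc[symmetric] M'.l_neg)
    finally have eq: "\<ominus>\<^bsub>M\<^esub> p' \<oplus>\<^bsub>M\<^esub> p = q' \<oplus>\<^bsub>M\<^esub> \<ominus>\<^bsub>M\<^esub> q" .
    have "\<ominus>\<^bsub>M\<^esub> p' \<oplus>\<^bsub>M\<^esub> p \<in> P" using PE p p'(2) by blast
    moreover have "q' \<oplus>\<^bsub>M\<^esub> \<ominus>\<^bsub>M\<^esub> q \<in> Q" using QE q q'(1) by blast
    ultimately have "q' \<oplus>\<^bsub>M\<^esub> \<ominus>\<^bsub>M\<^esub> q = \<zero>\<^bsub>M\<^esub>" using eq PQ0 by auto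
    hence "q' = q" using c by (metis M'.a_inv_closed M'.minus_equality M'.minus_minus)
    thus ?thesis by (simp add: q'_def)
  qed
  have decomp: "\<exists>p\<in>P. \<exists>q\<in>Q. m = p \<oplus>\<^bsub>M\<^esub> q" if "m \<in> carrier M" for m
    using that set_add_iff[of m M P Q] unfolding PQ by simp
  have e_hom: "e \<in> mod_hom R M M"
  proof (rule mod_homI)
    fix m assume m: "m \<in> carrier M"
    then obtain p q where pq: "p \<in> P" "q \<in> Q" "m = p \<oplus>\<^bsub>M\<^esub> q" using decomp by blast
    show "e m \<in> carrier M" using e_unique pq QM by simp
    show "e (m \<oplus>\<^bsub>M\<^esub> m') = e m \<oplus>\<^bsub>M\<^esub> e m'" if m': "m' \<in> carrier M" for m'
    proof -
      obtain p' q' where pq': "p' \<in> P" "q' \<in> Q" "m' = p' \<oplus>\<^bsub>M\<^esub> q'" using decomp m' by blast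
      have "m \<oplus>\<^bsub>M\<^esub> m' = (p \<oplus>\<^bsub>M\<^esub> p') \<oplus>\<^bsub>M\<^esub> (q \<oplus>\<^bsub>M\<^esub> q')"
        using pq pq' PM QM by (simp add: M'.M.a_ac)
      thus ?thesis using e_unique pq pq' PE(5) QE(5) by simp
    qed
    show "e (a \<odot>\<^bsub>M\<^esub> m) = a \<odot>\<^bsub>M\<^esub> e m" if a: "a \<in> carrier R" for a
      using e_unique[of "a \<odot>\<^bsub>M\<^esub> p" "a \<odot>\<^bsub>M\<^esub> q"] e_unique[of p q] pq a PM QM PE(4) QE(4)
      by (simp add: M'.smult_r_distr)
  qed
  have eQ: "e m \<in> Q" if "m \<in> carrier M" for m using decomp[OF that] e_unique by auto
  have e_id: "e q = q" if "q \<in> Q" for q using e_unique[OF P0 that] QM[OF that] by simp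
  have eP: "e p = \<zero>\<^bsub>M\<^esub>" if "p \<in> P" for p using e_unique[OF that Q0] PM[OF that] by simp
  define \<kappa> where "\<kappa> u = e (cls (incl u))" for u
  have \<kappa>: "\<kappa> \<in> mod_hom R (F n) M" unfolding \<kappa>_def by (rule mod_hom_comp[OF clsincl_hom e_hom])
  have \<kappa>x: "\<kappa> (x \<odot>\<^bsub>F n\<^esub> w) = \<zero>\<^bsub>M\<^esub>" if "w \<in> carrier (F n)" for w
    unfolding \<kappa>_def cls_incl_smult_x[OF that] by (rule mod_hom_zero[OF modM modM e_hom])
  have \<kappa>Q: "\<kappa> ` carrier (F n) = Q"
  proof (intro equalityI subsetI)
    fix q assume q: "q \<in> Q"
    obtain w where w: "w \<in> carrier (F N)" "q = cls w" using QM[OF q] by (auto simp: QM.carrier_Q)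
    have wn: "w n \<in> carrier R" by (rule free_mod_nth(1)[OF lessI w(1)])
    \<comment> \<open>Subtracting a multiple of \<open>v\<close> makes the last coordinate zero.
      Since the class of \<open>v\<close> lies in \<open>P\<close>, the projection to
      \<open>Q\<close> is unaffected, so \<open>Q\<close> is covered by the images of the
      \<open>e_i\<close>.\<close>
    define u where "u = w \<ominus>\<^bsub>F N\<^esub> (w n \<odot>\<^bsub>F N\<^esub> v)"
    have wv: "w n \<odot>\<^bsub>F N\<^esub> v \<in> carrier (F N)" using wn v by simp
    have u: "u \<in> carrier (F N)" using w wv by (simp add: u_def)
    have "u n = \<zero>" unfolding u_def free_mod_minus_nth[OF crR lessI w(1) wv]
      using wn v by (simp add: free_mod_nth minus_eq r_neg)
    note iu = incl_prl[OF u this]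
    have w': "w = u \<oplus>\<^bsub>F N\<^esub> (w n \<odot>\<^bsub>F N\<^esub> v)"
      unfolding u_def using w wv by (simp add: QM.M.minus_eq QM.M.a_assoc QM.M.l_neg)
    have "cls w = cls u \<oplus>\<^bsub>M\<^esub> w n \<odot>\<^bsub>M\<^esub> cls v"
      using QM.coset_add[OF u wv] QM.coset_smult[OF wn v(1)] w' by simp
    hence "e q = e (cls u) \<oplus>\<^bsub>M\<^esub> w n \<odot>\<^bsub>M\<^esub> e (cls v)"
      using w(2) u v wn by (simp add: mod_hom_add[OF e_hom] mod_hom_smult[OF e_hom] QM.coset_closed)
    hence "q = \<kappa> (prl n u)"
      using e_id[OF q] eP[OF v(3)] wn mod_hom_closed[OF e_hom QM.coset_closed[OF u]] iu by (simp add: \<kappa>_def)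
    thus "q \<in> \<kappa> ` carrier (F n)" using iu by blast
  qed (use eQ mod_hom_closed[OF clsincl_hom] in \<open>auto simp: \<kappa>_def\<close>)
  obtain \<kappa>' where \<kappa>': "\<kappa>' \<in> mod_hom R (res (free_mod A n)) M"
    "\<And>u. u \<in> carrier (F n) \<Longrightarrow> \<kappa>' (redv n u) = \<kappa> u"
    "\<kappa>' ` carrier (free_mod A n) = \<kappa> ` carrier (F n)"
    using factor_redv_R[OF modM \<kappa> \<kappa>x] by metis
  define Ka where "Ka = {w \<in> carrier (free_mod A n). \<kappa>' w = \<zero>\<^bsub>M\<^esub>}"
  have KaR: "submodule Ka R (res (free_mod A n))"
    using submodule_kernel[OF module_res[OF modFA] modM \<kappa>'(1)] by (simp add: Ka_def)
  interpret FA: Module.module A "free_mod A n" by (rule modFA)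
  interpret QR: quotient_module R "res (free_mod A n)" Ka
    by (intro quotient_module.intro module_res modFA quotient_module_axioms.intro KaR)
  have KaA: "submodule Ka A (free_mod A n)"
  proof (rule FA.submoduleI)
    note KE = QR.submoduleE[OF KaR]
    show "Ka \<subseteq> carrier (free_mod A n)" by (auto simp: Ka_def)
    show "\<zero>\<^bsub>free_mod A n\<^esub> \<in> Ka" using submodule_zero_closed[OF module_res[OF modFA] KaR] by simp
    have "\<ominus>\<^bsub>res (free_mod A n)\<^esub> w = \<ominus>\<^bsub>free_mod A n\<^esub> w" for w by (simp add: a_inv_def m_inv_def)
    thus "\<ominus>\<^bsub>free_mod A n\<^esub> w \<in> Ka" if "w \<in> Ka" for w using KE(3)[OF that] by simp
    show "w \<oplus>\<^bsub>free_mod A n\<^esub> w' \<in> Ka" if "w \<in> Ka" "w' \<in> Ka" for w w' using KE(5)[OF that] by simp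
    show "C \<odot>\<^bsub>free_mod A n\<^esub> w \<in> Ka" if "C \<in> carrier A" "w \<in> Ka" for C w
      using KE(4)[of _ w] that by (auto simp: carrier_A)
  qed
  interpret QA: quotient_module A "free_mod A n" Ka
    by (intro quotient_module.intro modFA quotient_module_axioms.intro KaA)
  \<comment> \<open>\<open>G_regular A\<close> speaks of \<open>A\<close>-modules whose elements are
    sets of vectors over \<open>A\<close>, while \<open>Q\<close> consists of sets of vectors over
    \<open>R\<close>. So \<open>Q\<close> is replaced by the isomorphic quotient of
    \<open>A^n\<close> by \<open>Ka\<close>.\<close>
  let ?X = "quot_module (free_mod A n) Ka"
  have resX: "res ?X = quot_module (res (free_mod A n)) Ka" by (rule res_quot_module)
  have modX: "Module.module A ?X" by (rule QA.module_Q)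
  have \<kappa>'K: "\<And>k. k \<in> Ka \<Longrightarrow> \<kappa>' k = \<zero>\<^bsub>M\<^esub>" unfolding Ka_def by blast
  define s where "s = quot_lift (res (free_mod A n)) Ka \<kappa>'"
  have s: "s \<in> mod_hom R (res ?X) M" unfolding s_def resX by (rule QR.quot_lift_hom[OF modM \<kappa>'(1) \<kappa>'K])
  have coset_res: "Ka +>\<^bsub>res (free_mod A n)\<^esub> w = Ka +>\<^bsub>free_mod A n\<^esub> w" for w
    by (simp add: a_r_coset_def r_coset_def)
  have sc: "s (Ka +>\<^bsub>free_mod A n\<^esub> w) = \<kappa>' w" if "w \<in> carrier (free_mod A n)" for w
    using QR.quot_lift_coset[OF modM \<kappa>'(1) \<kappa>'K, of w] that unfolding s_def coset_res by simp
  have s_im: "s ` carrier ?X = Q"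
    using \<kappa>'(3) \<kappa>Q sc by (auto simp: QA.carrier_Q image_image)
  have s_inj: "inj_on s (carrier ?X)"
  proof -
    have "inj_on s (carrier (res ?X))"
    proof (rule mod_hom_inj[OF module_res[OF modX] modM s])
      fix u assume "u \<in> carrier (res ?X)" and 0: "s u = \<zero>\<^bsub>M\<^esub>"
      then obtain w where w: "w \<in> carrier (free_mod A n)" "u = Ka +>\<^bsub>free_mod A n\<^esub> w"
        by (auto simp: QA.carrier_Q)
      have "\<kappa>' w = \<zero>\<^bsub>M\<^esub>" using sc[OF w(1)] 0 unfolding w(2) by (rule trans[OF sym])
      hence "w \<in> Ka" using w(1) unfolding Ka_def by blast
      hence "Ka +>\<^bsub>free_mod A n\<^esub> w = \<zero>\<^bsub>?X\<^esub>" using QA.coset_zero_iff[OF w(1)] by blast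
      thus "u = \<zero>\<^bsub>res ?X\<^esub>" unfolding w(2) res_simps .
    qed
    thus ?thesis by simp
  qed
  define r where "r m = inv_into (carrier ?X) s (e m)" for m
  have r_closed: "r m \<in> carrier ?X" and sr: "s (r m) = e m" if "m \<in> carrier M" for m
    using eQ[OF that] s_im inv_into_into[of "e m" s "carrier ?X"] f_inv_into_f[of "e m" s "carrier ?X"]
    by (simp_all add: r_def)
  have r_eqI: "r m = u" if "m \<in> carrier M" "u \<in> carrier ?X" "s u = e m" for m u
    using inj_onD[OF s_inj _ r_closed[OF that(1)] that(2)] sr[OF that(1)] that(3) by simp
  interpret RX: Module.module R "res ?X" by (rule module_res[OF modX])
  have r: "r \<in> mod_hom R M (res ?X)"
  proof (rule mod_homI)
    fix m assume m: "m \<in> carrier M"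
    show "r m \<in> carrier (res ?X)" using r_closed[OF m] by simp
    show "r (m \<oplus>\<^bsub>M\<^esub> m') = r m \<oplus>\<^bsub>res ?X\<^esub> r m'" if m': "m' \<in> carrier M" for m'
    proof (rule r_eqI)
      show "s (r m \<oplus>\<^bsub>res ?X\<^esub> r m') = e (m \<oplus>\<^bsub>M\<^esub> m')"
        using mod_hom_add[OF s, of "r m" "r m'"] r_closed m m' sr mod_hom_add[OF e_hom m m'] by simp
      show "r m \<oplus>\<^bsub>res ?X\<^esub> r m' \<in> carrier ?X" using RX.a_closed[of "r m" "r m'"] r_closed m m' by simp
    qed (use m m' in simp)
    show "r (a \<odot>\<^bsub>M\<^esub> m) = a \<odot>\<^bsub>res ?X\<^esub> r m" if a: "a \<in> carrier R" for a
    proof (rule r_eqI)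
      show "s (a \<odot>\<^bsub>res ?X\<^esub> r m) = e (a \<odot>\<^bsub>M\<^esub> m)"
        using mod_hom_smult[OF s a, of "r m"] r_closed m sr mod_hom_smult[OF e_hom a m] by simp
      show "a \<odot>\<^bsub>res ?X\<^esub> r m \<in> carrier ?X" using RX.smult_closed[OF a, of "r m"] r_closed m by simp
    qed (use m a in simp)
  qed
  have rs: "r (s u) = u" if u: "u \<in> carrier ?X" for u
  proof (rule r_eqI[OF _ u])
    have "s u \<in> Q" using s_im u by blast
    thus "s u \<in> carrier M" "s u = e (s u)" using QM e_id by auto
  qed
  have "totally_reflexive A ?X"
    by (rule summand_totally_reflexive[OF modX QA.coset_hom _ s r]) (auto simp: rs QA.carrier_Q)
  hence "free A ?X" using G by (simp add: G_regular_def)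
  moreover have "carrier ?X \<noteq> {\<zero>\<^bsub>?X\<^esub>}"
  proof
    assume X0: "carrier ?X = {\<zero>\<^bsub>?X\<^esub>}"
    have "q = \<zero>\<^bsub>M\<^esub>" if q: "q \<in> Q" for q
    proof -
      have "r q = \<zero>\<^bsub>res ?X\<^esub>" using r_closed[OF QM[OF q]] X0 by simp
      thus ?thesis using sr[OF QM[OF q]] e_id[OF q] mod_hom_zero[OF module_res[OF modX] modM s] by simp
    qed
    thus False using Qne Q0 by blast
  qed
  ultimately obtain h b where h: "h \<in> mod_hom A ?X (ring_mod A)"
    and b: "b \<in> carrier ?X" "h b = \<one>\<^bsub>A\<^esub>"
    by (rule free_coordinate[OF modX])
  define \<eta> where "\<eta> u = h (r (cls u))" for u
  have \<eta>: "\<eta> \<in> mod_hom R (F N) (res (ring_mod A))" unfolding \<eta>_def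
    by (rule mod_hom_comp[OF mod_hom_comp[OF QM.coset_hom r] mod_hom_res_D[OF h]])
  \<comment> \<open>The coordinate functional of the summand, pulled back to \<open>F N\<close>,
    lifts from \<open>A\<close> to \<open>R\<close>, where it is the pairing with a vector
    \<open>a\<close>.\<close>
  obtain l where l: "l \<in> mod_hom R (F N) RR" "\<And>u. u \<in> carrier (F N) \<Longrightarrow> red (l u) = \<eta> u"
    by (rule free_mod_lift[OF modR module_res[OF modA] red_hom \<eta>])
       (use mod_hom_closed[OF \<eta>] in \<open>auto simp: carrier_A\<close>)
  obtain a where a: "a \<in> carrier (F N)" "\<And>u. u \<in> carrier (F N) \<Longrightarrow> l u = dot n a u"
    using functional_dot[OF l(1)] by metis
  note an = free_mod_nth(1)[OF _ a(1)]
  have an': "a n \<in> carrier R" using an by simp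
  \<comment> \<open>The last column of the matrix, with entries \<open>z_i\<close> and
    \<open>-y\<close>. Its class is zero, so \<open>l t\<close> is a multiple of \<open>x\<close>,
    which is a relation among the \<open>z_i\<close> modulo \<open>(x,y)\<close> with coefficients
    \<open>a i\<close>.\<close>
  define t where "t = T (unitvec R N n)"
  note en = unitvec_closed[OF crR, of N n]
  have t: "t \<in> carrier (F N)" unfolding t_def by (rule mod_hom_closed[OF T_hom en])
  have ti: "t i = z i" if "i < n" for i using that z[OF zc that] by (simp add: t_def pres_def unitvec_def)
  have tn: "t n = \<ominus> y" by (simp add: t_def pres_def unitvec_def)
  have "cls t = \<zero>\<^bsub>M\<^esub>" using QM.coset_zero_iff[OF t] en by (auto simp: t_def)
  hence "\<eta> t = \<zero>\<^bsub>A\<^esub>"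
    using mod_hom_zero[OF modM module_res[OF modX] r] mod_hom_zero[OF modX modA h] by (simp add: \<eta>_def)
  hence "red (l t) = \<zero>\<^bsub>A\<^esub>" using l(2)[OF t] by simp
  then obtain c where c: "c \<in> carrier R" "l t = x \<otimes> c"
    using red_zero_iff[of "l t"] mod_hom_closed[OF l(1) t] by auto
  have "l t = (\<Oplus>i\<in>{..<n}. a i \<otimes> t i) \<oplus> a n \<otimes> t n" using a(2)[OF t] dot_eq[OF a(1) t] by simp
  also have "(\<Oplus>i\<in>{..<n}. a i \<otimes> t i) = (\<Oplus>i\<in>{..<n}. a i \<otimes> z i)"
    using an z[OF zc] ti by (intro finsum_cong') auto
  finally have lt: "x \<otimes> c = (\<Oplus>i\<in>{..<n}. a i \<otimes> z i) \<oplus> a n \<otimes> (\<ominus> y)" using c tn by simp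
  have sum: "(\<Oplus>i\<in>{..<n}. a i \<otimes> z i) \<in> carrier R" using an z[OF zc] by (auto intro!: finsum_closed)
  have "(\<Oplus>i\<in>{..<n}. a i \<otimes> z i) = x \<otimes> c \<oplus> y \<otimes> a n"
    unfolding lt using sum an' by (simp add: a_assoc r_minus m_comm[of y] l_neg)
  hence am: "\<forall>i<n. a i \<in> \<mm>"
    by (intro indep) (use c an an' in auto)
  obtain w where w: "w \<in> carrier (free_mod A n)" "b = Ka +>\<^bsub>free_mod A n\<^esub> w"
    using b(1) by (auto simp: QA.carrier_Q)
  \<comment> \<open>The basis element \<open>b\<close> comes from a vector with last entry zero. On
    it \<open>l\<close> is congruent to one modulo \<open>x\<close>, yet its value is a combination
    of the \<open>a i\<close>, which now lie in the maximal ideal.\<close>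
  obtain u where u: "u \<in> carrier (F n)" "w = redv n u" using w(1) redv_onto[of n] by blast
  note iu = mod_hom_closed[OF incl_hom u(1)]
  have "r (cls (incl u)) = b"
    by (rule r_eqI[OF QM.coset_closed[OF iu] b(1)]) (use sc[OF w(1)] w u \<kappa>'(2) \<kappa>_def in simp)
  hence "red (l (incl u)) = red \<one>" using l(2)[OF iu] b(2) by (simp add: \<eta>_def red_one)
  then obtain d where d: "d \<in> carrier R" "l (incl u) = \<one> \<oplus> x \<otimes> d"
    using red_eq_iff[of "l (incl u)" \<one>] mod_hom_closed[OF l(1) iu] by auto
  have "l (incl u) = (\<Oplus>i\<in>{..<n}. a i \<otimes> incl u i) \<oplus> a n \<otimes> incl u n"
    using a(2)[OF iu] dot_eq[OF a(1) iu] by simp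
  also have "\<dots> \<in> \<mm>"
  proof -
    have "(\<Oplus>i\<in>{..<n}. a i \<otimes> incl u i) \<in> \<mm>"
      using am free_mod_nth(1)[OF _ iu] by (intro finsum_in_m m.I_r_closed) auto
    moreover have "a n \<otimes> incl u n = \<zero>" using incl_nth(2)[OF u(1)] an' by simp
    ultimately show ?thesis using m.Icarr by (metis r_zero)
  qed
  finally have "\<one> \<oplus> x \<otimes> d \<in> \<mm>" using d by simp
  moreover have "x \<otimes> d \<in> \<mm>" using xm d by (intro m.I_r_closed)
  ultimately have "(\<one> \<oplus> x \<otimes> d) \<ominus> x \<otimes> d \<in> \<mm>" unfolding a_minus_def by (rule m.a_closed[OF _ m.a_inv_closed])
  moreover have "(\<one> \<oplus> x \<otimes> d) \<ominus> x \<otimes> d = \<one>" using d by (simp add: minus_eq a_assoc r_neg)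
  ultimately show False using one_notin_m by metis
qed

text \<open>Writes the class of the last unit vector as a sum over \<open>P\<close> and
  \<open>Q\<close>. Last entries of relations are multiples of \<open>y\<close>, so the two last
  coordinates add up to one modulo the maximal ideal; one of them is a unit, and after scaling to
  one \<open>summand_zero\<close> kills the opposite summand.\<close>

lemma indecomposable_M:
  assumes G: "G_regular A"
  shows "indecomposable R M"
  unfolding indecomposable_def
proof (intro conjI allI impI)
  interpret M': Module.module R M by (rule modM)
  note en = unitvec_closed[OF crR, of N n]
  have Kn: "k n \<in> \<mm>" if k: "k \<in> K" for k
  proof -
    obtain w where w: "w \<in> carrier (F N)" "k = T w" using k by blast
    have "w n \<in> carrier R" by (rule free_mod_nth(1)[OF lessI w(1)])
    thus ?thesis using ym w by (simp add: pres_def m.a_inv_closed m.I_r_closed)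
  qed
  show "carrier M \<noteq> {\<zero>\<^bsub>M\<^esub>}"
  proof
    assume "carrier M = {\<zero>\<^bsub>M\<^esub>}"
    hence "unitvec R N n \<in> K" using QM.coset_zero_iff[OF en] QM.coset_closed[OF en] by auto
    from Kn[OF this] show False using one_notin_m by (simp add: unitvec_def)
  qed
  fix P Q assume "submodule P R M \<and> submodule Q R M \<and> P \<inter> Q = {\<zero>\<^bsub>M\<^esub>} \<and> P <+>\<^bsub>M\<^esub> Q = carrier M"
  hence P: "submodule P R M" and Q: "submodule Q R M" and 0: "P \<inter> Q = {\<zero>\<^bsub>M\<^esub>}" "Q \<inter> P = {\<zero>\<^bsub>M\<^esub>}"
    and PQ: "P <+>\<^bsub>M\<^esub> Q = carrier M" by auto
  note PE = M'.submoduleE[OF P] and QE = M'.submoduleE[OF Q]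
  have QP: "Q <+>\<^bsub>M\<^esub> P = carrier M"
  proof -
    have "p \<oplus>\<^bsub>M\<^esub> q = q \<oplus>\<^bsub>M\<^esub> p" if "p \<in> P" "q \<in> Q" for p q
      using that PE(1) QE(1) by (intro M'.M.a_comm) auto
    hence "m \<in> Q <+>\<^bsub>M\<^esub> P \<longleftrightarrow> m \<in> P <+>\<^bsub>M\<^esub> Q" for m unfolding set_add_iff by metis
    hence "Q <+>\<^bsub>M\<^esub> P = P <+>\<^bsub>M\<^esub> Q" by blast
    thus ?thesis using PQ by simp
  qed
  have norm: "\<exists>v'\<in>carrier (F N). v' n = \<one> \<and> cls v' \<in> B"
    if B: "submodule B R M" and v: "v \<in> carrier (F N)" "cls v \<in> B" "v n \<notin> \<mm>" for B v
  proof -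
    obtain b where b: "b \<in> carrier R" "b \<otimes> v n = \<one>"
      using unit_if_notin_m[OF free_mod_nth(1)[OF lessI v(1)] v(3)] by blast
    have "cls (b \<odot>\<^bsub>F N\<^esub> v) \<in> B"
      using QM.coset_smult[OF b(1) v(1)] M'.submoduleE(4)[OF B b(1) v(2)] by simp
    thus ?thesis using b v by (intro bexI[of _ "b \<odot>\<^bsub>F N\<^esub> v"]) (auto simp: free_mod_nth)
  qed
  have "cls (unitvec R N n) \<in> P <+>\<^bsub>M\<^esub> Q" unfolding PQ by (rule QM.coset_closed[OF en])
  then obtain p q where pq: "p \<in> P" "q \<in> Q" "cls (unitvec R N n) = p \<oplus>\<^bsub>M\<^esub> q"
    by (metis set_add_iff)
  obtain u where u: "u \<in> carrier (F N)" "p = cls u" using pq(1) PE(1) by (auto simp: QM.carrier_Q)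
  obtain v where v: "v \<in> carrier (F N)" "q = cls v" using pq(2) QE(1) by (auto simp: QM.carrier_Q)
  have uv: "u \<oplus>\<^bsub>F N\<^esub> v \<in> carrier (F N)" using u v by simp
  have c: "u n \<in> carrier R" "v n \<in> carrier R" using free_mod_nth(1)[OF lessI] u v by auto
  have "unitvec R N n \<ominus>\<^bsub>F N\<^esub> (u \<oplus>\<^bsub>F N\<^esub> v) \<in> K"
    using pq(3) u v QM.coset_add QM.coset_eq_iff[OF en uv] by simp
  from Kn[OF this] have m1: "\<one> \<ominus> (u n \<oplus> v n) \<in> \<mm>"
    using free_mod_minus_nth[OF crR lessI en uv] by (simp add: unitvec_def free_mod_nth)
  have "u n \<notin> \<mm> \<or> v n \<notin> \<mm>"
  proof (rule ccontr)
    assume "\<not> ?thesis"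
    hence "(\<one> \<ominus> (u n \<oplus> v n)) \<oplus> (u n \<oplus> v n) \<in> \<mm>" using m1 m.a_closed by blast
    moreover have "(\<one> \<ominus> (u n \<oplus> v n)) \<oplus> (u n \<oplus> v n) = \<one>" using c by (simp add: minus_eq a_assoc l_neg)
    ultimately show False using one_notin_m by metis
  qed
  thus "P = {\<zero>\<^bsub>M\<^esub>} \<or> Q = {\<zero>\<^bsub>M\<^esub>}"
  proof
    assume "u n \<notin> \<mm>"
    then obtain v' where "v' \<in> carrier (F N)" "v' n = \<one>" "cls v' \<in> P" using norm[OF P u(1)] pq u by auto
    thus ?thesis using summand_zero[OF G P Q 0(1) PQ] by blast
  next
    assume "v n \<notin> \<mm>"
    then obtain v' where "v' \<in> carrier (F N)" "v' n = \<one>" "cls v' \<in> Q" using norm[OF Q v(1)] pq v by auto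
    thus ?thesis using summand_zero[OF G Q P 0(2) QP] by blast
  qed
qed

end

subsection \<open>Isomorphic presentations\<close>

context presentation
begin

text \<open>Lift the isomorphism and its inverse to \<open>f\<close> and \<open>g\<close> on
  \<open>F N\<close>. The defect \<open>id - f g\<close> maps into the relations of the second
  module, whose entries lie in the maximal ideal. The last relation \<open>t\<close> of the second
  module is this defect at \<open>t\<close> plus \<open>f (g t)\<close>. The second term has entries
  in \<open>W\<close> since \<open>g t\<close> is a relation of the first module, the first because
  \<open>W\<close> contains \<open>y\<close> and the products of \<open>z'\<close> with the maximal
  ideal.\<close>

lemma presentation_iso_ideal:
  assumes loc: "local_cring R" and z': "z' \<in> {..<n} \<rightarrow> max_ideal R"
    and xm: "x \<in> max_ideal R" and ym: "y \<in> max_ideal R"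
    and W: "ideal W R" and xW: "x \<in> W" and yW: "y \<in> W" and zW: "\<And>i. i < n \<Longrightarrow> z i \<in> W"
    and mW: "\<And>i c. i < n \<Longrightarrow> c \<in> max_ideal R \<Longrightarrow> z' i \<otimes> c \<in> W"
    and iso: "mod_iso R M (quot_module (F N) (pres R n x y z' ` carrier (F N)))"
  shows "i < n \<Longrightarrow> z' i \<in> W"
proof -
  assume i: "i < n"
  interpret local_cring R by (rule loc)
  interpret W: ideal W R by (rule W)
  have z'R: "z' \<in> {..<n} \<rightarrow> carrier R" using z' m.Icarr by blast
  interpret P: presentation R x y n z'
    by (intro presentation.intro exact_pair_ring_axioms presentation_axioms.intro z'R)
  have z'm: "z' j \<in> \<mm>" if "j < n" for j using z' that by auto
  obtain \<phi> where \<phi>: "\<phi> \<in> mod_hom R M P.M" "bij_betw \<phi> (carrier M) (carrier P.M)"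
    using iso unfolding mod_iso_def by blast
  define \<psi> where "\<psi> = inv_into (carrier M) \<phi>"
  have \<phi>i: "inj_on \<phi> (carrier M)" and \<phi>s: "\<phi> ` carrier M = carrier P.M"
    using \<phi>(2) unfolding bij_betw_def by blast+
  have \<psi>c: "\<psi> u \<in> carrier M" "\<phi> (\<psi> u) = u" if "u \<in> carrier P.M" for u
    using that inv_into_into[of u \<phi> "carrier M"] f_inv_into_f[of u \<phi> "carrier M"]
    unfolding \<psi>_def \<phi>s by blast+
  have \<psi>0: "\<psi> \<zero>\<^bsub>P.M\<^esub> = \<zero>\<^bsub>M\<^esub>"
  proof -
    interpret M': Module.module R M by (rule modM)
    interpret PM: Module.module R P.M by (rule P.modM)
    have "\<phi> (\<psi> \<zero>\<^bsub>P.M\<^esub>) = \<phi> \<zero>\<^bsub>M\<^esub>" using \<psi>c(2)[OF PM.zero_closed] mod_hom_zero[OF modM P.modM \<phi>(1)] by (rule trans[OF _ sym])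
    thus ?thesis by (rule inj_onD[OF \<phi>i _ \<psi>c(1)[OF PM.zero_closed] M'.zero_closed])
  qed
  have "(\<lambda>u. \<phi> (cls u)) ` carrier (F N) \<subseteq> P.cls ` carrier (F N)"
    unfolding P.QM.carrier_Q[symmetric] using mod_hom_closed[OF \<phi>(1) QM.coset_closed] by blast
  then obtain f where f: "f \<in> mod_hom R (F N) (F N)" "\<And>u. u \<in> carrier (F N) \<Longrightarrow> P.cls (f u) = \<phi> (cls u)"
    using free_mod_lift[OF modF P.modM P.QM.coset_hom mod_hom_comp[OF QM.coset_hom \<phi>(1)]] by metis
  have \<psi>: "\<psi> \<in> mod_hom R P.M M"
  proof (rule mod_homI)
    interpret M': Module.module R M by (rule modM)
    interpret PM: Module.module R P.M by (rule P.modM)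
    fix u assume u: "u \<in> carrier P.M"
    show "\<psi> u \<in> carrier M" by (rule \<psi>c[OF u])
    show "\<psi> (u \<oplus>\<^bsub>P.M\<^esub> v) = \<psi> u \<oplus>\<^bsub>M\<^esub> \<psi> v" if v: "v \<in> carrier P.M" for v
    proof (rule inj_onD[OF \<phi>i])
      show "\<phi> (\<psi> (u \<oplus>\<^bsub>P.M\<^esub> v)) = \<phi> (\<psi> u \<oplus>\<^bsub>M\<^esub> \<psi> v)"
        unfolding mod_hom_add[OF \<phi>(1) \<psi>c(1)[OF u] \<psi>c(1)[OF v]] \<psi>c(2)[OF u] \<psi>c(2)[OF v] \<psi>c(2)[OF PM.a_closed[OF u v]] ..
      show "\<psi> (u \<oplus>\<^bsub>P.M\<^esub> v) \<in> carrier M" by (rule \<psi>c(1)[OF PM.a_closed[OF u v]])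
      show "\<psi> u \<oplus>\<^bsub>M\<^esub> \<psi> v \<in> carrier M" by (rule M'.M.a_closed[OF \<psi>c(1)[OF u] \<psi>c(1)[OF v]])
    qed
    show "\<psi> (a \<odot>\<^bsub>P.M\<^esub> u) = a \<odot>\<^bsub>M\<^esub> \<psi> u" if a: "a \<in> carrier R" for a
    proof (rule inj_onD[OF \<phi>i])
      show "\<phi> (\<psi> (a \<odot>\<^bsub>P.M\<^esub> u)) = \<phi> (a \<odot>\<^bsub>M\<^esub> \<psi> u)"
        unfolding mod_hom_smult[OF \<phi>(1) a \<psi>c(1)[OF u]] \<psi>c(2)[OF u] \<psi>c(2)[OF PM.smult_closed[OF a u]] ..
      show "\<psi> (a \<odot>\<^bsub>P.M\<^esub> u) \<in> carrier M" by (rule \<psi>c(1)[OF PM.smult_closed[OF a u]])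
      show "a \<odot>\<^bsub>M\<^esub> \<psi> u \<in> carrier M" by (rule M'.smult_closed[OF a \<psi>c(1)[OF u]])
    qed
  qed
  have "(\<lambda>u. \<psi> (P.cls u)) ` carrier (F N) \<subseteq> cls ` carrier (F N)"
    unfolding QM.carrier_Q[symmetric] using mod_hom_closed[OF \<psi> P.QM.coset_closed] by blast
  then obtain g where g: "g \<in> mod_hom R (F N) (F N)" "\<And>u. u \<in> carrier (F N) \<Longrightarrow> cls (g u) = \<psi> (P.cls u)"
    using free_mod_lift[OF modF modM QM.coset_hom mod_hom_comp[OF P.QM.coset_hom \<psi>]] by metis
  \<comment> \<open>The vectors with all entries in \<open>W\<close>, a submodule containing the
    relations of the first module and preserved by \<open>f\<close>.\<close>
  define WF where "WF = {v \<in> carrier (F N). \<forall>i<N. v i \<in> W}"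
  have WF: "submodule WF R (F N)"
  proof (rule QM.submoduleI)
    show "WF \<subseteq> carrier (F N)" by (auto simp: WF_def)
    show "\<zero>\<^bsub>F N\<^esub> \<in> WF" using W.zero_closed QM.M.zero_closed by (auto simp: WF_def free_mod_nth)
    show "\<ominus>\<^bsub>F N\<^esub> v \<in> WF" if "v \<in> WF" for v
      using that by (auto simp: WF_def free_mod_neg_nth[OF crR])
    show "u \<oplus>\<^bsub>F N\<^esub> v \<in> WF" if "u \<in> WF" "v \<in> WF" for u v
      using that by (auto simp: WF_def free_mod_nth)
    show "a \<odot>\<^bsub>F N\<^esub> v \<in> WF" if "a \<in> carrier R" "v \<in> WF" for a v
      using that W.I_l_closed by (auto simp: WF_def free_mod_nth)
  qed
  have combW: "h v \<in> WF" if h: "h \<in> mod_hom R (F N) (F N)" and v: "v \<in> carrier (F N)"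
    and *: "\<And>j. j < N \<Longrightarrow> v j \<odot>\<^bsub>F N\<^esub> h (unitvec R N j) \<in> WF" for h v
    unfolding mod_hom_eq_lincomb[OF modF h v] lincomb_def
    by (rule submodule_finsum[OF modF WF]) (use * in auto)
  have KW: "K \<subseteq> WF"
  proof
    fix k assume k: "k \<in> K"
    then obtain w where w: "w \<in> carrier (F N)" "k = T w" by blast
    have wn: "w j \<in> carrier R" if "j < N" for j using free_mod_nth(1)[OF that w(1)] .
    have "k j \<in> W" if "j < N" for j
      using xW yW zW wn[OF that] wn[OF lessI] that unfolding w(2) pres_def
      by (auto intro!: W.a_closed W.a_inv_closed W.I_r_closed)
    thus "k \<in> WF" using mod_hom_closed[OF T_hom w(1)] by (simp add: WF_def w(2))
  qed
  have Km: "k j \<in> \<mm>" if k: "k \<in> P.K" and j: "j < N" for k j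
  proof -
    obtain w where w: "w \<in> carrier (F N)" "k = P.T w" using k by blast
    have wn: "w j \<in> carrier R" if "j < N" for j using free_mod_nth(1)[OF that w(1)] .
    show ?thesis
      using xm ym z'm wn[OF j] wn[OF lessI] j unfolding w(2) pres_def
      by (auto intro!: m.a_closed m.a_inv_closed m.I_r_closed)
  qed
  note en = unitvec_closed[OF crR]
  have fW: "f v \<in> WF" if v: "v \<in> WF" for v
  proof (rule combW[OF f(1)])
    show vF: "v \<in> carrier (F N)" using v by (simp add: WF_def)
    fix j assume j: "j < N"
    have "f (unitvec R N j) \<in> carrier (F N)" by (rule mod_hom_closed[OF f(1) en])
    thus "v j \<odot>\<^bsub>F N\<^esub> f (unitvec R N j) \<in> WF"
      using v j free_mod_nth(1)[OF _ vF] W.I_r_closed by (auto simp: WF_def free_mod_nth)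
  qed
  define D where "D v = v \<ominus>\<^bsub>F N\<^esub> f (g v)" for v
  have D: "D \<in> mod_hom R (F N) (F N)" unfolding D_def
    by (intro mod_hom_diff modF mod_hom_id mod_hom_comp[OF g(1) f(1)])
  have fg: "f (g v) \<in> carrier (F N)" "g v \<in> carrier (F N)" if "v \<in> carrier (F N)" for v
    using mod_hom_closed[OF f(1)] mod_hom_closed[OF g(1)] that by auto
  have DK: "D v \<in> P.K" if v: "v \<in> carrier (F N)" for v
  proof -
    have "P.cls (f (g v)) = P.cls v"
      using f(2)[OF fg(2)[OF v]] g(2)[OF v] \<psi>c(2)[OF P.QM.coset_closed[OF v]] by simp
    thus ?thesis using P.QM.coset_eq_iff[OF v fg(1)[OF v]] by (simp add: D_def)
  qed
  define t where "t = P.T (unitvec R N n)"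
  have t: "t \<in> carrier (F N)" unfolding t_def by (rule mod_hom_closed[OF P.T_hom en])
  have tK: "t \<in> P.K" unfolding t_def using en by blast
  have ti: "t j = z' j" if "j < n" for j
    using that z[OF z'R that] xy_closed by (simp add: t_def pres_def unitvec_def)
  have tn: "t n = \<ominus> y" by (simp add: t_def pres_def unitvec_def)
  have DtW: "D t \<in> WF"
  \<comment> \<open>\<open>D t\<close> is the combination of the vectors \<open>D e_j\<close> with
    coefficients \<open>t j\<close>. For \<open>j < n\<close> the coefficient is \<open>z' j\<close>
    and the vector has entries in the maximal ideal; for \<open>j = n\<close> the coefficient is
    \<open>-y\<close>.\<close>
  proof (rule combW[OF D t])
    fix j assume j: "j < N"
    have De: "D (unitvec R N j) \<in> carrier (F N)" by (rule mod_hom_closed[OF D en])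
    have tj: "t j \<in> carrier R" by (rule free_mod_nth(1)[OF j t])
    have "t j \<otimes> D (unitvec R N j) i \<in> W" if i: "i < N" for i
    proof (cases "j < n")
      case True
      thus ?thesis using mW[OF True Km[OF DK[OF en] i]] ti by simp
    next
      case False
      hence "t j = \<ominus> y" using j tn by (simp add: less_Suc_eq)
      thus ?thesis using yW free_mod_nth(1)[OF i De] by (auto intro: W.I_r_closed W.a_inv_closed)
    qed
    thus "t j \<odot>\<^bsub>F N\<^esub> D (unitvec R N j) \<in> WF"
      using De tj by (simp add: WF_def free_mod_nth)
  qed
  have "cls (g t) = \<zero>\<^bsub>M\<^esub>" using g(2)[OF t] P.QM.coset_zero_iff[OF t] tK \<psi>0 by simp
  hence "g t \<in> K" using QM.coset_zero_iff[OF fg(2)[OF t]] by simp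
  hence "f (g t) \<in> WF" using fW KW by blast
  hence "D t \<oplus>\<^bsub>F N\<^esub> f (g t) \<in> WF" using QM.submoduleE(5)[OF WF DtW] by blast
  moreover have "D t \<oplus>\<^bsub>F N\<^esub> f (g t) = t"
    unfolding D_def using t fg[OF t] by (simp add: QM.M.minus_eq QM.M.a_assoc QM.M.l_neg)
  ultimately have "t \<in> WF" by simp
  thus "z' i \<in> W" unfolding ti[OF i, symmetric] using i by (simp add: WF_def)
qed

end

subsection \<open>Minimal generators modulo the exact pair\<close>

text \<open>A relation with a unit coefficient can be solved for the generator \<open>v j\<close>,
  which is thus in the span \<open>L\<close> of the others.\<close>

lemma generates_drop:
  assumes X: "Module.module A X" and gen: "generates A X (Suc k) v"
    and c: "c \<in> {..<Suc k} \<rightarrow> carrier A" and 0: "(\<Oplus>\<^bsub>X\<^esub>i\<in>{..<Suc k}. c i \<odot>\<^bsub>X\<^esub> v i) = \<zero>\<^bsub>X\<^esub>"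
    and j: "j < Suc k" and d: "d \<in> carrier A" "d \<otimes>\<^bsub>A\<^esub> c j = \<one>\<^bsub>A\<^esub>"
  shows "\<exists>v'. generates A X k v'"
proof -
  interpret X: Module.module A X by (rule X)
  note crA = X.R.is_cring
  have v: "\<And>i. i < Suc k \<Longrightarrow> v i \<in> carrier X" using gen by (auto simp: generates_def)
  have cc: "\<And>i. i < Suc k \<Longrightarrow> c i \<in> carrier A" using c by auto
  \<comment> \<open>The enumeration of \<open>v\<close> that skips index \<open>j\<close>.\<close>
  define v' where "v' i = v (if i < j then i else Suc i)" for i
  have v': "v' \<in> {..<k} \<rightarrow> carrier X" using v by (auto simp: v'_def)
  note l = lincomb_hom[OF X v']
  define L where "L = lincomb X k v' ` carrier (free_mod A k)"
  have L: "submodule L A X" unfolding L_def by (rule submodule_range[OF module_free_mod[OF crA] X l])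
  have vL: "v i \<in> L" if "i < Suc k" "i \<noteq> j" for i
  proof -
    define i' where "i' = (if i < j then i else i - 1)"
    have i': "i' < k" "v' i' = v i" using that j by (auto simp: i'_def v'_def)
    have "v i = lincomb X k v' (unitvec A k i')" using lincomb_unitvec[OF X v' i'(1)] i'(2) by simp
    thus ?thesis unfolding L_def using unitvec_closed[OF crA] by blast
  qed
  have rest: "(\<Oplus>\<^bsub>X\<^esub>i\<in>{..<Suc k} - {j}. c i \<odot>\<^bsub>X\<^esub> v i) \<in> L"
    by (rule submodule_finsum[OF X L]) (use vL X.submoduleE(4)[OF L] cc in auto)
  have ins: "insert j ({..<Suc k} - {j}) = {..<Suc k}" using j by auto
  have "(\<Oplus>\<^bsub>X\<^esub>i\<in>insert j ({..<Suc k} - {j}). c i \<odot>\<^bsub>X\<^esub> v i) =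
      c j \<odot>\<^bsub>X\<^esub> v j \<oplus>\<^bsub>X\<^esub> (\<Oplus>\<^bsub>X\<^esub>i\<in>{..<Suc k} - {j}. c i \<odot>\<^bsub>X\<^esub> v i)"
    by (rule X.finsum_insert) (use cc v j in auto)
  hence "c j \<odot>\<^bsub>X\<^esub> v j \<oplus>\<^bsub>X\<^esub> (\<Oplus>\<^bsub>X\<^esub>i\<in>{..<Suc k} - {j}. c i \<odot>\<^bsub>X\<^esub> v i) = \<zero>\<^bsub>X\<^esub>" unfolding ins 0 by simp
  hence "c j \<odot>\<^bsub>X\<^esub> v j = \<ominus>\<^bsub>X\<^esub> (\<Oplus>\<^bsub>X\<^esub>i\<in>{..<Suc k} - {j}. c i \<odot>\<^bsub>X\<^esub> v i)"
    using rest X.submoduleE(1)[OF L] cc[OF j] v[OF j] by (intro X.minus_equality[symmetric]) auto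
  hence "c j \<odot>\<^bsub>X\<^esub> v j \<in> L" using X.submoduleE(3)[OF L rest] by simp
  hence "d \<odot>\<^bsub>X\<^esub> (c j \<odot>\<^bsub>X\<^esub> v j) \<in> L" using X.submoduleE(4)[OF L d(1)] by blast
  hence "v j \<in> L" using d cc[OF j] v[OF j] by (simp add: X.smult_assoc1[symmetric])
  hence vL': "v i \<in> L" if "i < Suc k" for i using vL that by blast
  have "generates A X k v'" unfolding generates_def
  proof (intro conjI v' ballI)
    fix m assume "m \<in> carrier X"
    then obtain b where b: "b \<in> {..<Suc k} \<rightarrow> carrier A" "m = (\<Oplus>\<^bsub>X\<^esub>i\<in>{..<Suc k}. b i \<odot>\<^bsub>X\<^esub> v i)"
      using gen by (auto simp: generates_def)
    have "m \<in> L" unfolding b(2)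
      by (rule submodule_finsum[OF X L]) (use vL' X.submoduleE(4)[OF L] b(1) in auto)
    then obtain u where "u \<in> carrier (free_mod A k)" "m = lincomb X k v' u" by (auto simp: L_def)
    thus "\<exists>c\<in>{..<k} \<rightarrow> carrier A. m = (\<Oplus>\<^bsub>X\<^esub>i\<in>{..<k}. c i \<odot>\<^bsub>X\<^esub> v' i)"
      by (intro bexI[of _ u]) (auto simp: lincomb_def free_mod_simps)
  qed
  thus ?thesis by blast
qed

locale noetherian_local = noetherian_base R + local_cring R for R :: "('a, 'e) ring_scheme" (structure)
begin

lemma independent_elements:
  assumes xy: "x \<in> \<mm>" "y \<in> \<mm>" and n: "enat n < s_inv R x y"
  obtains a where "a \<in> carrier (F (Suc n))"
    "\<And>c i. c \<in> carrier (F (Suc n)) \<Longrightarrow> dot n a c \<in> Idl {x, y} \<Longrightarrow> i < Suc n \<Longrightarrow> c i \<in> \<mm>"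
proof -
  define J where "J = Idl {x, y}"
  define B where "B = R Quot J"
  have J: "ideal J R" unfolding J_def by (rule genideal_ideal) (use xy m.Icarr in auto)
  interpret J: ideal J R by (rule J)
  have zB: "\<zero>\<^bsub>B\<^esub> = J" by (simp add: B_def FactRing_def)
  have crB: "cring B" unfolding B_def by (rule J.quotient_is_cring[OF crR])
  interpret B: cring B by (rule crB)
  let ?q = "\<lambda>a. J +> a"
  have carB: "carrier B = ?q ` carrier R" unfolding B_def by (auto simp: FactRing_def A_RCOSETS_def')
  have rh: "ring_hom_cring R B ?q" unfolding B_def by (rule J.rcos_ring_hom_cring[OF crR])
  interpret q: ring_hom_cring R B ?q by (rule rh)
  obtain I where I: "ideal I R" "n < mu B (ideal_mod B (?q ` I))"
    using n unfolding s_inv_def Let_def less_Sup_iff J_def[symmetric] B_def[symmetric] by auto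
  interpret I: ideal I R by (rule I(1))
  let ?X = "ideal_mod B (?q ` I)"
  have IR: "\<And>a. a \<in> I \<Longrightarrow> a \<in> carrier R" by (rule I.Icarr)
  have modB: "Module.module B (ring_mod B)" by (rule module_ring_mod[OF crB])
  interpret RB: Module.module B "ring_mod B" by (rule modB)
  have sub: "submodule (?q ` I) B (ring_mod B)"
  proof (rule RB.submoduleI)
    show "?q ` I \<subseteq> carrier (ring_mod B)" using IR by (auto simp: carB)
    show "\<zero>\<^bsub>ring_mod B\<^esub> \<in> ?q ` I" using q.hom_zero I.zero_closed by (metis imageI ring_mod_simps(2))
    show "\<ominus>\<^bsub>ring_mod B\<^esub> b \<in> ?q ` I" if b: "b \<in> ?q ` I" for b
    proof -
      obtain a where a: "a \<in> I" "b = ?q a" using b by blast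
      have "\<ominus>\<^bsub>ring_mod B\<^esub> b = ?q (\<ominus> a)"
        unfolding a_inv_ring_mod a(2) by (rule q.hom_a_inv[OF IR[OF a(1)], symmetric])
      thus ?thesis using I.a_inv_closed[OF a(1)] by blast
    qed
    show "b \<oplus>\<^bsub>ring_mod B\<^esub> b' \<in> ?q ` I" if b: "b \<in> ?q ` I" "b' \<in> ?q ` I" for b b'
    proof -
      obtain a a' where a: "a \<in> I" "b = ?q a" "a' \<in> I" "b' = ?q a'" using b by blast
      have "b \<oplus>\<^bsub>ring_mod B\<^esub> b' = ?q (a \<oplus> a')"
        unfolding a ring_mod_simps by (rule q.hom_add[OF IR[OF a(1)] IR[OF a(3)], symmetric])
      thus ?thesis using I.a_closed[OF a(1,3)] by blast
    qed
    show "b \<odot>\<^bsub>ring_mod B\<^esub> b' \<in> ?q ` I" if b: "b \<in> carrier B" "b' \<in> ?q ` I" for b b'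
    proof -
      obtain a a' where a: "a \<in> carrier R" "b = ?q a" "a' \<in> I" "b' = ?q a'" using b unfolding carB by blast
      have "b \<odot>\<^bsub>ring_mod B\<^esub> b' = ?q (a \<otimes> a')"
        unfolding a ring_mod_simps by (rule q.hom_mult[OF a(1) IR[OF a(3)], symmetric])
      thus ?thesis using I.I_l_closed[OF a(3,1)] by blast
    qed
  qed
  have X: "Module.module B ?X" unfolding ideal_mod_def by (rule submodule.submodule_is_module[OF sub modB])
  interpret X: Module.module B ?X by (rule X)
  have carX: "carrier ?X = ?q ` I" and smX: "smult ?X = mult B" and zX: "\<zero>\<^bsub>?X\<^esub> = \<zero>\<^bsub>B\<^esub>"
    by (simp_all add: ideal_mod_def)
  have idX: "(\<lambda>u. u) \<in> mod_hom B ?X (ring_mod B)"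
    unfolding ideal_mod_def by (rule mod_hom_sub[OF mod_hom_id RB.submoduleE(1)[OF sub]])
  have sumX: "finsum ?X h S = finsum B h S" if "h \<in> S \<rightarrow> ?q ` I" for h S
    using mod_hom_finsum[OF X modB idX, of h S] that by (simp add: carX finsum_ring_mod)
  \<comment> \<open>\<open>mu\<close> is a least number, so its value means something only once some
    finite generating system exists; the Noetherian property provides one.\<close>
  have "\<exists>k v. generates B ?X k v"
  proof -
    obtain k s where s: "s \<in> {..<k::nat} \<rightarrow> I" "\<And>J. ideal J R \<Longrightarrow> s ` {..<k} \<subseteq> J \<Longrightarrow> I \<subseteq> J"
      by (rule ideal_fin_gen[OF I(1)]) blast
    have sR: "s \<in> {..<k} \<rightarrow> carrier RR" using s(1) by (auto simp: Pi_iff intro: IR)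
    have sR': "\<And>i. i < k \<Longrightarrow> s i \<in> carrier R" using sR by auto
    note l = lincomb_hom[OF modR sR]
    have "ideal (lincomb RR k s ` carrier (F k)) R"
      by (rule submodule_ring_mod_ideal[OF crR submodule_range[OF modF modR l]])
    moreover have "s i \<in> lincomb RR k s ` carrier (F k)" if "i < k" for i
      using lincomb_unitvec[OF modR sR that] unitvec_closed[OF crR, of k i] by (metis imageI)
    ultimately have Is: "I \<subseteq> lincomb RR k s ` carrier (F k)" by (intro s(2)) auto
    have "generates B ?X k (\<lambda>i. ?q (s i))" unfolding generates_def
    proof (intro conjI ballI)
      show "(\<lambda>i. ?q (s i)) \<in> {..<k} \<rightarrow> carrier ?X" using s(1) by (auto simp: carX)
      fix b assume "b \<in> carrier ?X"
      then obtain u where u: "u \<in> carrier (F k)" "b = ?q (lincomb RR k s u)" using Is by (auto simp: carX)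
      note un = free_mod_nth(1)[OF _ u(1)]
      have us: "u i \<otimes> s i \<in> I" if "i < k" for i
        by (rule I.I_l_closed) (use s(1) un that in auto)
      have "b = ?q (\<Oplus>i\<in>{..<k}. u i \<otimes> s i)" using u by (simp add: lincomb_def finsum_ring_mod)
      also have "\<dots> = (\<Oplus>\<^bsub>B\<^esub>i\<in>{..<k}. ?q (u i \<otimes> s i))"
        using un sR' by (subst q.hom_finsum) (auto simp: comp_def)
      also have "\<dots> = (\<Oplus>\<^bsub>?X\<^esub>i\<in>{..<k}. ?q (u i \<otimes> s i))"
        using us by (intro sumX[symmetric]) auto
      also have "\<dots> = (\<Oplus>\<^bsub>?X\<^esub>i\<in>{..<k}. ?q (u i) \<odot>\<^bsub>?X\<^esub> ?q (s i))"
        by (rule X.finsum_cong'[OF refl])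
           (use us un sR' imageI[where f = ?q, OF us] in \<open>auto simp: smX carX q.hom_mult[symmetric] simp del: q.hom_mult\<close>)
      finally show "\<exists>c\<in>{..<k} \<rightarrow> carrier B. b = (\<Oplus>\<^bsub>?X\<^esub>i\<in>{..<k}. c i \<odot>\<^bsub>?X\<^esub> ?q (s i))"
        using un by (intro bexI[of _ "\<lambda>i. ?q (u i)"]) (auto simp: carB)
    qed
    thus ?thesis by blast
  qed
  define k where "k = mu B ?X"
  obtain v where v: "generates B ?X k v"
    using LeastI_ex[OF \<open>\<exists>k v. generates B ?X k v\<close>] unfolding k_def mu_def by blast
  have min: "\<not> generates B ?X k' v'" if "k' < k" for k' v'
    using not_less_Least[of k' "\<lambda>n. \<exists>v. generates B ?X n v"] that unfolding k_def mu_def by blast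
  have nk: "n < k" using I(2) by (simp add: k_def)
  then obtain k' where k': "k = Suc k'" by (cases k) auto
  have "v i \<in> ?q ` I" if "i < k" for i using v that unfolding generates_def carX by blast
  hence "\<forall>i. \<exists>a. i < k \<longrightarrow> a \<in> I \<and> v i = ?q a" by blast
  then obtain a where a: "\<And>i. i < k \<Longrightarrow> a i \<in> I" "\<And>i. i < k \<Longrightarrow> v i = ?q (a i)" by metis
  have aR: "\<And>i. i < k \<Longrightarrow> a i \<in> carrier R" using a IR by blast
  have ind: "c i \<in> \<mm>" if c: "c \<in> {..<k} \<rightarrow> carrier R" and s: "(\<Oplus>i\<in>{..<k}. c i \<otimes> a i) \<in> J" and i: "i < k" for c i
  proof (rule ccontr)
    assume ni: "c i \<notin> \<mm>"
    have cR: "\<And>i. i < k \<Longrightarrow> c i \<in> carrier R" using c by auto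
    obtain d where d: "d \<in> carrier R" "d \<otimes> c i = \<one>" using unit_if_notin_m[OF cR[OF i] ni] by blast
    have qs: "?q (c i) \<otimes>\<^bsub>B\<^esub> ?q (a i) = ?q (c i \<otimes> a i)" "?q (c i \<otimes> a i) \<in> ?q ` I" if "i < k" for i
    proof -
      show "?q (c i) \<otimes>\<^bsub>B\<^esub> ?q (a i) = ?q (c i \<otimes> a i)" using cR[OF that] aR[OF that] by simp
      show "?q (c i \<otimes> a i) \<in> ?q ` I" by (rule imageI[OF I.I_l_closed[OF a(1)[OF that] cR[OF that]]])
    qed
    have "(\<Oplus>\<^bsub>?X\<^esub>i\<in>{..<k}. ?q (c i) \<odot>\<^bsub>?X\<^esub> v i) = (\<Oplus>\<^bsub>?X\<^esub>i\<in>{..<k}. ?q (c i \<otimes> a i))"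
      using qs a(2) by (intro X.finsum_cong') (auto simp: smX carX)
    also have "\<dots> = (\<Oplus>\<^bsub>B\<^esub>i\<in>{..<k}. ?q (c i \<otimes> a i))" using qs by (intro sumX) auto
    also have "\<dots> = ?q (\<Oplus>i\<in>{..<k}. c i \<otimes> a i)" using cR aR by (subst q.hom_finsum) (auto simp: comp_def)
    also have "\<dots> = \<zero>\<^bsub>B\<^esub>" unfolding zB by (rule J.a_rcos_const[OF s])
    finally have "(\<Oplus>\<^bsub>?X\<^esub>i\<in>{..<Suc k'}. ?q (c i) \<odot>\<^bsub>?X\<^esub> v i) = \<zero>\<^bsub>?X\<^esub>" by (simp add: zX k')
    moreover have "?q d \<otimes>\<^bsub>B\<^esub> ?q (c i) = \<one>\<^bsub>B\<^esub>"
      using d cR[OF i] q.hom_one by (simp add: q.hom_mult[symmetric] del: q.hom_mult)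
    ultimately have "\<exists>v'. generates B ?X k' v'"
      using v d i cR unfolding k' by (intro generates_drop[OF X, of k' v "\<lambda>i. ?q (c i)" i "?q d"]) (auto simp: carB)
    thus False using min[of k'] k' by auto
  qed
  define a' where "a' = restrict a {..<Suc n}"
  have a': "a' \<in> carrier (F (Suc n))" unfolding a'_def using aR nk by (intro free_mod_memI) auto
  show ?thesis
  proof (rule that[OF a'])
    fix c i assume c: "c \<in> carrier (F (Suc n))" and s: "dot n a' c \<in> Idl {x, y}" and i: "i < Suc n"
    note cn = free_mod_nth(1)[OF _ c]
    \<comment> \<open>A relation among the first \<open>n + 1\<close> generators is padded with
      zeros to one among all \<open>k\<close>.\<close>
    define c' where "c' i = (if i < Suc n then c i else \<zero>)" for i
    have c': "c' \<in> {..<k} \<rightarrow> carrier R" using cn by (auto simp: c'_def)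
    have "(\<Oplus>i\<in>{..<k}. c' i \<otimes> a i) = (\<Oplus>i\<in>{..<Suc n}. c' i \<otimes> a i)"
      by (rule add.finprod_mono_neutral_cong_right) (use nk aR cn in \<open>auto simp: c'_def\<close>)
    also have "\<dots> = dot n a' c"
      unfolding dot_def by (rule finsum_cong') (use nk aR cn in \<open>auto simp: c'_def a'_def m_comm\<close>)
    finally have "c' i \<in> \<mm>" using ind[OF c', of i] s i nk by (auto simp: J_def)
    thus "c i \<in> \<mm>" using i by (simp add: c'_def)
  qed
qed

end

subsection \<open>The family\<close>

lemma exact_zerodivisors_exact_pair:
  assumes nr: "noetherian_ring R" and loc: "local_ring R" and ex: "exact_zerodivisors R x y"
  shows "noetherian_base.exact_pair R x y"
proof -
  interpret noetherian_base R by (rule noetherian_base.intro[OF nr])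
  interpret local_cring R by (intro local_cring.intro crR local_cring_axioms.intro loc)
  have c: "x \<in> carrier R" "y \<in> carrier R" using ex m.Icarr by (auto simp: exact_zerodivisors_def)
  have a: "u \<otimes>\<^bsub>R\<^esub> v = \<zero>\<^bsub>R\<^esub> \<longleftrightarrow> (\<exists>b\<in>carrier R. v = w \<otimes>\<^bsub>R\<^esub> b)"
    if uw: "u \<in> carrier R" "w \<in> carrier R" and e: "ann R u = PIdl\<^bsub>R\<^esub> w" and v: "v \<in> carrier R" for u v w
  proof -
    have "u \<otimes>\<^bsub>R\<^esub> v = \<zero>\<^bsub>R\<^esub> \<longleftrightarrow> v \<in> ann R u" using v m_comm[OF uw(1) v] by (simp add: ann_def)
    also have "\<dots> \<longleftrightarrow> (\<exists>b\<in>carrier R. v = b \<otimes>\<^bsub>R\<^esub> w)" unfolding e by (auto simp: cgenideal_def)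
    also have "\<dots> \<longleftrightarrow> (\<exists>b\<in>carrier R. v = w \<otimes>\<^bsub>R\<^esub> b)" using m_comm[OF uw(2)] by metis
    finally show ?thesis .
  qed
  show ?thesis unfolding exact_pair_def
    using c ex a[OF c(1) c(2)] a[OF c(2) c(1)] by (auto simp: exact_zerodivisors_def)
qed

theorem theorem3p8:
  fixes R :: "'a ring" and x y :: 'a and n :: nat
  assumes "noetherian_ring R" and "local_ring R"
    and "exact_zerodivisors R x y"
    and "G_regular (R Quot (PIdl\<^bsub>R\<^esub> x))"
    and "0 < n" and "enat n < s_inv R x y"
  shows "\<exists>(M :: 'a \<Rightarrow> ('a, (nat \<Rightarrow> 'a) set) module) f g.
     (\<forall>r\<in>carrier R. Module.module R (M r) \<and>
        short_exact R (pow_mod (quot_mod R (PIdl\<^bsub>R\<^esub> x)) n) (M r) (quot_mod R (PIdl\<^bsub>R\<^esub> y)) (f r) (g r) \<and>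
        indecomposable R (M r)) \<and>
     (\<forall>p\<in>carrier R. \<forall>q\<in>carrier R. mod_iso R (M p) (M q) \<longrightarrow>
        max_ideal R +>\<^bsub>R\<^esub> p = max_ideal R +>\<^bsub>R\<^esub> q)"
proof -
  interpret noetherian_base R by (rule noetherian_base.intro[OF assms(1)])
  interpret local_cring R by (intro local_cring.intro crR local_cring_axioms.intro assms(2))
  interpret noetherian_local R by (intro noetherian_local.intro noetherian_base_axioms local_cring_axioms)
  note n = assms(5)
  let ?N = "Suc n" and ?J = "Idl\<^bsub>R\<^esub> {x, y}"
  have xym: "x \<in> \<mm>" "y \<in> \<mm>" using assms(3) by (auto simp: exact_zerodivisors_def)
  have xyR: "x \<in> carrier R" "y \<in> carrier R" using xym m.Icarr by auto
  have J: "ideal ?J R" by (rule genideal_ideal) (use xyR in auto)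
  interpret J: ideal ?J R by (rule J)
  have xyJ: "x \<in> ?J" "y \<in> ?J" using genideal_self[of "{x, y}"] xyR by auto
  have pair: "exact_pair x y" by (rule exact_zerodivisors_exact_pair[OF assms(1-3)])
  have epr: "exact_pair_ring R x y"
    by (intro exact_pair_ring.intro noetherian_base_axioms exact_pair_ring_axioms.intro pair)
  obtain a where a: "a \<in> carrier (F ?N)"
    and ind: "\<And>c i. c \<in> carrier (F ?N) \<Longrightarrow> dot n a c \<in> ?J \<Longrightarrow> i < ?N \<Longrightarrow> c i \<in> \<mm>"
    by (rule independent_elements[OF xym assms(6)]) blast
  interpret FN: Module.module R "F ?N" by (rule modF)
  note da = dot_hom[OF a]
  note dc = mod_hom_closed[OF da, unfolded ring_mod_simps]
  \<comment> \<open>Coefficient vectors of the \<open>z_i\<close> with respect to \<open>a\<close>: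
    the unit vector \<open>i\<close>, and for \<open>i = 0\<close> additionally \<open>r\<close> at
    position \<open>n\<close>.\<close>
  define w where "w r i = restrict (\<lambda>j. if j = i then \<one>\<^bsub>R\<^esub> else if i = 0 \<and> j = n then r else \<zero>\<^bsub>R\<^esub>) {..<?N}" for r i
  define z where "z r i = dot n a (w r i)" for r i
  have w: "w r i \<in> carrier (F ?N)" if "r \<in> carrier R" for r i
    unfolding w_def by (rule free_mod_memI) (use that in auto)
  have zR: "z r \<in> {..<n} \<rightarrow> carrier R" if "r \<in> carrier R" for r
    using dc[OF w[OF that]] by (simp add: z_def)
  have z_ind: "c i \<in> \<mm>"
    if r: "r \<in> carrier R" and c: "c \<in> {..<n} \<rightarrow> carrier R" and s: "(\<Oplus>\<^bsub>R\<^esub>i\<in>{..<n}. c i \<otimes>\<^bsub>R\<^esub> z r i) \<in> ?J" and i: "i < n"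
    for r c i
  proof -
    have cR: "\<And>i. i < n \<Longrightarrow> c i \<in> carrier R" using c by auto
    have wr: "w r \<in> {..<n} \<rightarrow> carrier (F ?N)" using w[OF r] by auto
    have cw: "\<And>i. i < n \<Longrightarrow> c i \<odot>\<^bsub>F ?N\<^esub> w r i \<in> carrier (F ?N)" using cR w[OF r] by simp
    \<comment> \<open>The coefficient vector of \<open>sum of c_i z_i\<close> with respect to
      \<open>a\<close>. The perturbation by \<open>r\<close> sits at position \<open>n\<close>, so
      at positions below \<open>n\<close> the entries of \<open>C\<close> are those of
      \<open>c\<close>.\<close>
    define C where "C = (\<Oplus>\<^bsub>F ?N\<^esub>i\<in>{..<n}. c i \<odot>\<^bsub>F ?N\<^esub> w r i)"
    have C: "C \<in> carrier (F ?N)" unfolding C_def using cw by (auto intro!: FN.finsum_closed)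
    have "dot n a C = (\<Oplus>\<^bsub>RR\<^esub>i\<in>{..<n}. dot n a (c i \<odot>\<^bsub>F ?N\<^esub> w r i))"
      unfolding C_def by (rule mod_hom_finsum[OF modF modR da]) (use cw in auto)
    also have "\<dots> = (\<Oplus>\<^bsub>R\<^esub>i\<in>{..<n}. c i \<otimes>\<^bsub>R\<^esub> z r i)"
      unfolding finsum_ring_mod
      by (rule finsum_cong') (use cR dc[OF w[OF r]] mod_hom_smult[OF da _ w[OF r]] in \<open>auto simp: z_def\<close>)
    finally have Cm: "C i \<in> \<mm>" using ind[OF C] s i by simp
    have iN: "i < ?N" using i by simp
    have "C i = (\<Oplus>\<^bsub>RR\<^esub>j\<in>{..<n}. (c j \<odot>\<^bsub>F ?N\<^esub> w r j) i)"
      unfolding C_def by (rule mod_hom_finsum[OF modF modR free_mod_coord[OF iN]]) (use cw in auto)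
    also have "\<dots> = (\<Oplus>\<^bsub>R\<^esub>j\<in>{..<n}. if i = j then c j else \<zero>\<^bsub>R\<^esub>)"
      unfolding finsum_ring_mod
      by (rule finsum_cong') (use i iN cR in \<open>auto simp: free_mod_nth w_def\<close>)
    also have "\<dots> = c i" by (rule finsum_singleton) (use i cR in auto)
    finally show ?thesis using Cm by simp
  qed
  have am: "dot n a u \<in> \<mm>" if u: "u \<in> carrier (F ?N)" for u
  proof -
    have coord: "a i \<in> \<mm>" if i: "i < ?N" for i
    proof -
      \<comment> \<open>A second index exists because \<open>n > 0\<close>. The trivial relation
        \<open>a_i a_j - a_j a_i = 0\<close> has coefficient vector \<open>c\<close> with entry
        \<open>a_i\<close> at \<open>j\<close>, and independence puts this entry in the maximal
        ideal.\<close>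
      obtain j where j: "j < ?N" "j \<noteq> i" using n by (metis less_Suc_eq zero_less_Suc not_less_iff_gr_or_eq)
      have ai: "a i \<in> carrier R" "a j \<in> carrier R" using free_mod_nth(1)[OF _ a] i j by auto
      define c where "c = (a i \<odot>\<^bsub>F ?N\<^esub> unitvec R ?N j) \<ominus>\<^bsub>F ?N\<^esub> (a j \<odot>\<^bsub>F ?N\<^esub> unitvec R ?N i)"
      have e: "unitvec R ?N k \<in> carrier (F ?N)" for k by (rule unitvec_closed[OF crR])
      have de: "dot n a (unitvec R ?N k) = a k" if "k < ?N" for k
        unfolding dot_lincomb[OF a e]
        by (rule lincomb_unitvec[OF modR _ that]) (use free_mod_nth(1)[OF _ a] in auto)
      have s: "a i \<odot>\<^bsub>F ?N\<^esub> unitvec R ?N j \<in> carrier (F ?N)" "a j \<odot>\<^bsub>F ?N\<^esub> unitvec R ?N i \<in> carrier (F ?N)"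
        using ai e by simp_all
      have c: "c \<in> carrier (F ?N)" unfolding c_def using s by simp
      have "dot n a c = a i \<otimes>\<^bsub>R\<^esub> a j \<ominus>\<^bsub>R\<^esub> a j \<otimes>\<^bsub>R\<^esub> a i"
        unfolding c_def mod_hom_minus[OF modF modR da s] mod_hom_smult[OF da ai(1) e] mod_hom_smult[OF da ai(2) e]
          de[OF i] de[OF j(1)] by (simp add: a_minus_def a_inv_ring_mod)
      hence "dot n a c = \<zero>\<^bsub>R\<^esub>" using ai m_comm[of "a i" "a j"] by (simp add: minus_eq r_neg)
      hence "c j \<in> \<mm>" using ind[OF c _ j(1)] J.zero_closed by simp
      moreover have "c j = a i"
        unfolding c_def free_mod_minus_nth[OF crR j(1) s] using j ai i
        by (simp add: free_mod_nth unitvec_def minus_eq)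
      ultimately show ?thesis by simp
    qed
    show ?thesis unfolding dot_def
      using coord free_mod_nth(1)[OF _ u] by (intro finsum_in_m m.I_r_closed) auto
  qed
  have pres: "presentation R x y n (z r)" if "r \<in> carrier R" for r
    by (intro presentation.intro epr presentation_axioms.intro zR[OF that])
  have lpres: "local_presentation R x y n (z r)" if r: "r \<in> carrier R" for r
  proof (intro local_presentation.intro pres[OF r] local_cring_axioms local_presentation_axioms.intro xym allI impI)
    fix c i assume c: "c \<in> {..<n} \<rightarrow> carrier R" and i: "i < n"
      and s: "\<exists>s\<in>carrier R. \<exists>t\<in>carrier R. (\<Oplus>\<^bsub>R\<^esub>i\<in>{..<n}. c i \<otimes>\<^bsub>R\<^esub> z r i) = x \<otimes>\<^bsub>R\<^esub> s \<oplus>\<^bsub>R\<^esub> y \<otimes>\<^bsub>R\<^esub> t"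
    have "(\<Oplus>\<^bsub>R\<^esub>i\<in>{..<n}. c i \<otimes>\<^bsub>R\<^esub> z r i) \<in> ?J"
      using s xyJ J.I_r_closed J.a_closed by auto
    thus "c i \<in> \<mm>" by (rule z_ind[OF r c _ i])
  qed
  define M where "M r = quot_module (F ?N) (pres R n x y (z r) ` carrier (F ?N))" for r
  have "\<exists>f g. short_exact R (pow_mod (quot_mod R (PIdl\<^bsub>R\<^esub> x)) n) (M r) (quot_mod R (PIdl\<^bsub>R\<^esub> y)) f g"
    if "r \<in> carrier R" for r
    using presentation.short_exact_presentation[OF pres[OF that]] by (simp add: M_def)
  then obtain f g where fg: "\<And>r. r \<in> carrier R \<Longrightarrow>
      short_exact R (pow_mod (quot_mod R (PIdl\<^bsub>R\<^esub> x)) n) (M r) (quot_mod R (PIdl\<^bsub>R\<^esub> y)) (f r) (g r)"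
    by metis
  have mod: "Module.module R (M r)" if "r \<in> carrier R" for r
    unfolding M_def by (rule presentation.modM[OF pres[OF that]])
  have indec: "indecomposable R (M r)" if "r \<in> carrier R" for r
    unfolding M_def by (rule local_presentation.indecomposable_M[OF lpres[OF that] assms(4)])
  have iso: "\<mm> +>\<^bsub>R\<^esub> p = \<mm> +>\<^bsub>R\<^esub> q"
    if p: "p \<in> carrier R" and q: "q \<in> carrier R" and pq: "mod_iso R (M p) (M q)" for p q
  proof -
    \<comment> \<open>A linear form on coefficient vectors that vanishes on every
      \<open>w p i\<close> with \<open>i < n\<close> and takes the value \<open>q - p\<close> on
      \<open>w q 0\<close>. It detects the parameter once shown to vanish there modulo the maximal
      ideal.\<close>
    define \<chi> where "\<chi> u = u n \<ominus>\<^bsub>R\<^esub> p \<otimes>\<^bsub>R\<^esub> u 0" for u :: "nat \<Rightarrow> 'a"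
    have \<chi>: "\<chi> \<in> mod_hom R (F ?N) RR"
      using mod_hom_diff[OF modR free_mod_coord[of n ?N R] mod_hom_scale[OF modR p free_mod_coord[of 0 ?N R]]]
      by (simp add: \<chi>_def[abs_def] a_minus_def a_inv_ring_mod)
    define C where "C = {u \<in> carrier (F ?N). \<chi> u \<in> \<mm>}"
    have C: "submodule C R (F ?N)"
    proof (rule FN.submoduleI)
      show "\<zero>\<^bsub>F ?N\<^esub> \<in> C" using mod_hom_zero[OF modF modR \<chi>] m.zero_closed by (simp add: C_def)
      show "\<ominus>\<^bsub>F ?N\<^esub> u \<in> C" if "u \<in> C" for u
        using that mod_hom_neg[OF modF modR \<chi>, of u] by (auto simp: C_def a_inv_ring_mod)
      show "u \<oplus>\<^bsub>F ?N\<^esub> v \<in> C" if "u \<in> C" "v \<in> C" for u v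
        using that mod_hom_add[OF \<chi>, of u v] by (auto simp: C_def)
      show "b \<odot>\<^bsub>F ?N\<^esub> u \<in> C" if "b \<in> carrier R" "u \<in> C" for b u
        using that mod_hom_smult[OF \<chi>, of b u] m.I_l_closed by (auto simp: C_def)
    qed (auto simp: C_def)
    \<comment> \<open>The values of \<open>a\<close> on coefficient vectors with
      \<open>\<chi>\<close> in the maximal ideal, enlarged by \<open>(x,y)\<close>. It contains each
      \<open>z p i\<close>, where \<open>\<chi>\<close> is zero, and each multiple of
      \<open>z q i\<close> by an element of the maximal ideal.\<close>
    define W where "W = dot n a ` C <+>\<^bsub>R\<^esub> ?J"
    have dC: "ideal (dot n a ` C) R"
      by (rule submodule_ring_mod_ideal[OF crR submodule_image[OF modF modR da C]])
    have W: "ideal W R" unfolding W_def by (rule add_ideals[OF dC J])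
    have CW: "dot n a u \<in> W" if u: "u \<in> C" for u
    proof -
      have "dot n a u = dot n a u \<oplus>\<^bsub>R\<^esub> \<zero>\<^bsub>R\<^esub>" using dc u by (simp add: C_def)
      thus ?thesis unfolding W_def set_add_iff using u J.zero_closed by blast
    qed
    have JW: "j \<in> W" if j: "j \<in> ?J" for j
    proof -
      interpret D: ideal "dot n a ` C" R by (rule dC)
      have "j = \<zero>\<^bsub>R\<^esub> \<oplus>\<^bsub>R\<^esub> j" using j J.Icarr by simp
      thus ?thesis unfolding W_def set_add_iff using j D.zero_closed by blast
    qed
    have \<chi>w: "\<chi> (w r i) = (if i = 0 then r \<ominus>\<^bsub>R\<^esub> p else \<zero>\<^bsub>R\<^esub>)" if "r \<in> carrier R" "i < n" for r i
      using that n p by (auto simp: \<chi>_def w_def minus_eq)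
    interpret P: presentation R x y n "z p" by (rule pres[OF p])
    have zq: "z q 0 \<in> W"
    proof (rule P.presentation_iso_ideal[OF local_cring_axioms _ xym W JW[OF xyJ(1)] JW[OF xyJ(2)] _ _ _ n])
      show "z q \<in> {..<n} \<rightarrow> \<mm>" using am w[OF q] by (auto simp: z_def)
      show "z p i \<in> W" if "i < n" for i
        unfolding z_def using \<chi>w[OF p that] p w[OF p] by (intro CW) (auto simp: C_def minus_eq r_neg)
      show "z q i \<otimes>\<^bsub>R\<^esub> c \<in> W" if i: "i < n" and c: "c \<in> \<mm>" for i c
      proof -
        have cR: "c \<in> carrier R" using c by (rule m.Icarr)
        have "\<chi> (w q i) \<in> carrier R" using mod_hom_closed[OF \<chi> w[OF q]] by simp
        hence "c \<odot>\<^bsub>F ?N\<^esub> w q i \<in> C"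
          using mod_hom_smult[OF \<chi> cR w[OF q, of i]] cR w[OF q] c by (simp add: C_def m.I_r_closed)
        from CW[OF this] have "c \<otimes>\<^bsub>R\<^esub> z q i \<in> W"
          using mod_hom_smult[OF da cR w[OF q, of i]] by (simp add: z_def)
        thus ?thesis using m_comm[OF cR dc[OF w[OF q, of i]]] by (simp add: z_def)
      qed
      show "mod_iso R (quot_module (F ?N) (pres R n x y (z p) ` carrier (F ?N)))
          (quot_module (F ?N) (pres R n x y (z q) ` carrier (F ?N)))"
        using pq by (simp add: M_def)
    qed
    then obtain u j where u: "u \<in> C" "j \<in> ?J" "z q 0 = dot n a u \<oplus>\<^bsub>R\<^esub> j"
      unfolding W_def set_add_iff by blast
    have uF: "u \<in> carrier (F ?N)" "u n \<ominus>\<^bsub>R\<^esub> p \<otimes>\<^bsub>R\<^esub> u 0 \<in> \<mm>" using u(1) by (auto simp: C_def \<chi>_def)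
    have uR: "u n \<in> carrier R" "u 0 \<in> carrier R" using free_mod_nth(1)[OF _ uF(1)] by auto
    have jR: "j \<in> carrier R" using u(2) by (rule J.Icarr)
    \<comment> \<open>Two coefficient vectors of \<open>z q 0\<close> modulo \<open>(x,y)\<close>.
      Their difference represents \<open>j\<close> in \<open>(x,y)\<close>, so by independence all
      its entries lie in the maximal ideal.\<close>
    define d where "d = w q 0 \<ominus>\<^bsub>F ?N\<^esub> u"
    have d: "d \<in> carrier (F ?N)" unfolding d_def using w[OF q] uF by simp
    have "dot n a d = z q 0 \<ominus>\<^bsub>R\<^esub> dot n a u"
      unfolding d_def mod_hom_minus[OF modF modR da w[OF q] uF(1)] by (simp add: z_def a_minus_def a_inv_ring_mod)
    also have "\<dots> = j" unfolding u(3) using dc[OF uF(1)] jR by (simp add: minus_eq a_comm[of _ j] a_assoc r_neg)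
    finally have dm: "d i \<in> \<mm>" if "i < ?N" for i using ind[OF d _ that] u(2) by simp
    have d0: "d 0 = \<one>\<^bsub>R\<^esub> \<ominus>\<^bsub>R\<^esub> u 0" and dn: "d n = q \<ominus>\<^bsub>R\<^esub> u n"
      unfolding d_def using free_mod_minus_nth[OF crR _ w[OF q, of 0] uF(1)] n by (auto simp: w_def)
    \<comment> \<open>This is \<open>\<chi> (w q 0) = \<chi> d + \<chi> u\<close> written out; every
      term on the right lies in the maximal ideal.\<close>
    have "q \<ominus>\<^bsub>R\<^esub> p = d n \<oplus>\<^bsub>R\<^esub> (u n \<ominus>\<^bsub>R\<^esub> p \<otimes>\<^bsub>R\<^esub> u 0) \<oplus>\<^bsub>R\<^esub> \<ominus>\<^bsub>R\<^esub> (p \<otimes>\<^bsub>R\<^esub> d 0)"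
    proof -
      have 1: "\<ominus>\<^bsub>R\<^esub> (p \<otimes>\<^bsub>R\<^esub> d 0) = \<ominus>\<^bsub>R\<^esub> p \<oplus>\<^bsub>R\<^esub> p \<otimes>\<^bsub>R\<^esub> u 0"
        unfolding d0 using p uR by (simp add: minus_eq r_distr r_minus minus_add)
      have "d n \<oplus>\<^bsub>R\<^esub> (u n \<ominus>\<^bsub>R\<^esub> p \<otimes>\<^bsub>R\<^esub> u 0) = q \<ominus>\<^bsub>R\<^esub> p \<otimes>\<^bsub>R\<^esub> u 0"
        unfolding dn using q p uR by (simp add: minus_eq a_assoc[symmetric]) (simp add: a_assoc l_neg q)
      thus ?thesis unfolding 1 using q p uR
        by (simp add: minus_eq a_assoc a_lcomm[of "\<ominus>\<^bsub>R\<^esub> (p \<otimes>\<^bsub>R\<^esub> u 0)"] l_neg)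
    qed
    also have "\<dots> \<in> \<mm>"
      by (intro m.a_closed m.a_inv_closed m.I_l_closed uF(2) dm p) auto
    finally have "q \<ominus>\<^bsub>R\<^esub> p \<in> \<mm>" .
    thus ?thesis using quotient_eq_iff_same_a_r_cos[OF m.ideal_axioms q p] by simp
  qed
  show ?thesis
    by (rule exI[of _ M], rule exI[of _ f], rule exI[of _ g]) (use mod fg indec iso in auto)
qed

end
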